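(* Let $0<p<1/2$. There exist functions $\delta:(0,1]\to(0,1]$ and $j:(0,1]\to\mathbb{N}$, depending only on $p$, with the following property (P): for every $n\ge1$, every $g:\{0,1\}^n\to[0,1]$ and every $\varepsilon\in(0,1]$, if $\mathrm{Edge}(g)\le\delta(\varepsilon)$ then there exist $J\subseteq[n]$ with $|J|\le j(\varepsilon)$ and an intersecting family $T\subseteq\{0,1\}^J$ such that $$\mathbb{E}_{w\in\{0,1\}^J}\big[\mathbb{1}_{\overline T}(w)\,\mathbb{E}_{x\in\{0,1\}^{[n]\setminus J}}[g(w,x)]\big]\le\varepsilon,$$ with expectations taken with respect to $\mu_p$. For any functions $\delta,j$ with property (P) the following holds. For every $\varepsilon\in(0,1]$ and all sufficiently large $n$ such that $k=pn$ is a positive integer: if $f:\binom{[n]}{k}\to[0,1]$ satisfies $$\mathrm{Edge}(f):=\sum_{(x,y):\,x\cap y=\emptyset}\frac{f(x)f(y)}{\binom nk\binom{n-k}{k}}\le\delta(\varepsilon)$$ (sum over ordered pairs of disjoint $x,y\in\binom{[n]}{k}$, i.e. over the edges of the Kneser graph), then there exist $J\subseteq[n]$ with $|J|\le j(\varepsilon)$ and $T\subseteq\{0,1\}^J$ such that 1. $T$ is an intersecting family, and 2. $\displaystyle \binom nk^{-1}\sum_{x\in\binom{[n]}{k}:\ (x\cap J)\notin T} f(x)\le 5\varepsilon.$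
   Context: Subsets of a finite set $J$ are identified with elements of $\{0,1\}^J$, and $\binom{[n]}{k}$ is the set of $k$-element subsets of $[n]$. The Kneser graph $G(n,k)$ has vertex set $\binom{[n]}{k}$ and edges the pairs $\{x,y\}$ with $x\cap y=\emptyset$. A family $T\subseteq\{0,1\}^J$ is intersecting if $w\cap w'\ne\emptyset$ for all $w,w'\in T$ (including $w=w'$, so $\emptyset\notin T$). $\mu_p$ is the product measure $\mu_p(x)=p^{|x|}(1-p)^{m-|x|}$ on the cube $\{0,1\}^m$ (and likewise on $\{0,1\}^J$). For disjoint $x,y\subseteq[n]$, $\mu_{p,p}(x,y)=p^{|x|}p^{|y|}(1-2p)^{n-|x|-|y|}$, and for $g:\{0,1\}^n\to[0,1]$, $\mathrm{Edge}(g)=\sum_{x\cap y=\emptyset}g(x)g(y)\mu_{p,p}(x,y)$, the sum being over ordered pairs of disjoint subsets of $[n]$. $(w,x)$ denotes the element of $\{0,1\}^n$ obtained by merging $w\in\{0,1\}^J$ and $x\in\{0,1\}^{[n]\setminus J}$. "Sufficiently large $n$" means $n\ge n_0$ where $n_0$ may depend on $p$, $\varepsilon$ and the functions $\delta,j$, but not on $f$. *)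

theory Defs
  imports "HOL-Analysis.Analysis" "HOL-Library.Ramsey"
begin

text \<open>
  \<^term>\<open>{1..n}\<close> plays the role of $[n]$, a point of the cube $\{0,1\}^J$ is a subset of $J$,
  and \<^term>\<open>nsets {1..n} k\<close> is the family of $k$-element subsets of $[n]$.
  Functions on a cube or on a slice are total functions on sets, of which only the values on
  \<^term>\<open>Pow J\<close>, respectively \<^term>\<open>nsets {1..n} k\<close>, are ever used.
\<close>

definition mu :: "real \<Rightarrow> 'a set \<Rightarrow> 'a set \<Rightarrow> real" where
  "mu p J x = p ^ card x * (1 - p) ^ (card J - card x)"

definition cube_expectation :: "real \<Rightarrow> 'a set \<Rightarrow> ('a set \<Rightarrow> real) \<Rightarrow> real" where
  "cube_expectation p J h = (\<Sum>x\<in>Pow J. mu p J x * h x)"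

definition mu_pair :: "real \<Rightarrow> nat \<Rightarrow> nat set \<Rightarrow> nat set \<Rightarrow> real" where
  "mu_pair p n x y = p ^ card x * p ^ card y * (1 - 2 * p) ^ (n - card x - card y)"

definition cube_edge :: "real \<Rightarrow> nat \<Rightarrow> (nat set \<Rightarrow> real) \<Rightarrow> real" where
  "cube_edge p n g =
     (\<Sum>(x, y) \<in> {(x, y). x \<subseteq> {1..n} \<and> y \<subseteq> {1..n} \<and> x \<inter> y = {}}. g x * g y * mu_pair p n x y)"

text \<open>The sum is over ordered pairs, so every edge of the Kneser graph is counted twice.\<close>

definition kneser_edge :: "nat \<Rightarrow> nat \<Rightarrow> (nat set \<Rightarrow> real) \<Rightarrow> real" where
  "kneser_edge n k f =
     (\<Sum>(x, y) \<in> {(x, y). x \<in> nsets {1..n} k \<and> y \<in> nsets {1..n} k \<and> x \<inter> y = {}}.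
        f x * f y / (real (n choose k) * real ((n - k) choose k)))"

text \<open>The case \<open>w = w'\<close> is included, so the empty set is not in \<open>T\<close>.\<close>

definition intersecting_family :: "'a set \<Rightarrow> 'a set set \<Rightarrow> bool" where
  "intersecting_family J T \<longleftrightarrow> T \<subseteq> Pow J \<and> (\<forall>w\<in>T. \<forall>w'\<in>T. w \<inter> w' \<noteq> {})"

text \<open>
  \<open>\<delta>\<close> and \<open>j\<close> stand for functions on $(0,1]$; their values elsewhere are irrelevant.
  For \<open>w \<subseteq> J\<close> and \<open>x \<subseteq> {1..n} - J\<close>, the merged point $(w,x)$ is \<open>w \<union> x\<close>.
\<close>

definition removal_property :: "real \<Rightarrow> (real \<Rightarrow> real) \<Rightarrow> (real \<Rightarrow> nat) \<Rightarrow> bool" where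
  "removal_property p \<delta> j \<longleftrightarrow>
     (\<forall>n\<ge>1. \<forall>g. \<forall>\<epsilon>\<in>{0<..1}.
        (\<forall>x\<in>Pow {1..n}. g x \<in> {0..1}) \<longrightarrow> cube_edge p n g \<le> \<delta> \<epsilon> \<longrightarrow>
        (\<exists>J T. J \<subseteq> {1..n} \<and> card J \<le> j \<epsilon> \<and> intersecting_family J T \<and>
           cube_expectation p J
             (\<lambda>w. indicator (Pow J - T) w *
                  cube_expectation p ({1..n} - J) (\<lambda>x. g (w \<union> x))) \<le> \<epsilon>))"

end

theory Submission
  imports Defs
begin

text \<open>
  Cube. A $\mu_{p,p}$-random disjoint pair is a pair of points of the cube with coordinatewise
  correlation $\lambda = -p/(1-p)$, and $|\lambda| < 1$. If $f,g$ have no influential coordinates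
  after a little noise, then replacing the coordinates one at a time by their averages and using the
  Taylor expansion of $(uv)^a$ gives $E[f(x)g(y)] \ge E[(f(x)g(y))^a] \ge (Ef\,Eg)^a - o(1)$:
  the quadratic terms have the right sign for large $a$, and the cubic ones are small by
  hypercontractivity. An energy increment argument yields a bounded set $J$ such that for most $w$
  the restriction of $g$ to $w$ has no influential coordinates; the $w$ on which in addition this
  restriction has mean above $\varepsilon/2$ form the intersecting family.

  Slice. Given $f$ on $k$-sets, let $g(z)$ be the average of $f$ over the $k$-subsets of $z$, and $0$ when
  $|z| < k$. A uniform $k$-subset of each member of a disjoint pair gives a uniform disjoint pair of
  $k$-sets, so Edge($g$) is at most Edge($f$). With probability about $1/2$ the size of $z$ lies in
  $[k, k + o(n)]$, and then a random $k$-subset of $z$ has the same trace on $J$ with probability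
  $1 - o(1)$; this accounts for the factor $5$.
\<close>

section \<open>Sums over the subsets of a finite set\<close>

text \<open>On the cube the obstacle is that disjoint pairs are negatively correlated: expanding uv
  itself leaves only a cross term of the wrong sign. The power a supplies squares that dominate it,
  and it costs only a power of the means, which the choice of \<delta> absorbs. One set J must serve
  all its subsets w at once, because the members of T are compared with one another inside J. Hence
  J collects every point that is influential for some w, its size is bounded by an iterated
  exponential, and \<delta> carries a lower bound for the probability of a disjoint pair in J. On
  the slice, \<delta> and j are arbitrary functions with the removal property, with no continuity to
  exploit. So g must satisfy Edge(g) \<le> \<delta>(\<epsilon>) without any error term, and the J
  and T found for g must serve f unchanged. Averaging over k-subsets is chosen for this reason: it
  compares the two edge densities without loss, and all the loss is left to the passage from the
  mass of g outside T back to that of f, where a constant factor is allowed.\<close>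

lemma sum_Pow_insert:
  fixes h :: "'a set \<Rightarrow> real"
  assumes "finite V" "i \<notin> V"
  shows "(\<Sum>x\<in>Pow (insert i V). h x) = (\<Sum>x\<in>Pow V. h x) + (\<Sum>x\<in>Pow V. h (insert i x))"
proof -
  have "inj_on (insert i) (Pow V)"
    using assms(2) by (intro inj_onI) (metis PowD insert_ident subsetD)
  then show ?thesis
    using assms by (subst Pow_insert, subst sum.union_disjoint) (auto simp: sum.reindex)
qed

lemma sum_Pow_union:
  fixes h :: "'a set \<Rightarrow> real"
  assumes "finite J" "finite V" "J \<inter> V = {}"
  shows "(\<Sum>Z\<in>Pow (J \<union> V). h Z) = (\<Sum>R\<in>Pow J. \<Sum>S\<in>Pow V. h (R \<union> S))"
  using assms
proof (induction J arbitrary: h rule: finite_induct)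
  case (insert i J)
  then have "(\<Sum>Z\<in>Pow (insert i J \<union> V). h Z) = (\<Sum>Z\<in>Pow (J \<union> V). h Z) + (\<Sum>Z\<in>Pow (J \<union> V). h (insert i Z))"
    using sum_Pow_insert[of "J \<union> V" i h] by simp
  then show ?case
    using insert by (simp add: sum_Pow_insert)
qed simp

lemma sum_sum_Pow_member:
  fixes w :: "'a set \<Rightarrow> real"
  assumes "finite V"
  shows "(\<Sum>i\<in>V. \<Sum>S\<in>Pow V. if i \<in> S then w S else 0) = (\<Sum>S\<in>Pow V. real (card S) * w S)"
proof -
  have "(\<Sum>i\<in>V. if i \<in> S then w S else 0) = real (card S) * w S" if "S \<in> Pow V" for S
  proof -
    have "V \<inter> {i. i \<in> S} = S" using that by auto
    then show ?thesis using assms by (simp flip: sum.inter_restrict add: sum.If_cases)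
  qed
  then show ?thesis by (subst sum.swap) simp
qed

text \<open>Inserting \<open>i\<close> is a bijection from the subsets of \<open>V\<close> avoiding
  \<open>i\<close> to those containing it. It matches the coefficients of a discrete derivative,
  indexed by sets avoiding \<open>i\<close>, with an influence, indexed by sets containing
  \<open>i\<close>.\<close>

lemma sum_Pow_shift:
  fixes w :: "'a set \<Rightarrow> real"
  assumes "finite V" "i \<in> V"
  shows "(\<Sum>S\<in>Pow V. if i \<in> S then 0 else w (insert i S)) = (\<Sum>S\<in>Pow V. if i \<in> S then w S else 0)"
proof -
  define W where "W = V - {i}"
  have W: "finite W" "i \<notin> W" "V = insert i W" using assms by (auto simp: W_def)
  have "i \<notin> S" if "S \<in> Pow W" for S using that W by auto
  then show ?thesis
    unfolding W(3) sum_Pow_insert[OF W(1,2)] by simp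
qed

section \<open>Fourier analysis on the biased cube\<close>

locale biased_cube =
  fixes p :: real
  assumes p_pos: "0 < p" and p_less: "p < 1/2"
begin

section \<open>Expectation under the biased product measure\<close>

abbreviation E :: "'a set \<Rightarrow> ('a set \<Rightarrow> real) \<Rightarrow> real" where
  "E \<equiv> cube_expectation p"

lemma E_empty [simp]: "E {} h = h {}"
  by (simp add: cube_expectation_def mu_def)

lemma E_insert:
  assumes "finite V" "i \<notin> V"
  shows "E (insert i V) h = (1 - p) * E V h + p * E V (\<lambda>x. h (insert i x))"
proof -
  have 1: "mu p (insert i V) x = (1 - p) * mu p V x" if "x \<in> Pow V" for x
  proof -
    have "card x \<le> card V" using that assms by (simp add: card_mono)
    then show ?thesis using assms by (simp add: mu_def Suc_diff_le)
  qed
  have 2: "mu p (insert i V) (insert i x) = p * mu p V x" if "x \<in> Pow V" for x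
  proof -
    have "i \<notin> x" "finite x" using that assms finite_subset by auto
    then show ?thesis using assms by (simp add: mu_def)
  qed
  show ?thesis
    unfolding cube_expectation_def sum_Pow_insert[OF assms] sum_distrib_left
    by (intro arg_cong2[where f = "(+)"] sum.cong) (simp_all add: 1 2)
qed

lemma mu_nonneg: "mu p V x \<ge> 0"
  using p_pos p_less by (simp add: mu_def)

lemma E_cong: "(\<And>x. x \<subseteq> V \<Longrightarrow> f x = g x) \<Longrightarrow> E V f = E V g"
  by (auto simp: cube_expectation_def intro!: sum.cong)

lemma E_mono: "(\<And>x. x \<subseteq> V \<Longrightarrow> f x \<le> g x) \<Longrightarrow> E V f \<le> E V g"
  by (auto simp: cube_expectation_def intro!: sum_mono mult_left_mono mu_nonneg)

lemma E_add: "E V (\<lambda>x. f x + g x) = E V f + E V g"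
  by (simp add: cube_expectation_def sum.distrib algebra_simps)

lemma E_diff: "E V (\<lambda>x. f x - g x) = E V f - E V g"
  by (simp add: cube_expectation_def sum_subtractf algebra_simps)

lemma E_cmult: "E V (\<lambda>x. c * f x) = c * E V f"
  by (simp add: cube_expectation_def sum_distrib_left algebra_simps)

lemma E_multc: "E V (\<lambda>x. f x * c) = E V f * c"
  by (simp add: cube_expectation_def sum_distrib_left sum_distrib_right algebra_simps)

lemma E_sum: "E V (\<lambda>x. \<Sum>s\<in>A. f s x) = (\<Sum>s\<in>A. E V (f s))"
  unfolding cube_expectation_def sum_distrib_left by (rule sum.swap)

lemma E_const: "finite V \<Longrightarrow> E V (\<lambda>x. c) = c"
  by (induction V rule: finite_induct) (simp_all add: E_insert algebra_simps)

lemma E_nonneg: "(\<And>x. x \<subseteq> V \<Longrightarrow> 0 \<le> f x) \<Longrightarrow> 0 \<le> E V f"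
  by (auto simp: cube_expectation_def intro!: sum_nonneg mult_nonneg_nonneg mu_nonneg)

lemma E_union:
  assumes "finite J" "finite V" "J \<inter> V = {}"
  shows "E (J \<union> V) h = E J (\<lambda>w. E V (\<lambda>x. h (w \<union> x)))"
  using assms
proof (induction J arbitrary: h rule: finite_induct)
  case (insert i J)
  then have "E (insert i J \<union> V) h
      = (1 - p) * E (J \<union> V) h + p * E (J \<union> V) (\<lambda>x. h (insert i x))"
    using E_insert[of "J \<union> V" i h] by simp
  then show ?case
    using insert by (simp add: E_insert)
qed simp

text \<open>The standardised indicator of a point: for a bit that is set with probability
  \<open>p\<close> it has mean 0 and variance 1, so that the products \<open>chi\<close> are
  orthonormal.\<close>

definition phi :: "bool \<Rightarrow> real" where
  "phi b = (if b then sqrt ((1 - p) / p) else - sqrt (p / (1 - p)))"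

definition chi :: "'a set \<Rightarrow> 'a set \<Rightarrow> real" where
  "chi S x = (\<Prod>i\<in>S. phi (i \<in> x))"

lemma phi_mult:
  "phi True * phi True = (1 - p) / p" "phi False * phi False = p / (1 - p)"
  "phi True * phi False = -1" "phi False * phi True = -1"
  using p_pos p_less by (simp_all add: phi_def flip: real_sqrt_mult)

lemma phi_mean: "(1 - p) * phi False + p * phi True = 0"
proof -
  have "phi True \<noteq> 0" using phi_mult(3) by auto
  moreover have "phi True * ((1 - p) * phi False + p * phi True) = 0"
  proof -
    have "phi True * ((1 - p) * phi False + p * phi True)
        = (1 - p) * (phi True * phi False) + p * (phi True * phi True)"
      by (simp only: algebra_simps)
    then show ?thesis using p_pos by (simp add: phi_mult)
  qed
  ultimately show ?thesis by simp
qed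

lemma phi_var: "(1 - p) * (phi False)^2 + p * (phi True)^2 = 1"
  using p_pos p_less by (simp add: power2_eq_square phi_mult)

lemma phi_diff_sq: "(phi True - phi False)^2 = 1 / (p * (1 - p))"
  using p_pos p_less by (simp add: power2_eq_square algebra_simps phi_mult) (simp add: field_simps)

text \<open>The density, against two independent copies of the biased measure, of a pair of points
  whose coordinates have correlation \<open>r\<close>. One formula covers point evaluation
  (\<open>r = 1\<close>), noise (\<open>r = s\<close>) and disjoint pairs
  (\<open>r = lam\<close>).\<close>

definition kern :: "real \<Rightarrow> 'a set \<Rightarrow> 'a set \<Rightarrow> 'a set \<Rightarrow> real" where
  "kern r V x y = (\<Prod>i\<in>V. 1 + r * phi (i \<in> x) * phi (i \<in> y))"

lemma kern_expand:
  assumes "finite V"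
  shows "kern r V x y = (\<Sum>S\<in>Pow V. r ^ card S * chi S x * chi S y)"
proof -
  have "kern r V x y = (\<Prod>i\<in>V. r * phi (i \<in> x) * phi (i \<in> y) + 1)"
    by (simp add: kern_def add.commute)
  also have "\<dots> = (\<Sum>S\<in>Pow V. r ^ card S * chi S x * chi S y)"
    by (simp add: prod_add[OF assms] chi_def prod.distrib)
  finally show ?thesis .
qed

lemma kern_insert:
  assumes "finite V" "i \<notin> V"
  shows "kern r (insert i V) x y = (1 + r * phi (i \<in> x) * phi (i \<in> y)) * kern r V x y"
  using assms by (simp add: kern_def)

lemma kern_insert_arg:
  assumes "i \<notin> V"
  shows "kern r V (insert i x) y = kern r V x y" "kern r V x (insert i y) = kern r V x y"
proof -
  have "j \<in> insert i x \<longleftrightarrow> j \<in> x" if "j \<in> V" for j x using assms that by auto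
  then show "kern r V (insert i x) y = kern r V x y" "kern r V x (insert i y) = kern r V x y"
    unfolding kern_def by (intro prod.cong refl; simp)+
qed

text \<open>The product of two values of \<open>phi\<close> is -1 when the bits differ and positive
  when they agree, so no factor becomes negative for \<open>r\<close> up to 1.\<close>

lemma kern_nonneg:
  assumes "0 \<le> r" "r \<le> 1"
  shows "kern r V x y \<ge> 0"
  unfolding kern_def
proof (rule prod_nonneg)
  fix i
  have "phi a * phi b \<ge> -1" for a b
    using p_pos p_less by (cases a; cases b) (auto simp: phi_mult intro: order_trans[of _ 0])
  from this[of "i \<in> x" "i \<in> y"] show "0 \<le> 1 + r * phi (i \<in> x) * phi (i \<in> y)"
    using assms mult_left_mono[of "-1" "phi (i \<in> x) * phi (i \<in> y)" r] by (simp add: mult.assoc)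
qed

text \<open>At \<open>r = 1\<close> a factor vanishes when the bits differ and is the reciprocal of
  the point mass when they agree, so the kernel reproduces \<open>f\<close>. Expanding it in
  characters then gives \<open>parseval\<close>.\<close>

lemma E_kern_one:
  assumes "finite V" "x \<subseteq> V"
  shows "E V (\<lambda>y. f y * kern 1 V x y) = f x"
  using assms
proof (induction V arbitrary: f x rule: finite_induct)
  case empty
  then show ?case by (simp add: kern_def)
next
  case (insert i V)
  have xV: "x - {i} \<subseteq> V" using insert.prems by auto
  have i: "i \<notin> y" if "y \<subseteq> V" for y using that insert.hyps by auto
  have k: "kern 1 V x y = kern 1 V (x - {i}) y" for y
    using insert.hyps(2) by (cases "i \<in> x") (simp_all flip: kern_insert_arg(1)[of i V 1 "x - {i}"] add: insert_absorb)
  have "E (insert i V) (\<lambda>y. f y * kern 1 (insert i V) x y)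
      = (1 - p) * E V (\<lambda>y. f y * kern 1 (insert i V) x y)
        + p * E V (\<lambda>y. f (insert i y) * kern 1 (insert i V) x (insert i y))"
    using insert.hyps by (rule E_insert)
  also have "E V (\<lambda>y. f y * kern 1 (insert i V) x y)
      = (1 + phi (i \<in> x) * phi False) * E V (\<lambda>y. f y * kern 1 V (x - {i}) y)"
    unfolding E_cmult[symmetric]
    using insert.hyps i by (intro E_cong) (simp add: kern_insert k)
  also have "E V (\<lambda>y. f (insert i y) * kern 1 (insert i V) x (insert i y))
      = (1 + phi (i \<in> x) * phi True) * E V (\<lambda>y. f (insert i y) * kern 1 V (x - {i}) y)"
    unfolding E_cmult[symmetric]
    using insert.hyps by (intro E_cong) (simp add: kern_insert kern_insert_arg k)
  also have "E V (\<lambda>y. f y * kern 1 V (x - {i}) y) = f (x - {i})"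
    using insert.IH[OF xV] .
  also have "E V (\<lambda>y. f (insert i y) * kern 1 V (x - {i}) y) = f (insert i (x - {i}))"
    using insert.IH[OF xV] .
  also have "(1 - p) * ((1 + phi (i \<in> x) * phi False) * f (x - {i}))
      + p * ((1 + phi (i \<in> x) * phi True) * f (insert i (x - {i}))) = f x"
  proof -
    have "(1 - p) * (1 + phi False * phi False) = 1" "p * (1 + phi True * phi True) = 1"
      using p_pos p_less by (simp_all add: phi_mult field_simps)
    then show ?thesis
      by (cases "i \<in> x") (simp_all add: phi_mult insert_absorb flip: mult.assoc)
  qed
  finally show ?case by simp
qed

definition coef :: "'a set \<Rightarrow> ('a set \<Rightarrow> real) \<Rightarrow> 'a set \<Rightarrow> real" where
  "coef V f S = E V (\<lambda>x. f x * chi S x)"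

lemma E_kern:
  assumes "finite V"
  shows "E V (\<lambda>y. f y * kern r V x y) = (\<Sum>S\<in>Pow V. r ^ card S * coef V f S * chi S x)"
  by (simp add: kern_expand[OF assms] sum_distrib_left E_sum coef_def mult.assoc
      flip: E_cmult E_multc) (simp add: ac_simps)

lemma E_E_kern:
  assumes "finite V"
  shows "E V (\<lambda>x. E V (\<lambda>y. f x * g y * kern r V x y))
       = (\<Sum>S\<in>Pow V. r ^ card S * coef V f S * coef V g S)"
proof -
  have "E V (\<lambda>x. E V (\<lambda>y. f x * g y * kern r V x y))
     = E V (\<lambda>x. f x * (\<Sum>S\<in>Pow V. r ^ card S * coef V g S * chi S x))"
    unfolding E_kern[OF assms, symmetric] E_cmult[symmetric] by (simp add: mult.assoc)
  also have "\<dots> = (\<Sum>S\<in>Pow V. r ^ card S * coef V g S * coef V f S)"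
    by (simp add: sum_distrib_left E_sum coef_def flip: E_cmult) (simp add: ac_simps)
  finally show ?thesis by (simp add: ac_simps)
qed

lemma parseval:
  assumes "finite V"
  shows "E V (\<lambda>x. f x * g x) = (\<Sum>S\<in>Pow V. coef V f S * coef V g S)"
proof -
  have "E V (\<lambda>x. E V (\<lambda>y. f x * g y * kern 1 V x y)) = E V (\<lambda>x. f x * g x)"
    using assms by (intro E_cong) (simp add: E_kern_one mult.assoc E_cmult)
  then show ?thesis using E_E_kern[OF assms, of f g 1] by simp
qed

text \<open>The expectation over a random pair of disjoint sets whose marginals are both $\mu_p$;
  \<^term>\<open>lam\<close> is the correlation of the two indicators of a point.\<close>

definition pairexp :: "'a set \<Rightarrow> ('a set \<Rightarrow> 'a set \<Rightarrow> real) \<Rightarrow> real" where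
  "pairexp V h = (\<Sum>x\<in>Pow V. \<Sum>y\<in>Pow (V - x).
     p ^ card x * p ^ card y * (1 - 2 * p) ^ (card V - card x - card y) * h x y)"

definition lam :: real where "lam = - p / (1 - p)"

lemma pairexp_empty [simp]: "pairexp {} h = h {} {}"
  by (simp add: pairexp_def)

text \<open>A point lies in neither set, only in the first or only in the second, independently of
  the other points. The inductions on disjoint pairs rest on this recursion.\<close>

lemma pairexp_insert:
  assumes "finite V" "i \<notin> V"
  shows "pairexp (insert i V) h = (1 - 2 * p) * pairexp V h
     + p * pairexp V (\<lambda>x y. h (insert i x) y) + p * pairexp V (\<lambda>x y. h x (insert i y))"
proof -
  define w where "w x y = p ^ card x * p ^ card y * (1 - 2 * p) ^ (card V - card x - card y)"
    for x y :: "'a set"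
  define w' where "w' x y = p ^ card x * p ^ card y * (1 - 2 * p) ^ (card (insert i V) - card x - card y)"
    for x y :: "'a set"
  have c: "card x + card y \<le> card V \<and> finite x \<and> finite y \<and> i \<notin> x \<and> i \<notin> y" if "x \<in> Pow V" "y \<in> Pow (V - x)" for x y
  proof -
    have "finite x" "finite y" using that assms finite_subset by blast+
    moreover have "card (x \<union> y) \<le> card V" using that assms by (intro card_mono) auto
    moreover have "card (x \<union> y) = card x + card y" using that \<open>finite x\<close> \<open>finite y\<close> by (intro card_Un_disjoint) auto
    ultimately show ?thesis using that assms by auto
  qed
  have 1: "w' x y = (1 - 2 * p) * w x y" "w' x (insert i y) = p * w x y" "w' (insert i x) y = p * w x y"
    if "x \<in> Pow V" "y \<in> Pow (V - x)" for x y
    using c[OF that] assms by (simp_all add: w_def w'_def Suc_diff_le)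
  have "pairexp (insert i V) h = (\<Sum>x\<in>Pow V. \<Sum>y\<in>Pow (insert i (V - x)). w' x y * h x y)
      + (\<Sum>x\<in>Pow V. \<Sum>y\<in>Pow (V - x). w' (insert i x) y * h (insert i x) y)"
  proof -
    have "insert i V - x = insert i (V - x)" if "x \<in> Pow V" for x using that assms by auto
    moreover have "insert i V - insert i x = V - x" if "x \<in> Pow V" for x using that assms by auto
    ultimately show ?thesis
      unfolding pairexp_def sum_Pow_insert[OF assms] w'_def
      by (intro arg_cong2[where f = "(+)"] sum.cong) auto
  qed
  also have "(\<Sum>x\<in>Pow V. \<Sum>y\<in>Pow (insert i (V - x)). w' x y * h x y)
     = (\<Sum>x\<in>Pow V. (\<Sum>y\<in>Pow (V - x). w' x y * h x y) + (\<Sum>y\<in>Pow (V - x). w' x (insert i y) * h x (insert i y)))"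
    using assms by (intro sum.cong) (simp_all add: sum_Pow_insert)
  also have "\<dots> = (\<Sum>x\<in>Pow V. (\<Sum>y\<in>Pow (V - x). (1 - 2 * p) * w x y * h x y) + (\<Sum>y\<in>Pow (V - x). p * w x y * h x (insert i y)))"
    by (intro sum.cong arg_cong2[where f = "(+)"]) (simp_all add: 1)
  also have "(\<Sum>x\<in>Pow V. \<Sum>y\<in>Pow (V - x). w' (insert i x) y * h (insert i x) y)
      = (\<Sum>x\<in>Pow V. \<Sum>y\<in>Pow (V - x). p * w x y * h (insert i x) y)"
    by (intro sum.cong) (simp_all add: 1)
  finally show ?thesis
    by (simp add: pairexp_def sum.distrib sum_distrib_left w_def mult.assoc)
qed

lemma pairexp_mono: "(\<And>x y. x \<subseteq> V \<Longrightarrow> y \<subseteq> V \<Longrightarrow> f x y \<le> g x y) \<Longrightarrow> pairexp V f \<le> pairexp V g"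
  unfolding pairexp_def using p_pos p_less
  by (intro sum_mono mult_left_mono) auto

lemma pairexp_add: "pairexp V (\<lambda>x y. f x y + g x y) = pairexp V f + pairexp V g"
  by (simp add: pairexp_def sum.distrib algebra_simps)

lemma pairexp_cmult: "pairexp V (\<lambda>x y. c * f x y) = c * pairexp V f"
  by (simp add: pairexp_def sum_distrib_left algebra_simps)

lemma pairexp_fst: "finite V \<Longrightarrow> pairexp V (\<lambda>x y. h x) = E V h"
  by (induction V arbitrary: h rule: finite_induct)
    (simp_all add: pairexp_insert E_insert algebra_simps)

lemma pairexp_snd: "finite V \<Longrightarrow> pairexp V (\<lambda>x y. h y) = E V h"
  by (induction V arbitrary: h rule: finite_induct)
    (simp_all add: pairexp_insert E_insert algebra_simps)

lemma pairexp_union: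
  assumes "finite J" "finite V" "J \<inter> V = {}"
  shows "pairexp (J \<union> V) h = pairexp J (\<lambda>w w'. pairexp V (\<lambda>x x'. h (w \<union> x) (w' \<union> x')))"
  using assms
proof (induction J arbitrary: h rule: finite_induct)
  case (insert i J)
  then have "pairexp (insert i J \<union> V) h = (1 - 2 * p) * pairexp (J \<union> V) h
     + p * pairexp (J \<union> V) (\<lambda>x y. h (insert i x) y) + p * pairexp (J \<union> V) (\<lambda>x y. h x (insert i y))"
    using pairexp_insert[of "J \<union> V" i h] by simp
  then show ?case
    using insert by (simp add: pairexp_insert)
qed simp

text \<open>Comparison point by point: the product weights times
  \<open>1 + lam * phi a * phi b\<close> give 0 when both bits are set, \<open>p\<close> when a
  prescribed one of them is the only one set, and \<open>1 - 2 * p\<close> when neither is. The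
  first of these values determines \<open>lam\<close>.\<close>

lemma pairexp_eq_kern:
  assumes "finite V"
  shows "pairexp V h = E V (\<lambda>x. E V (\<lambda>y. h x y * kern lam V x y))"
  using assms
proof (induction V arbitrary: h rule: finite_induct)
  case empty
  then show ?case by (simp add: kern_def)
next
  case (insert i V)
  have q: "1 - p \<noteq> 0" "p \<noteq> 0" using p_pos p_less by auto
  let ?k = "\<lambda>a b. 1 + lam * phi a * phi b"
  have k: "?k True True = 0" "(1 - p) * p * ?k False True = p" "p * (1 - p) * ?k True False = p"
    using q by (simp_all only: lam_def mult.assoc phi_mult) (simp_all add: field_simps)
  have "(1 - p) * (1 - p) * ?k False False = (1 - p) * (1 - p) - p * p"
    using q by (simp add: lam_def mult.assoc phi_mult right_diff_distrib)
  then have k': "(1 - p) * (1 - p) * ?k False False = 1 - 2 * p"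
    by (simp add: algebra_simps)
  have factor: "E V (\<lambda>x. E V (\<lambda>y. h' x y * kern lam (insert i V) (u x) (v y))) = ?k a b * pairexp V h'"
    if "\<And>x y. x \<subseteq> V \<Longrightarrow> y \<subseteq> V \<Longrightarrow> kern lam (insert i V) (u x) (v y) = ?k a b * kern lam V x y"
    for h' u v a b
  proof -
    have "E V (\<lambda>x. E V (\<lambda>y. h' x y * kern lam (insert i V) (u x) (v y)))
        = E V (\<lambda>x. E V (\<lambda>y. ?k a b * (h' x y * kern lam V x y)))"
      using that by (intro E_cong) simp
    then show ?thesis by (simp only: E_cmult insert.IH)
  qed
  have i: "i \<notin> x" if "x \<subseteq> V" for x using that insert.hyps by auto
  note ki = kern_insert[OF insert.hyps] kern_insert_arg[OF insert.hyps(2)]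
  have "E (insert i V) (\<lambda>x. E (insert i V) (\<lambda>y. h x y * kern lam (insert i V) x y))
    = (1 - p) * (1 - p) * E V (\<lambda>x. E V (\<lambda>y. h x y * kern lam (insert i V) x y))
     + (1 - p) * p * E V (\<lambda>x. E V (\<lambda>y. h x (insert i y) * kern lam (insert i V) x (insert i y)))
     + p * (1 - p) * E V (\<lambda>x. E V (\<lambda>y. h (insert i x) y * kern lam (insert i V) (insert i x) y))
     + p * p * E V (\<lambda>x. E V (\<lambda>y. h (insert i x) (insert i y) * kern lam (insert i V) (insert i x) (insert i y)))"
    by (simp only: E_insert[OF insert.hyps] E_add E_cmult) (simp only: algebra_simps)
  also have "\<dots> = (1 - p) * (1 - p) * (?k False False * pairexp V h)
     + (1 - p) * p * (?k False True * pairexp V (\<lambda>x y. h x (insert i y)))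
     + p * (1 - p) * (?k True False * pairexp V (\<lambda>x y. h (insert i x) y))
     + p * p * (?k True True * pairexp V (\<lambda>x y. h (insert i x) (insert i y)))"
    by (intro arg_cong2[where f = "(+)"] arg_cong2[where f = "(*)"] refl factor) (simp_all add: ki i)
  finally show ?case
    unfolding mult.assoc[symmetric] k k' using pairexp_insert[OF insert.hyps, of h] by simp
qed

lemma pairexp_fourier:
  assumes "finite V"
  shows "pairexp V (\<lambda>x y. f x * g y) = (\<Sum>S\<in>Pow V. lam ^ card S * coef V f S * coef V g S)"
  by (simp add: pairexp_eq_kern[OF assms] E_E_kern[OF assms])

section \<open>The noise operator and orthonormality of the characters\<close>

definition noise :: "real \<Rightarrow> 'a set \<Rightarrow> ('a set \<Rightarrow> real) \<Rightarrow> 'a set \<Rightarrow> real" where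
  "noise s V f x = (\<Sum>S\<in>Pow V. s ^ card S * coef V f S * chi S x)"

lemma E_kern_weight:
  assumes "finite V"
  shows "E V (kern r V x) = 1"
  using assms
proof (induction V rule: finite_induct)
  case empty
  then show ?case by (simp add: kern_def)
next
  case (insert i V)
  have i: "i \<notin> y" if "y \<subseteq> V" for y using that insert.hyps by auto
  note ki = kern_insert[OF insert.hyps] kern_insert_arg[OF insert.hyps(2)]
  have "E (insert i V) (kern r (insert i V) x)
      = (1 - p) * E V (\<lambda>y. (1 + r * phi (i \<in> x) * phi False) * kern r V x y)
       + p * E V (\<lambda>y. (1 + r * phi (i \<in> x) * phi True) * kern r V x y)"
    unfolding E_insert[OF insert.hyps]
    by (intro arg_cong2[where f = "(+)"] arg_cong2[where f = "(*)"] refl E_cong) (simp_all add: ki i)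
  also have "\<dots> = 1 + r * phi (i \<in> x) * ((1 - p) * phi False + p * phi True)"
    unfolding E_cmult insert.IH by (simp add: algebra_simps)
  finally show ?case by (simp add: phi_mean)
qed

text \<open>By \<open>E_kern\<close> the operator integrates \<open>f\<close> against
  \<open>kern s V x\<close>, which is nonnegative and has total weight 1. The Fourier formula does
  not show this positivity.\<close>

lemma noise_bounds:
  assumes "finite V" "0 \<le> s" "s \<le> 1" "\<And>x. x \<subseteq> V \<Longrightarrow> f x \<in> {0..1}"
  shows "noise s V f x \<in> {0..1}"
proof -
  have eq: "noise s V f x = E V (\<lambda>y. f y * kern s V x y)"
    by (simp add: noise_def E_kern[OF assms(1)])
  have "0 \<le> E V (\<lambda>y. f y * kern s V x y)"
    using assms by (intro E_nonneg mult_nonneg_nonneg kern_nonneg) auto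
  moreover have "E V (\<lambda>y. f y * kern s V x y) \<le> E V (\<lambda>y. kern s V x y)"
    using assms by (intro E_mono mult_left_le_one_le kern_nonneg) auto
  ultimately show ?thesis
    using E_kern_weight[OF assms(1), of s x] by (simp add: eq)
qed

lemma chi_insert:
  assumes "finite S" "i \<notin> S"
  shows "chi (insert i S) x = phi (i \<in> x) * chi S x"
  using assms by (simp add: chi_def)

lemma chi_insert_arg:
  assumes "i \<notin> S"
  shows "chi S (insert i x) = chi S x" "chi S (x - {i}) = chi S x"
proof -
  have "j \<in> insert i x \<longleftrightarrow> j \<in> x" "j \<in> x - {i} \<longleftrightarrow> j \<in> x" if "j \<in> S" for j using assms that by auto
  then show "chi S (insert i x) = chi S x" "chi S (x - {i}) = chi S x"
    unfolding chi_def by (intro prod.cong refl; simp)+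
qed

text \<open>Stated for arbitrary coefficients so that it applies to truncated sums. Splitting off
  \<open>i\<close> writes the sum as \<open>G x + phi (i \<in> x) * H x\<close> with
  \<open>G\<close> and \<open>H\<close> free of \<open>i\<close>; mean 0 removes the cross term and
  variance 1 normalises the square.\<close>

lemma E_chi_sum_sq:
  assumes "finite V"
  shows "E V (\<lambda>x. (\<Sum>S\<in>Pow V. c S * chi S x)\<^sup>2) = (\<Sum>S\<in>Pow V. (c S)\<^sup>2)"
  using assms
proof (induction V arbitrary: c rule: finite_induct)
  case empty
  then show ?case by (simp add: chi_def)
next
  case (insert i V)
  define G where "G x = (\<Sum>S\<in>Pow V. c S * chi S x)" for x
  define H where "H x = (\<Sum>S\<in>Pow V. c (insert i S) * chi S x)" for x
  have i: "i \<notin> y" "finite y" if "y \<in> Pow V" for y using that insert.hyps finite_subset by auto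
  have F: "(\<Sum>S\<in>Pow (insert i V). c S * chi S x) = G x + phi (i \<in> x) * H x" for x
    unfolding sum_Pow_insert[OF insert.hyps] G_def H_def sum_distrib_left
    by (intro arg_cong2[where f = "(+)"] sum.cong) (simp_all add: chi_insert i)
  have GH: "G (insert i x) = G x" "H (insert i x) = H x" for x
    unfolding G_def H_def by (intro sum.cong refl; simp add: chi_insert_arg i)+
  have "E (insert i V) (\<lambda>x. (\<Sum>S\<in>Pow (insert i V). c S * chi S x)\<^sup>2)
      = (1 - p) * E V (\<lambda>x. (G x + phi False * H x)\<^sup>2) + p * E V (\<lambda>x. (G x + phi True * H x)\<^sup>2)"
    unfolding F E_insert[OF insert.hyps] GH
    by (intro arg_cong2[where f = "(+)"] arg_cong2[where f = "(*)"] refl E_cong) (use i in auto)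
  also have "\<dots> = E V (\<lambda>x. (G x)\<^sup>2) + (2 * E V (\<lambda>x. G x * H x)) * ((1 - p) * phi False + p * phi True)
      + E V (\<lambda>x. (H x)\<^sup>2) * ((1 - p) * (phi False)\<^sup>2 + p * (phi True)\<^sup>2)"
  proof -
    have sq: "(G x + c * H x)\<^sup>2 = (G x)\<^sup>2 + ((2 * c) * (G x * H x) + c\<^sup>2 * (H x)\<^sup>2)" for c x
      by (simp add: power2_eq_square algebra_simps)
    show ?thesis unfolding sq E_add E_cmult by (simp add: algebra_simps)
  qed
  also have "\<dots> = (\<Sum>S\<in>Pow V. (c S)\<^sup>2) + (\<Sum>S\<in>Pow V. (c (insert i S))\<^sup>2)"
    unfolding phi_mean phi_var using insert.IH[of c] insert.IH[of "\<lambda>S. c (insert i S)"] by (simp add: G_def H_def)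
  finally show ?case unfolding sum_Pow_insert[OF insert.hyps] .
qed

end

section \<open>Lower bound for disjoint pairs by a Lindeberg argument\<close>

text \<open>Multiplying the expansion by \<open>u + d\<close> raises the exponent by one. Where the
  exponents \<open>a - 1\<close> and \<open>a - 2\<close> are truncated to 0, their coefficients
  vanish.\<close>

lemma power_taylor_cubic:
  fixes u d :: real
  assumes "u \<in> {0..1}" "u + d \<in> {0..1}"
  shows "\<exists>r. \<bar>r\<bar> \<le> real a ^ 3 \<and>
    (u + d) ^ a = u ^ a + real a * u ^ (a - 1) * d
      + real a * (real a - 1) / 2 * u ^ (a - 2) * d\<^sup>2 + r * d ^ 3"
proof (induction a)
  case (Suc a)
  then obtain r where r: "\<bar>r\<bar> \<le> real a ^ 3" and eq:
    "(u + d) ^ a = u ^ a + real a * u ^ (a - 1) * d + real a * (real a - 1) / 2 * u ^ (a - 2) * d\<^sup>2 + r * d ^ 3"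
    by blast
  define r' where "r' = r * (u + d) + real a * (real a - 1) / 2 * u ^ (a - 2)"
  have "u ^ (a - 2) \<in> {0..1}" using assms by (auto intro: power_le_one)
  then have "\<bar>real a * (real a - 1) / 2 * u ^ (a - 2)\<bar> \<le> real a * (real a - 1) / 2"
    by (cases a) (auto simp: abs_mult intro: mult_left_le)
  moreover have "\<bar>r * (u + d)\<bar> \<le> real a ^ 3 * 1"
    unfolding abs_mult using r assms by (intro mult_mono) auto
  ultimately have "\<bar>r'\<bar> \<le> real a ^ 3 + real a * (real a - 1) / 2"
    unfolding r'_def by linarith
  also have "\<dots> \<le> real (Suc a) ^ 3"
    by (simp add: power3_eq_cube algebra_simps)
  finally have r': "\<bar>r'\<bar> \<le> real (Suc a) ^ 3" .
  have 1: "real a * u ^ a = real a * (u * u ^ (a - 1))" by (cases a) auto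
  have 2: "real a * (real a - 1) * u ^ (a - 1) = real a * (real a - 1) * (u * u ^ (a - 2))"
    by (cases "a \<le> 1") (auto simp: le_Suc_eq simp flip: power_Suc simp: Suc_diff_Suc numeral_2_eq_2)
  have "(u + d) ^ Suc a = u * u ^ a + (u ^ a + real a * (u * u ^ (a - 1))) * d
      + (real a * u ^ (a - 1) + (real a * (real a - 1) * (u * u ^ (a - 2))) / 2) * d\<^sup>2 + r' * d ^ 3"
    unfolding power_Suc eq r'_def by (simp add: field_simps power2_eq_square power3_eq_cube)
  also have "\<dots> = u ^ Suc a + real (Suc a) * u ^ (Suc a - 1) * d
      + real (Suc a) * (real (Suc a) - 1) / 2 * u ^ (Suc a - 2) * d\<^sup>2 + r' * d ^ 3"
    unfolding 1[symmetric] 2[symmetric] by (simp add: field_simps)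
  finally show ?case using r' by blast
qed simp

lemma cube_product_le:
  fixes x y :: real
  assumes "0 \<le> x" "0 \<le> y"
  shows "x * y\<^sup>2 \<le> x ^ 3 + y ^ 3"
proof (cases "x \<le> y")
  case True
  then have "x * y\<^sup>2 \<le> y * y\<^sup>2" using assms by (intro mult_right_mono) auto
  also have "\<dots> \<le> x ^ 3 + y ^ 3" using assms by (simp add: power3_eq_cube power2_eq_square)
  finally show ?thesis .
next
  case False
  then have "x * y\<^sup>2 \<le> x * x\<^sup>2" using assms by (intro mult_left_mono power_mono) auto
  also have "\<dots> \<le> x ^ 3 + y ^ 3" using assms by (simp add: power3_eq_cube power2_eq_square)
  finally show ?thesis .
qed

text \<open>Product of two cubic expansions. Among the terms of order at least three, each of the
  three mixed ones is at most \<open>a ^ 6\<close> times the sum of the cubes, and the two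
  remainders are at most 1 and 2 times \<open>a ^ 6\<close> times one cube; hence the factor
  5.\<close>

lemma power_product_lower:
  fixes u v d e :: real
  assumes "u \<in> {0..1}" "u + d \<in> {0..1}" "v \<in> {0..1}" "v + e \<in> {0..1}" "a \<ge> 2"
  shows "u ^ a * v ^ a + real a * u ^ (a - 1) * v ^ a * d + real a * u ^ a * v ^ (a - 1) * e
     + (u * v) ^ (a - 2) * (real a * (real a - 1) / 2 * (v\<^sup>2 * d\<^sup>2 + u\<^sup>2 * e\<^sup>2) + (real a)\<^sup>2 * (u * v) * (d * e))
     - 5 * real a ^ 6 * (\<bar>d\<bar> ^ 3 + \<bar>e\<bar> ^ 3)
     \<le> (u + d) ^ a * (v + e) ^ a"
proof -
  let ?c = "real a * (real a - 1) / 2"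
  define A1 A2 B1 B2 where "A1 = real a * u ^ (a - 1)" and "A2 = ?c * u ^ (a - 2)"
    and "B1 = real a * v ^ (a - 1)" and "B2 = ?c * v ^ (a - 2)"
  obtain r where r: "\<bar>r\<bar> \<le> real a ^ 3" and eq: "(u + d) ^ a = u ^ a + A1 * d + A2 * d\<^sup>2 + r * d ^ 3"
    using power_taylor_cubic[OF assms(1,2), of a] unfolding A1_def A2_def by blast
  obtain s where s: "\<bar>s\<bar> \<le> real a ^ 3" and eq': "(v + e) ^ a = v ^ a + B1 * e + B2 * e\<^sup>2 + s * e ^ 3"
    using power_taylor_cubic[OF assms(3,4), of a] unfolding B1_def B2_def by blast
  define M where "M = real a ^ 3"
  have M: "M \<ge> 1" "M * M = real a ^ 6" using assms(5) by (auto simp: M_def simp flip: power_add)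
  have am: "real a \<le> M" "?c \<le> M" "0 \<le> ?c"
  proof -
    have "real a * 1 \<le> real a * (real a)\<^sup>2" using assms(5) by (intro mult_left_mono) auto
    then show "real a \<le> M" by (simp add: M_def power3_eq_cube power2_eq_square)
    have "real a * (real a - 1) / 2 \<le> real a * real a * 1" using assms(5) by (simp add: field_simps)
    also have "\<dots> \<le> real a * real a * real a" using assms(5) by (intro mult_left_mono) auto
    finally show "?c \<le> M" by (simp add: M_def power3_eq_cube)
    show "0 \<le> ?c" using assms(5) by simp
  qed
  have pw: "0 \<le> u ^ k" "u ^ k \<le> 1" "0 \<le> v ^ k" "v ^ k \<le> 1" for k
    using assms by (auto intro: power_le_one)
  have b: "\<bar>A1\<bar> \<le> M" "\<bar>A2\<bar> \<le> M" "\<bar>B1\<bar> \<le> M" "\<bar>B2\<bar> \<le> M"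
  proof -
    have bound: "\<bar>c * z\<bar> \<le> M" if "0 \<le> c" "c \<le> M" "0 \<le> z" "z \<le> 1" for c z
      using mult_mono[OF that(2,4)] that M(1) by (simp add: abs_mult)
    show "\<bar>A1\<bar> \<le> M" "\<bar>A2\<bar> \<le> M" "\<bar>B1\<bar> \<le> M" "\<bar>B2\<bar> \<le> M"
      unfolding A1_def A2_def B1_def B2_def by (intro bound am pw of_nat_0_le_iff)+
  qed
  define P where "P = u ^ a + A1 * d + A2 * d\<^sup>2"
  have prod: "(u + d) ^ a * (v + e) ^ a = u ^ a * v ^ a + A1 * v ^ a * d + u ^ a * B1 * e
      + (A2 * v ^ a * d\<^sup>2 + u ^ a * B2 * e\<^sup>2 + A1 * B1 * (d * e))
      + (A1 * B2 * (d * e\<^sup>2) + A2 * B1 * (e * d\<^sup>2) + A2 * B2 * (d\<^sup>2 * e\<^sup>2)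
        + r * (v + e) ^ a * d ^ 3 + P * s * e ^ 3)"
    unfolding eq eq' P_def by (simp add: algebra_simps power2_eq_square power3_eq_cube)
  have vv: "v ^ a = v ^ (a - 2) * v\<^sup>2" "u ^ a = u ^ (a - 2) * u\<^sup>2" "v ^ (a - 1) = v ^ (a - 2) * v" "u ^ (a - 1) = u ^ (a - 2) * u"
  proof -
    obtain b where "a = 2 + b" using assms(5) le_Suc_ex by blast
    then show "v ^ a = v ^ (a - 2) * v\<^sup>2" "u ^ a = u ^ (a - 2) * u\<^sup>2"
      "v ^ (a - 1) = v ^ (a - 2) * v" "u ^ (a - 1) = u ^ (a - 2) * u"
      by (simp_all add: power2_eq_square)
  qed
  have second: "A2 * v ^ a * d\<^sup>2 + u ^ a * B2 * e\<^sup>2 + A1 * B1 * (d * e)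
     = (u * v) ^ (a - 2) * (?c * (v\<^sup>2 * d\<^sup>2 + u\<^sup>2 * e\<^sup>2) + (real a)\<^sup>2 * (u * v) * (d * e))"
    unfolding A1_def A2_def B1_def B2_def vv power_mult_distrib
    by (simp add: algebra_simps power2_eq_square)
  have de: "\<bar>d\<bar> \<le> 1" "\<bar>e\<bar> \<le> 1" using assms by auto
  let ?R = "\<bar>d\<bar> ^ 3 + \<bar>e\<bar> ^ 3"
  have R: "\<bar>d * e\<^sup>2\<bar> \<le> ?R" "\<bar>e * d\<^sup>2\<bar> \<le> ?R" "\<bar>d\<^sup>2 * e\<^sup>2\<bar> \<le> ?R"
  proof -
    show 1: "\<bar>d * e\<^sup>2\<bar> \<le> ?R" "\<bar>e * d\<^sup>2\<bar> \<le> ?R"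
      using cube_product_le[of "\<bar>d\<bar>" "\<bar>e\<bar>"] cube_product_le[of "\<bar>e\<bar>" "\<bar>d\<bar>"] by (auto simp: abs_mult)
    have "\<bar>d\<^sup>2 * e\<^sup>2\<bar> = \<bar>d\<bar> * \<bar>d * e\<^sup>2\<bar>" by (simp add: abs_mult power2_eq_square)
    also have "\<dots> \<le> 1 * \<bar>d * e\<^sup>2\<bar>" using de by (intro mult_right_mono) auto
    finally show "\<bar>d\<^sup>2 * e\<^sup>2\<bar> \<le> ?R" using 1 by linarith
  qed
  have term_le: "\<bar>x * y * z\<bar> \<le> k * M * w" if "\<bar>x\<bar> \<le> k" "\<bar>y\<bar> \<le> M" "\<bar>z\<bar> \<le> w" for x y z k w
    unfolding abs_mult using that by (intro mult_mono) auto
  have "\<bar>A1 * B2 * (d * e\<^sup>2)\<bar> \<le> M * M * ?R" "\<bar>A2 * B1 * (e * d\<^sup>2)\<bar> \<le> M * M * ?R"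
    "\<bar>A2 * B2 * (d\<^sup>2 * e\<^sup>2)\<bar> \<le> M * M * ?R"
    by (intro term_le b R)+
  moreover have "\<bar>r * (v + e) ^ a * d ^ 3\<bar> \<le> M * M * \<bar>d\<bar> ^ 3"
  proof (rule term_le)
    have "\<bar>(v + e) ^ a\<bar> \<le> 1" using assms by (auto intro: power_le_one)
    then show "\<bar>(v + e) ^ a\<bar> \<le> M" using M by linarith
  qed (use r in \<open>auto simp: M_def power_abs\<close>)
  moreover have "\<bar>P * s * e ^ 3\<bar> \<le> 2 * M * M * \<bar>e\<bar> ^ 3"
  proof (rule term_le)
    have "\<bar>r * d ^ 3\<bar> \<le> M * 1"
      unfolding abs_mult using r de M by (intro mult_mono) (auto simp: M_def power_abs intro: power_le_one)
    moreover have "\<bar>(u + d) ^ a\<bar> \<le> 1" using assms by (auto intro: power_le_one)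
    moreover have "P = (u + d) ^ a - r * d ^ 3" using eq by (simp add: P_def)
    ultimately show "\<bar>P\<bar> \<le> 2 * M" using M by linarith
  qed (use s in \<open>auto simp: M_def power_abs\<close>)
  moreover have "0 \<le> M * M * \<bar>d\<bar> ^ 3" using M by auto
  moreover have "5 * (M * M) * ?R = M * M * ?R + M * M * ?R + M * M * ?R
      + 2 * (M * M * \<bar>d\<bar> ^ 3) + 2 * M * M * \<bar>e\<bar> ^ 3"
    by (simp add: algebra_simps)
  moreover have "real a * u ^ (a - 1) * v ^ a * d = A1 * v ^ a * d"
    "real a * u ^ a * v ^ (a - 1) * e = u ^ a * B1 * e"
    by (simp_all add: A1_def B1_def)
  ultimately show ?thesis
    unfolding prod second M(2)[symmetric] abs_le_iff by linarith
qed

context biased_cube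
begin

text \<open>The linear terms of the Taylor expansion of $(uv)^a$ average to zero, and the quadratic ones
  average to a nonnegative form as soon as $(a-1)/a \ge p/(1-p)$, the absolute value of the
  correlation \<^term>\<open>lam\<close>. This is where $p < 1/2$ is needed.\<close>

lemma two_point_pair_inequality:
  fixes u0 u1 v0 v1 :: real
  assumes "u0 \<in> {0..1}" "u1 \<in> {0..1}" "v0 \<in> {0..1}" "v1 \<in> {0..1}"
    and a: "a \<ge> 2" "real a * p \<le> (real a - 1) * (1 - p)"
  shows "(((1 - p) * u0 + p * u1) * ((1 - p) * v0 + p * v1)) ^ a
       - 5 * real a ^ 6 * (\<bar>u1 - u0\<bar> ^ 3 + \<bar>v1 - v0\<bar> ^ 3)
    \<le> (1 - 2 * p) * (u0 * v0) ^ a + p * (u1 * v0) ^ a + p * (u0 * v1) ^ a"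
proof -
  define D F where "D = u1 - u0" and "F = v1 - v0"
  \<comment> \<open>The expansion is made around the averages, so that the displacements are centred
    and the linear terms cancel.\<close>
  define u v where "u = (1 - p) * u0 + p * u1" and "v = (1 - p) * v0 + p * v1"
  have pts: "u0 = u + (- p * D)" "u1 = u + (1 - p) * D" "v0 = v + (- p * F)" "v1 = v + (1 - p) * F"
    by (simp_all add: u_def v_def D_def F_def algebra_simps)
  have uv: "u \<in> {0..1}" "v \<in> {0..1}"
    using assms p_pos p_less convex_bound_le[of u0 1 u1 "1 - p" p] convex_bound_le[of v0 1 v1 "1 - p" p]
    by (auto simp: u_def v_def)
  define X Y c Q where "X = real a * u ^ (a - 1) * v ^ a" and "Y = real a * u ^ a * v ^ (a - 1)"
    and "c = real a * (real a - 1) / 2" and "Q = (u * v) ^ (a - 2)"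
  define low where "low d e = u ^ a * v ^ a + X * d + Y * e
     + Q * (c * (v\<^sup>2 * d\<^sup>2 + u\<^sup>2 * e\<^sup>2) + (real a)\<^sup>2 * (u * v) * (d * e))" for d e
  define B where "B = 5 * real a ^ 6 * (\<bar>D\<bar> ^ 3 + \<bar>F\<bar> ^ 3)"
  have low: "low d e - B \<le> ((u + d) * (v + e)) ^ a"
    if "u + d \<in> {0..1}" "v + e \<in> {0..1}" "\<bar>d\<bar> \<le> \<bar>D\<bar>" "\<bar>e\<bar> \<le> \<bar>F\<bar>" for d e
  proof -
    have "5 * real a ^ 6 * (\<bar>d\<bar> ^ 3 + \<bar>e\<bar> ^ 3) \<le> B"
      unfolding B_def using that by (intro mult_left_mono add_mono power_mono) auto
    then show ?thesis
      using power_product_lower[OF uv(1) that(1) uv(2) that(2) a(1)]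
      by (simp add: low_def X_def Y_def c_def Q_def power_mult_distrib)
  qed
  have small: "\<bar>- p * z\<bar> \<le> \<bar>z\<bar>" "\<bar>(1 - p) * z\<bar> \<le> \<bar>z\<bar>" for z
    using p_pos p_less by (auto simp: abs_mult intro: mult_left_le_one_le)
  have "(1 - 2 * p) * (low (- p * D) (- p * F) - B) + p * (low ((1 - p) * D) (- p * F) - B)
      + p * (low (- p * D) ((1 - p) * F) - B)
     \<le> (1 - 2 * p) * (u0 * v0) ^ a + p * (u1 * v0) ^ a + p * (u0 * v1) ^ a"
  proof (intro add_mono mult_left_mono)
    show "low (- p * D) (- p * F) - B \<le> (u0 * v0) ^ a" "low ((1 - p) * D) (- p * F) - B \<le> (u1 * v0) ^ a"
      "low (- p * D) ((1 - p) * F) - B \<le> (u0 * v1) ^ a"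
      using low[of "- p * D" "- p * F"] low[of "(1 - p) * D" "- p * F"] low[of "- p * D" "(1 - p) * F"]
        small assms unfolding pts[symmetric] by blast+
  qed (use p_pos p_less in auto)
  \<comment> \<open>Under the law of a disjoint pair the squared displacements have means
    \<open>p * (1 - p) * D\<^sup>2\<close> and \<open>p * (1 - p) * F\<^sup>2\<close>, and the
    product of the displacements has mean \<open>- p\<^sup>2 * D * F\<close>.\<close>
  moreover have "(1 - 2 * p) * (low (- p * D) (- p * F) - B) + p * (low ((1 - p) * D) (- p * F) - B)
      + p * (low (- p * D) ((1 - p) * F) - B)
    = u ^ a * v ^ a - B + Q * p * (c * (1 - p) * ((v * D)\<^sup>2 + (u * F)\<^sup>2) - (real a)\<^sup>2 * p * ((v * D) * (u * F)))"
    by (simp add: low_def algebra_simps power2_eq_square)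
  moreover have "0 \<le> Q * p * (c * (1 - p) * ((v * D)\<^sup>2 + (u * F)\<^sup>2) - (real a)\<^sup>2 * p * ((v * D) * (u * F)))"
  proof (intro mult_nonneg_nonneg)
    show "0 \<le> Q" using uv by (simp add: Q_def)
    have "(real a)\<^sup>2 * p * ((v * D) * (u * F)) \<le> (real a)\<^sup>2 * p * (((v * D)\<^sup>2 + (u * F)\<^sup>2) / 2)"
      using p_pos sum_squares_bound[of "v * D" "u * F"] by (intro mult_left_mono) auto
    also have "\<dots> = real a / 2 * (real a * p) * ((v * D)\<^sup>2 + (u * F)\<^sup>2)"
      by (simp add: power2_eq_square)
    also have "\<dots> \<le> real a / 2 * ((real a - 1) * (1 - p)) * ((v * D)\<^sup>2 + (u * F)\<^sup>2)"
      using a by (intro mult_right_mono mult_left_mono) auto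
    finally show "0 \<le> c * (1 - p) * ((v * D)\<^sup>2 + (u * F)\<^sup>2) - (real a)\<^sup>2 * p * ((v * D) * (u * F))"
      by (simp add: c_def)
  qed (use p_pos in simp)
  ultimately show ?thesis
    unfolding B_def by (simp add: power_mult_distrib u_def v_def D_def F_def)
qed

section \<open>Third moments of discrete derivatives and replacement of coordinates\<close>

definition disc :: "'a \<Rightarrow> ('a set \<Rightarrow> real) \<Rightarrow> 'a set \<Rightarrow> real" where
  "disc i f x = f (insert i x) - f (x - {i})"

text \<open>Up to a constant factor, the total error of replacing all coordinates one at a
  time.\<close>

definition third :: "'a set \<Rightarrow> ('a set \<Rightarrow> real) \<Rightarrow> real" where
  "third V f = (\<Sum>i\<in>V. E V (\<lambda>x. \<bar>disc i f x\<bar> ^ 3))"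

text \<open>Jensen's inequality for the third power, read off from an explicit factorisation of its
  defect on nonnegative arguments.\<close>

lemma abs_cube_convex:
  "\<bar>(1 - p) * x + p * y\<bar> ^ 3 \<le> (1 - p) * \<bar>x\<bar> ^ 3 + p * \<bar>y\<bar> ^ 3" for x y :: real
proof -
  have "\<bar>(1 - p) * x + p * y\<bar> \<le> (1 - p) * \<bar>x\<bar> + p * \<bar>y\<bar>"
    using p_pos p_less abs_triangle_ineq[of "(1 - p) * x" "p * y"] by (simp add: abs_mult)
  then have "\<bar>(1 - p) * x + p * y\<bar> ^ 3 \<le> ((1 - p) * \<bar>x\<bar> + p * \<bar>y\<bar>) ^ 3"
    by (intro power_mono) auto
  also have "\<dots> \<le> (1 - p) * \<bar>x\<bar> ^ 3 + p * \<bar>y\<bar> ^ 3"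
  proof -
    have "(1 - p) * a ^ 3 + p * b ^ 3 - ((1 - p) * a + p * b) ^ 3
        = p * (1 - p) * (a - b)\<^sup>2 * ((2 - p) * a + (1 + p) * b)" for a b
      by (simp add: power3_eq_cube power2_eq_square algebra_simps)
    moreover have "0 \<le> p * (1 - p) * (\<bar>x\<bar> - \<bar>y\<bar>)\<^sup>2 * ((2 - p) * \<bar>x\<bar> + (1 + p) * \<bar>y\<bar>)"
      using p_pos p_less by auto
    ultimately show ?thesis by smt
  qed
  finally show ?thesis .
qed

text \<open>Averaging over \<open>i\<close> does not increase the third moments at the other points,
  by convexity. The cost of replacing \<open>i\<close> and the total cost for the averaged function
  thus fit together into the total cost for \<open>f\<close>, which is what closes the replacement
  induction.\<close>

lemma third_insert:
  assumes "finite V" "i \<notin> V"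
  shows "E V (\<lambda>x. \<bar>f (insert i x) - f x\<bar> ^ 3) + third V (\<lambda>x. (1 - p) * f x + p * f (insert i x))
     \<le> third (insert i V) f"
proof -
  have i: "i \<notin> x" if "x \<subseteq> V" for x using that assms by auto
  have "E (insert i V) (\<lambda>x. \<bar>disc i f x\<bar> ^ 3) = E V (\<lambda>x. \<bar>f (insert i x) - f x\<bar> ^ 3)"
  proof -
    have "E V (\<lambda>x. \<bar>disc i f x\<bar> ^ 3) = E V (\<lambda>x. \<bar>f (insert i x) - f x\<bar> ^ 3)"
      "E V (\<lambda>x. \<bar>disc i f (insert i x)\<bar> ^ 3) = E V (\<lambda>x. \<bar>f (insert i x) - f x\<bar> ^ 3)"
      using i by (auto simp: disc_def intro!: E_cong)
    then show ?thesis by (simp add: E_insert[OF assms] algebra_simps)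
  qed
  moreover have "third V (\<lambda>x. (1 - p) * f x + p * f (insert i x))
      \<le> (\<Sum>j\<in>V. E (insert i V) (\<lambda>x. \<bar>disc j f x\<bar> ^ 3))"
    unfolding third_def
  proof (rule sum_mono)
    fix j assume "j \<in> V"
    then have "i \<noteq> j" using assms by auto
    then have eq: "disc j (\<lambda>x. (1 - p) * f x + p * f (insert i x)) x
        = (1 - p) * disc j f x + p * disc j f (insert i x)" for x
      by (simp add: disc_def insert_commute insert_Diff_if algebra_simps)
    show "E V (\<lambda>x. \<bar>disc j (\<lambda>x. (1 - p) * f x + p * f (insert i x)) x\<bar> ^ 3)
        \<le> E (insert i V) (\<lambda>x. \<bar>disc j f x\<bar> ^ 3)"
      unfolding E_insert[OF assms] E_cmult[symmetric] E_add[symmetric] eq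
      by (intro E_mono abs_cube_convex)
  qed
  ultimately show ?thesis using assms by (simp add: third_def)
qed

text \<open>Point \<open>i\<close> is averaged out of \<open>f\<close> and \<open>g\<close>
  together, by the two-point inequality for fixed values of the remaining coordinates. Each error
  term depends on one of the two sets only, so the marginals turn it into an expectation
  \<open>E\<close>.\<close>

lemma pairexp_power_lower:
  assumes a: "a \<ge> 2" "real a * p \<le> (real a - 1) * (1 - p)"
    and "finite V" "\<And>x. x \<subseteq> V \<Longrightarrow> f x \<in> {0..1}" "\<And>x. x \<subseteq> V \<Longrightarrow> g x \<in> {0..1}"
  shows "(E V f * E V g) ^ a - 5 * real a ^ 6 * (third V f + third V g) \<le> pairexp V (\<lambda>x y. (f x * g y) ^ a)"
  using assms(3-)
proof (induction V arbitrary: f g rule: finite_induct)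
  case empty
  then show ?case by (simp add: third_def)
next
  case (insert i V)
  let ?f = "\<lambda>x. (1 - p) * f x + p * f (insert i x)" and ?g = "\<lambda>x. (1 - p) * g x + p * g (insert i x)"
  let ?C = "5 * real a ^ 6"
  have bd: "f x \<in> {0..1}" "f (insert i x) \<in> {0..1}" "g x \<in> {0..1}" "g (insert i x) \<in> {0..1}" if "x \<subseteq> V" for x
    by (rule insert.prems; use that in auto)+
  have cv: "(1 - p) * s + p * t \<in> {0..1}" if "s \<in> {0..1}" "t \<in> {0..1}" for s t
    using that p_pos p_less convex_bound_le[of s 1 t "1 - p" p] by auto
  have "(E V ?f * E V ?g) ^ a - ?C * (third V ?f + third V ?g) \<le> pairexp V (\<lambda>x y. (?f x * ?g y) ^ a)"
    by (intro insert.IH cv bd)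
  also have "\<dots> \<le> pairexp V (\<lambda>x y. ((1 - 2 * p) * (f x * g y) ^ a + p * (f (insert i x) * g y) ^ a
      + p * (f x * g (insert i y)) ^ a) + ?C * (\<bar>f (insert i x) - f x\<bar> ^ 3 + \<bar>g (insert i y) - g y\<bar> ^ 3))"
  proof (rule pairexp_mono)
    fix x y assume "x \<subseteq> V" "y \<subseteq> V"
    from two_point_pair_inequality[OF bd(1,2)[OF this(1)] bd(3,4)[OF this(2)] a]
    show "(?f x * ?g y) ^ a \<le> ((1 - 2 * p) * (f x * g y) ^ a + p * (f (insert i x) * g y) ^ a
      + p * (f x * g (insert i y)) ^ a) + ?C * (\<bar>f (insert i x) - f x\<bar> ^ 3 + \<bar>g (insert i y) - g y\<bar> ^ 3)"
      by linarith
  qed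
  also have "\<dots> = pairexp (insert i V) (\<lambda>x y. (f x * g y) ^ a)
      + ?C * (E V (\<lambda>x. \<bar>f (insert i x) - f x\<bar> ^ 3) + E V (\<lambda>x. \<bar>g (insert i x) - g x\<bar> ^ 3))"
    unfolding pairexp_insert[OF insert.hyps] pairexp_add pairexp_cmult
      pairexp_fst[OF insert.hyps(1)] pairexp_snd[OF insert.hyps(1)] by simp
  finally have "(E V ?f * E V ?g) ^ a \<le> pairexp (insert i V) (\<lambda>x y. (f x * g y) ^ a)
     + ?C * ((E V (\<lambda>x. \<bar>f (insert i x) - f x\<bar> ^ 3) + third V ?f) + (E V (\<lambda>x. \<bar>g (insert i x) - g x\<bar> ^ 3) + third V ?g))"
    by (simp add: algebra_simps)
  also have "\<dots> \<le> pairexp (insert i V) (\<lambda>x y. (f x * g y) ^ a) + ?C * (third (insert i V) f + third (insert i V) g)"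
    by (intro add_left_mono mult_left_mono add_mono third_insert insert.hyps) auto
  finally show ?case
    by (simp add: E_insert[OF insert.hyps] E_add E_cmult)
qed

end

section \<open>Hypercontractivity and noise\<close>

text \<open>\<open>s ^ n\<close> is at most each of the \<open>n\<close> terms of the geometric sum.
  This bounds both the total influence and, from below, the energy gained by enlarging
  \<open>J\<close>.\<close>

lemma mult_power_le_one_minus_power:
  fixes s :: real
  assumes "0 \<le> s" "s < 1"
  shows "(1 - s) * (real n * s ^ n) \<le> 1 - s ^ n"
proof -
  have "real n * s ^ n = (\<Sum>k<n. s ^ n)" by simp
  also have "\<dots> \<le> (\<Sum>k<n. s ^ k)"
    using assms by (intro sum_mono power_decreasing) auto
  also have "\<dots> = (1 - s ^ n) / (1 - s)"
    using assms by (simp add: sum_gp_strict)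
  finally show ?thesis using assms by (simp add: field_simps)
qed

lemma mult_power_le_geometric:
  fixes s :: real
  assumes "0 \<le> s" "s < 1"
  shows "real n * s ^ n \<le> 1 / (1 - s)"
proof -
  have "(1 - s) * (real n * s ^ n) \<le> 1"
    using mult_power_le_one_minus_power[OF assms, of n] zero_le_power[OF assms(1), of n] by linarith
  then show ?thesis using assms by (simp add: field_simps)
qed

context biased_cube
begin

section \<open>Fourth moments and hypercontractivity for the biased measure\<close>

lemma E_Cauchy_Schwarz: "(E V (\<lambda>x. f x * g x))\<^sup>2 \<le> E V (\<lambda>x. (f x)\<^sup>2) * E V (\<lambda>x. (g x)\<^sup>2)"
proof -
  have "(E V (\<lambda>x. f x * g x))\<^sup>2
      = (\<Sum>x\<in>Pow V. (sqrt (mu p V x) * f x) * (sqrt (mu p V x) * g x))\<^sup>2"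
    unfolding cube_expectation_def
    by (intro arg_cong[where f = "\<lambda>t. t\<^sup>2"] sum.cong refl)
      (metis (no_types, opaque_lifting) mu_nonneg real_sqrt_mult_self abs_of_nonneg mult.assoc mult.left_commute)
  also have "\<dots> \<le> (\<Sum>x\<in>Pow V. (sqrt (mu p V x) * f x)\<^sup>2) * (\<Sum>x\<in>Pow V. (sqrt (mu p V x) * g x)\<^sup>2)"
    by (rule Cauchy_Schwarz_ineq_sum)
  finally show ?thesis by (simp add: cube_expectation_def power_mult_distrib mu_nonneg)
qed

text \<open>One point is split off at a time. \<open>pointwise\<close> is the inequality in one bit,
  and Cauchy-Schwarz bounds the mixed fourth moment by \<open>g * h\<close>, which completes the
  square of \<open>g + h\<close>.\<close>

lemma hypercontractive:
  obtains r where "0 < r" "r \<le> 1"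
    "\<And>(V :: 'a set) c. finite V \<Longrightarrow>
       E V (\<lambda>x. (\<Sum>S\<in>Pow V. r ^ card S * c S * chi S x) ^ 4) \<le> (\<Sum>S\<in>Pow V. (c S)\<^sup>2)\<^sup>2"
proof -
  define k3 where "k3 = (1 - p) * phi False ^ 3 + p * phi True ^ 3"
  define k4 where "k4 = (1 - p) * phi False ^ 4 + p * phi True ^ 4"
  have k4: "k4 \<ge> 0" using p_pos p_less by (simp add: k4_def)
  \<comment> \<open>The third moment \<open>k3\<close> of a biased bit need not vanish, so a cubic
    term survives. The denominator is chosen to give \<open>r \<le> 1 / 2\<close>,
    \<open>r * \<bar>k3\<bar> \<le> 1\<close> and \<open>r * k4 \<le> 1\<close> at once, with no
    attempt at the best constant.\<close>
  define r where "r = 1 / (2 + \<bar>k3\<bar> + k4)"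
  have r: "0 < r" "r \<le> 1 / 2" "r * \<bar>k3\<bar> \<le> 1" "r * k4 \<le> 1"
  proof -
    have "0 < 2 + \<bar>k3\<bar> + k4" using k4 by linarith
    then show "0 < r" "r \<le> 1 / 2" "r * \<bar>k3\<bar> \<le> 1" "r * k4 \<le> 1"
      using k4 by (simp_all add: r_def field_simps)
  qed
  have r2: "r\<^sup>2 \<le> 1 / 4" "r ^ 3 \<le> 1 / 8"
    using power_mono[OF r(2), of 2] power_mono[OF r(2), of 3] r(1) by (simp_all add: power_divide)
  have c3: "r ^ 3 * \<bar>k3\<bar> \<le> 1 / 4"
  proof -
    have "r ^ 3 * \<bar>k3\<bar> = r\<^sup>2 * (r * \<bar>k3\<bar>)" by (simp add: power2_eq_square power3_eq_cube)
    also have "\<dots> \<le> r\<^sup>2 * 1" using r by (intro mult_left_mono) auto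
    finally show ?thesis using r2 by simp
  qed
  have c4: "r ^ 4 * k4 \<le> 1 / 8"
  proof -
    have "r ^ 4 * k4 = r ^ 3 * (r * k4)" by (simp add: power3_eq_cube power4_eq_xxxx)
    also have "\<dots> \<le> r ^ 3 * 1" using r by (intro mult_left_mono) auto
    finally show ?thesis using r2 by simp
  qed
  have pointwise: "(1 - p) * (g + r * phi False * h) ^ 4 + p * (g + r * phi True * h) ^ 4
      \<le> g ^ 4 + 2 * (g\<^sup>2 * h\<^sup>2) + h ^ 4" for g h
  proof -
    have "(1 - p) * (g + r * phi False * h) ^ 4 + p * (g + r * phi True * h) ^ 4
        = g ^ 4 + 4 * r * g ^ 3 * h * ((1 - p) * phi False + p * phi True)
         + 6 * r\<^sup>2 * (g\<^sup>2 * h\<^sup>2) * ((1 - p) * (phi False)\<^sup>2 + p * (phi True)\<^sup>2)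
         + 4 * r ^ 3 * k3 * (g * h ^ 3) + r ^ 4 * k4 * h ^ 4"
      unfolding k3_def k4_def by (simp add: power4_eq_xxxx power3_eq_cube power2_eq_square algebra_simps)
    also have "\<dots> = g ^ 4 + 6 * r\<^sup>2 * (g\<^sup>2 * h\<^sup>2) + 4 * r ^ 3 * k3 * (g * h ^ 3) + r ^ 4 * k4 * h ^ 4"
      by (simp add: phi_mean phi_var)
    \<comment> \<open>The budget is 2 for \<open>g\<^sup>2 * h\<^sup>2\<close> and 1 for
      \<open>h ^ 4\<close>; it is spent as 3/2 + 1/2 and 1/2 + 1/8.\<close>
    also have "\<dots> \<le> g ^ 4 + 6 * (1 / 4) * (g\<^sup>2 * h\<^sup>2) + 1 / 2 * (g\<^sup>2 * h\<^sup>2 + h ^ 4) + 1 / 8 * h ^ 4"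
    proof (intro add_mono order_refl)
      show "6 * r\<^sup>2 * (g\<^sup>2 * h\<^sup>2) \<le> 6 * (1 / 4) * (g\<^sup>2 * h\<^sup>2)"
        using r2 by (intro mult_right_mono) auto
      show "r ^ 4 * k4 * h ^ 4 \<le> 1 / 8 * h ^ 4" using c4 by (intro mult_right_mono) auto
      have "2 * \<bar>g * h ^ 3\<bar> \<le> g\<^sup>2 * h\<^sup>2 + h ^ 4"
      proof -
        have "\<bar>g * h ^ 3\<bar> = \<bar>g * h\<bar> * h\<^sup>2" by (simp add: abs_mult power2_eq_square power3_eq_cube)
        then show ?thesis
          using sum_squares_bound[of "\<bar>g * h\<bar>" "h\<^sup>2"] by (simp add: power_mult_distrib)
      qed
      then have "4 * (r ^ 3 * \<bar>k3\<bar>) * \<bar>g * h ^ 3\<bar> \<le> 4 * (1 / 4) * ((g\<^sup>2 * h\<^sup>2 + h ^ 4) / 2)"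
        using c3 r by (intro mult_mono) auto
      moreover have "4 * r ^ 3 * k3 * (g * h ^ 3) \<le> 4 * (r ^ 3 * \<bar>k3\<bar>) * \<bar>g * h ^ 3\<bar>"
        using r abs_ge_self[of "4 * r ^ 3 * k3 * (g * h ^ 3)"] by (simp add: abs_mult)
      ultimately show "4 * r ^ 3 * k3 * (g * h ^ 3) \<le> 1 / 2 * (g\<^sup>2 * h\<^sup>2 + h ^ 4)" by simp
    qed
    also have "\<dots> \<le> g ^ 4 + 2 * (g\<^sup>2 * h\<^sup>2) + h ^ 4"
      by (simp add: field_simps)
    finally show ?thesis .
  qed
  have main: "E V (\<lambda>x. (\<Sum>S\<in>Pow V. r ^ card S * c S * chi S x) ^ 4) \<le> (\<Sum>S\<in>Pow V. (c S)\<^sup>2)\<^sup>2"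
    if "finite V" for V :: "'a set" and c
    using that
  proof (induction V arbitrary: c rule: finite_induct)
    case empty
    then show ?case by (simp add: chi_def)
  next
    case (insert i V)
    define G where "G x = (\<Sum>S\<in>Pow V. r ^ card S * c S * chi S x)" for x
    define H where "H x = (\<Sum>S\<in>Pow V. r ^ card S * c (insert i S) * chi S x)" for x
    define g h where "g = (\<Sum>S\<in>Pow V. (c S)\<^sup>2)" and "h = (\<Sum>S\<in>Pow V. (c (insert i S))\<^sup>2)"
    have gh: "0 \<le> g" "0 \<le> h" by (auto simp: g_def h_def intro: sum_nonneg)
    have i: "i \<notin> y" "finite y" if "y \<in> Pow V" for y using that insert.hyps finite_subset by auto
    have F: "(\<Sum>S\<in>Pow (insert i V). r ^ card S * c S * chi S x) = G x + r * phi (i \<in> x) * H x" for x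
      unfolding sum_Pow_insert[OF insert.hyps] G_def H_def sum_distrib_left
      by (intro arg_cong2[where f = "(+)"] sum.cong) (simp_all add: chi_insert i)
    have GH: "G (insert i x) = G x" "H (insert i x) = H x" for x
      unfolding G_def H_def by (intro sum.cong refl; simp add: chi_insert_arg i)+
    have IH: "E V (\<lambda>x. G x ^ 4) \<le> g\<^sup>2" "E V (\<lambda>x. H x ^ 4) \<le> h\<^sup>2"
      using insert.IH[of c] insert.IH[of "\<lambda>S. c (insert i S)"] by (simp_all add: G_def H_def g_def h_def)
    have "E (insert i V) (\<lambda>x. (\<Sum>S\<in>Pow (insert i V). r ^ card S * c S * chi S x) ^ 4)
        = E V (\<lambda>x. (1 - p) * (G x + r * phi False * H x) ^ 4 + p * (G x + r * phi True * H x) ^ 4)"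
      unfolding F E_insert[OF insert.hyps] GH E_add E_cmult
      by (intro arg_cong2[where f = "(+)"] arg_cong2[where f = "(*)"] refl E_cong) (use i in auto)
    also have "\<dots> \<le> E V (\<lambda>x. G x ^ 4 + 2 * ((G x)\<^sup>2 * (H x)\<^sup>2) + H x ^ 4)"
      by (intro E_mono pointwise)
    also have "\<dots> = E V (\<lambda>x. G x ^ 4) + 2 * E V (\<lambda>x. (G x)\<^sup>2 * (H x)\<^sup>2) + E V (\<lambda>x. H x ^ 4)"
      by (simp only: E_add E_cmult)
    also have "\<dots> \<le> g\<^sup>2 + 2 * (g * h) + h\<^sup>2"
    proof (intro add_mono mult_left_mono IH)
      have "(E V (\<lambda>x. (G x)\<^sup>2 * (H x)\<^sup>2))\<^sup>2 \<le> E V (\<lambda>x. G x ^ 4) * E V (\<lambda>x. H x ^ 4)"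
        using E_Cauchy_Schwarz[of V "\<lambda>x. (G x)\<^sup>2" "\<lambda>x. (H x)\<^sup>2"] by simp
      also have "\<dots> \<le> g\<^sup>2 * h\<^sup>2" by (intro mult_mono IH E_nonneg) auto
      finally have "(E V (\<lambda>x. (G x)\<^sup>2 * (H x)\<^sup>2))\<^sup>2 \<le> (g * h)\<^sup>2" by (simp add: power_mult_distrib)
      then show "E V (\<lambda>x. (G x)\<^sup>2 * (H x)\<^sup>2) \<le> g * h" using gh by (simp add: abs_le_square_iff[symmetric])
    qed simp
    also have "\<dots> = (\<Sum>S\<in>Pow (insert i V). (c S)\<^sup>2)\<^sup>2"
      unfolding sum_Pow_insert[OF insert.hyps] g_def[symmetric] h_def[symmetric]
      by (simp add: power2_sum)
    finally show ?case .
  qed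
  show ?thesis
    by (rule that[of r]) (use r main in auto)
qed

text \<open>In degree at most \<open>D\<close> the damping \<open>r ^ card S\<close> can be undone,
  enlarging the sum of squares by at most \<open>(1 / r) ^ (2 * D)\<close>; squaring gives
  \<open>B = (1 / r) ^ 4\<close>, which depends on neither \<open>V\<close> nor
  \<open>D\<close>.\<close>

lemma hypercontractive_low_degree:
  obtains B where "B \<ge> 1"
    "\<And>(V :: 'a set) c D. finite V \<Longrightarrow>
       E V (\<lambda>x. (\<Sum>S\<in>Pow V. (if card S \<le> D then c S else 0) * chi S x) ^ 4) \<le> B ^ D * (\<Sum>S\<in>Pow V. (c S)\<^sup>2)\<^sup>2"
proof -
  obtain r where r: "0 < r" "r \<le> 1" and hyp:
    "\<And>(V :: 'a set) c. finite V \<Longrightarrow>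
       E V (\<lambda>x. (\<Sum>S\<in>Pow V. r ^ card S * c S * chi S x) ^ 4) \<le> (\<Sum>S\<in>Pow V. (c S)\<^sup>2)\<^sup>2"
    using hypercontractive by blast
  have "E V (\<lambda>x. (\<Sum>S\<in>Pow V. (if card S \<le> D then c S else 0) * chi S x) ^ 4)
      \<le> ((1 / r) ^ 4) ^ D * (\<Sum>S\<in>Pow V. (c S)\<^sup>2)\<^sup>2"
    if "finite V" for V :: "'a set" and c D
  proof -
    define c' where "c' S = (if card S \<le> D then (1 / r) ^ card S * c S else 0)" for S
    have "r ^ card S * c' S = (if card S \<le> D then c S else 0)" for S
      using r by (simp add: c'_def power_one_over)
    then have "E V (\<lambda>x. (\<Sum>S\<in>Pow V. (if card S \<le> D then c S else 0) * chi S x) ^ 4) \<le> (\<Sum>S\<in>Pow V. (c' S)\<^sup>2)\<^sup>2"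
      using hyp[OF that, of c'] by simp
    also have "\<dots> \<le> (((1 / r)\<^sup>2) ^ D * (\<Sum>S\<in>Pow V. (c S)\<^sup>2))\<^sup>2"
      unfolding sum_distrib_left
    proof (intro power_mono sum_mono sum_nonneg)
      fix S
      show "(c' S)\<^sup>2 \<le> ((1 / r)\<^sup>2) ^ D * (c S)\<^sup>2"
      proof (cases "card S \<le> D")
        case True
        have "(c' S)\<^sup>2 = ((1 / r)\<^sup>2) ^ card S * (c S)\<^sup>2"
          using True by (simp add: c'_def power_mult_distrib power_mult[symmetric] mult.commute)
        also have "\<dots> \<le> ((1 / r)\<^sup>2) ^ D * (c S)\<^sup>2"
          using True r by (intro mult_right_mono power_increasing) (auto simp: one_le_power)
        finally show ?thesis .
      qed (use r in \<open>auto simp: c'_def\<close>)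
    qed auto
    also have "\<dots> = ((1 / r) ^ 4) ^ D * (\<Sum>S\<in>Pow V. (c S)\<^sup>2)\<^sup>2"
      by (simp add: power_mult_distrib flip: power_mult)
    finally show ?thesis .
  qed
  moreover have "(1 / r) ^ 4 \<ge> 1" using r by (intro one_le_power) auto
  ultimately show ?thesis using that by blast
qed

text \<open>Up to the factor \<open>(phi True - phi False)\<^sup>2\<close>, the mean square of the
  discrete derivative of \<open>noise s V f\<close> at \<open>i\<close>.\<close>

definition infl :: "real \<Rightarrow> 'a set \<Rightarrow> ('a set \<Rightarrow> real) \<Rightarrow> 'a \<Rightarrow> real" where
  "infl s V f i = (\<Sum>S\<in>Pow V. if i \<in> S then s ^ (2 * card S) * (coef V f S)\<^sup>2 else 0)"

lemma coef_sq_sum_le: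
  assumes "finite V" "\<And>x. x \<subseteq> V \<Longrightarrow> f x \<in> {0..1}"
  shows "(\<Sum>S\<in>Pow V. (coef V f S)\<^sup>2) \<le> 1"
proof -
  have "(\<Sum>S\<in>Pow V. (coef V f S)\<^sup>2) = E V (\<lambda>x. f x * f x)"
    by (simp add: parseval[OF assms(1)] power2_eq_square)
  also have "\<dots> \<le> E V (\<lambda>x. 1)"
    using assms(2) by (intro E_mono) (auto intro: mult_le_one)
  finally show ?thesis by (simp add: E_const[OF assms(1)])
qed

lemma infl_nonneg: "0 \<le> s \<Longrightarrow> 0 \<le> infl s V f i"
  by (auto simp: infl_def intro!: sum_nonneg)

text \<open>Summing over \<open>i\<close> counts \<open>S\<close> with multiplicity
  \<open>card S\<close>, and the noise factor compensates for that. So the total influence is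
  bounded independently of \<open>V\<close>, and only boundedly many points can be
  influential.\<close>

lemma sum_infl_le:
  assumes "finite V" "\<And>x. x \<subseteq> V \<Longrightarrow> f x \<in> {0..1}" "0 \<le> s" "s < 1"
  shows "(\<Sum>i\<in>V. infl s V f i) \<le> 1 / (1 - s)"
proof -
  have "(\<Sum>i\<in>V. infl s V f i) = (\<Sum>S\<in>Pow V. real (card S) * (s ^ (2 * card S) * (coef V f S)\<^sup>2))"
    unfolding infl_def by (rule sum_sum_Pow_member[OF assms(1)])
  also have "\<dots> \<le> (\<Sum>S\<in>Pow V. 1 / (1 - s) * (coef V f S)\<^sup>2)"
  proof (rule sum_mono)
    fix S :: "'a set"
    have "real (card S) * s ^ (2 * card S) = real (card S) * s ^ card S * s ^ card S"
      by (simp add: mult_2 power_add)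
    also have "\<dots> \<le> 1 / (1 - s) * 1"
      using assms mult_power_le_geometric[of s "card S"] by (intro mult_mono power_le_one) auto
    finally show "real (card S) * (s ^ (2 * card S) * (coef V f S)\<^sup>2) \<le> 1 / (1 - s) * (coef V f S)\<^sup>2"
      unfolding mult.assoc[symmetric] by (intro mult_right_mono) auto
  qed
  also have "\<dots> \<le> 1 / (1 - s) * 1"
    unfolding sum_distrib_left[symmetric]
    by (intro mult_left_mono coef_sq_sum_le) (use assms in auto)
  finally show ?thesis by simp
qed

text \<open>The derivative kills the characters of sets avoiding \<open>i\<close>; from the others
  it strips the factor at \<open>i\<close>, leaving \<open>phi True - phi False\<close>.\<close>

lemma disc_chi_sum:
  assumes "finite V" "i \<in> V"
  shows "disc i (\<lambda>x. \<Sum>S\<in>Pow V. b S * chi S x) x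
    = (phi True - phi False) * (\<Sum>S\<in>Pow V. (if i \<in> S then 0 else b (insert i S)) * chi S x)"
proof -
  define W where "W = V - {i}"
  have W: "finite W" "i \<notin> W" "V = insert i W" using assms by (auto simp: W_def)
  have i: "i \<notin> S" "finite S" if "S \<in> Pow W" for S using that W finite_subset by auto
  have "(\<Sum>S\<in>Pow W. b (insert i S) * chi (insert i S) (insert i x))
     = phi True * (\<Sum>S\<in>Pow W. b (insert i S) * chi S x)"
    "(\<Sum>S\<in>Pow W. b (insert i S) * chi (insert i S) (x - {i}))
     = phi False * (\<Sum>S\<in>Pow W. b (insert i S) * chi S x)"
    unfolding sum_distrib_left by (intro sum.cong refl; simp add: chi_insert chi_insert_arg i)+
  moreover have "(\<Sum>S\<in>Pow W. b S * chi S (insert i x)) = (\<Sum>S\<in>Pow W. b S * chi S (x - {i}))"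
    "(\<Sum>S\<in>Pow W. (if i \<in> S then 0 else b (insert i S)) * chi S x) = (\<Sum>S\<in>Pow W. b (insert i S) * chi S x)"
    by (intro sum.cong refl; simp add: chi_insert_arg i)+
  ultimately show ?thesis
    unfolding W(3) sum_Pow_insert[OF W(1,2)] disc_def by (simp add: left_diff_distrib)
qed

text \<open>Split a discrete derivative $d$ into its parts $L$ of degree at most $D$ and $H$ of higher degree.
  Noise makes $H$ negligible, and $|d| \le 1$ reduces $|d|^3$ to $L^2|d|$ up to $H^2$; this is at most
  $\theta d^2 + L^4/\theta$, where hypercontractivity controls $L^4$ by the square of an influence.\<close>

lemma third_noise_bound:
  assumes s: "0 < s" "s < 1" and "\<kappa> > 0"
  obtains K where "K \<ge> 0"
    "\<And>(V :: 'a set) f. finite V \<Longrightarrow> (\<And>x. x \<subseteq> V \<Longrightarrow> f x \<in> {0..1}) \<Longrightarrow>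
       third V (noise s V f) \<le> \<kappa> + K * (\<Sum>i\<in>V. (infl s V f i)\<^sup>2)"
proof -
  obtain B where B: "B \<ge> 1" "\<And>(V :: 'a set) c D. finite V \<Longrightarrow>
       E V (\<lambda>x. (\<Sum>S\<in>Pow V. (if card S \<le> D then c S else 0) * chi S x) ^ 4) \<le> B ^ D * (\<Sum>S\<in>Pow V. (c S)\<^sup>2)\<^sup>2"
    using hypercontractive_low_degree by blast
  define \<sigma> where "\<sigma> = (phi True - phi False)\<^sup>2"
  have \<sigma>: "\<sigma> > 0" unfolding \<sigma>_def phi_diff_sq using p_pos p_less by simp
  \<comment> \<open>\<open>\<theta>\<close> and \<open>D\<close> are balanced so that, summed over
    \<open>V\<close>, the squared derivatives and the parts of degree above \<open>D\<close>
    contribute at most \<open>\<kappa> / 2\<close> each. The hypercontractive term goes into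
    \<open>K\<close>.\<close>
  define \<theta> where "\<theta> = \<kappa> * (1 - s) / (2 * \<sigma>\<^sup>2)"
  have \<theta>: "\<theta> > 0" using assms \<sigma> by (simp add: \<theta>_def)
  have "(\<lambda>n. s ^ n) \<longlonglongrightarrow> 0" using s by (intro LIMSEQ_power_zero) auto
  moreover have "0 < \<kappa> * (1 - s) / (4 * \<sigma>)" using assms \<sigma> by simp
  ultimately have "\<forall>\<^sub>F n in sequentially. s ^ n < \<kappa> * (1 - s) / (4 * \<sigma>)"
    by (rule order_tendstoD)
  then obtain D where D: "s ^ D < \<kappa> * (1 - s) / (4 * \<sigma>)"
    by (auto simp: eventually_sequentially)
  define K where "K = \<sigma> / \<theta> * B ^ D"
  have K: "K \<ge> 0" unfolding K_def using \<sigma> \<theta> B(1)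
    by (intro mult_nonneg_nonneg divide_nonneg_nonneg zero_le_power) auto
  have "third V (noise s V f) \<le> \<kappa> + K * (\<Sum>i\<in>V. (infl s V f i)\<^sup>2)"
    if V: "finite V" and f: "\<And>x. x \<subseteq> V \<Longrightarrow> f x \<in> {0..1}" for V :: "'a set" and f
  proof -
    define h where "h = noise s V f"
    define b where "b S = s ^ card S * coef V f S" for S
    define c where "c i S = (if i \<in> S then 0 else b (insert i S))" for i S
    define d where "d i x = (\<Sum>S\<in>Pow V. c i S * chi S x)" for i x
    define L where "L i x = (\<Sum>S\<in>Pow V. (if card S \<le> D then c i S else 0) * chi S x)" for i x
    define H where "H i x = (\<Sum>S\<in>Pow V. (if card S \<le> D then 0 else c i S) * chi S x)" for i x
    have dLH: "d i x = L i x + H i x" for i x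
      unfolding d_def L_def H_def sum.distrib[symmetric] by (intro sum.cong) auto
    have h01: "h x \<in> {0..1}" for x
      unfolding h_def by (intro noise_bounds V f) (use s in auto)
    have b2: "(b S)\<^sup>2 = s ^ (2 * card S) * (coef V f S)\<^sup>2" for S
      by (simp add: b_def power_mult_distrib power_mult[symmetric] mult.commute)
    have disc: "disc i h x = (phi True - phi False) * d i x" if "i \<in> V" for i x
      using disc_chi_sum[OF V that, of b x] by (simp add: h_def noise_def[abs_def] b_def d_def c_def)
    have infl: "(\<Sum>S\<in>Pow V. (c i S)\<^sup>2) = infl s V f i" if "i \<in> V" for i
    proof -
      have "(\<Sum>S\<in>Pow V. (c i S)\<^sup>2) = (\<Sum>S\<in>Pow V. if i \<in> S then 0 else (b (insert i S))\<^sup>2)"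
        by (intro sum.cong) (auto simp: c_def)
      also have "\<dots> = infl s V f i"
        using sum_Pow_shift[OF V that, of "\<lambda>S. (b S)\<^sup>2"] by (simp add: infl_def b2 cong: if_cong)
      finally show ?thesis .
    qed
    have pointwise: "\<bar>disc i h x\<bar> ^ 3 \<le> 2 * \<sigma> * (H i x)\<^sup>2 + \<sigma> * (\<theta> * \<sigma>) * (d i x)\<^sup>2 + \<sigma> / \<theta> * L i x ^ 4"
      if "i \<in> V" for i x
    proof -
      define t where "t = \<bar>disc i h x\<bar>"
      have t: "0 \<le> t" "t \<le> 1" using h01[of "insert i x"] h01[of "x - {i}"] by (auto simp: t_def disc_def)
      have t2: "t\<^sup>2 = \<sigma> * (d i x)\<^sup>2" by (simp add: t_def disc[OF that] \<sigma>_def power_mult_distrib)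
      have "(d i x)\<^sup>2 \<le> 2 * (L i x)\<^sup>2 + 2 * (H i x)\<^sup>2"
        using sum_squares_bound[of "L i x" "H i x"] by (simp add: dLH power2_sum)
      then have "t * (\<sigma> * (d i x)\<^sup>2) \<le> t * (\<sigma> * (2 * (L i x)\<^sup>2 + 2 * (H i x)\<^sup>2))"
        using \<sigma> t by (intro mult_left_mono) auto
      then have "t ^ 3 \<le> t * (\<sigma> * (2 * (H i x)\<^sup>2)) + \<sigma> * (2 * t * (L i x)\<^sup>2)"
        unfolding t2[symmetric] by (simp add: power3_eq_cube power2_eq_square algebra_simps)
      also have "\<dots> \<le> 1 * (\<sigma> * (2 * (H i x)\<^sup>2)) + \<sigma> * (\<theta> * t\<^sup>2 + L i x ^ 4 / \<theta>)"
      proof (intro add_mono mult_right_mono mult_left_mono t)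
        have "0 \<le> (\<theta> * t - (L i x)\<^sup>2)\<^sup>2 / \<theta>" using \<theta> by simp
        then show "2 * t * (L i x)\<^sup>2 \<le> \<theta> * t\<^sup>2 + L i x ^ 4 / \<theta>"
          using \<theta> by (simp add: power2_diff field_simps power2_eq_square power4_eq_xxxx)
      qed (use \<sigma> in auto)
      finally show ?thesis unfolding t2 by (simp add: t_def algebra_simps)
    qed
    have Hsum: "(\<Sum>i\<in>V. E V (\<lambda>x. (H i x)\<^sup>2)) \<le> s ^ D / (1 - s)"
    proof -
      \<comment> \<open>\<open>c i S\<close> is the value of \<open>b\<close> at
        \<open>insert i S\<close>, which has one more element than \<open>S\<close>; hence the
        threshold \<open>Suc D\<close> in place of \<open>D\<close>.\<close>
      define w where "w S = (if card S \<le> Suc D then 0 else (b S)\<^sup>2)" for S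
      have "E V (\<lambda>x. (H i x)\<^sup>2) = (\<Sum>S\<in>Pow V. if i \<in> S then w S else 0)" if "i \<in> V" for i
      proof -
        have "E V (\<lambda>x. (H i x)\<^sup>2) = (\<Sum>S\<in>Pow V. (if card S \<le> D then 0 else c i S)\<^sup>2)"
          unfolding H_def by (rule E_chi_sum_sq[OF V])
        also have "\<dots> = (\<Sum>S\<in>Pow V. if i \<in> S then 0 else w (insert i S))"
          using V by (intro sum.cong) (auto simp: c_def w_def card_insert_if finite_subset)
        finally show ?thesis using sum_Pow_shift[OF V that] by simp
      qed
      then have "(\<Sum>i\<in>V. E V (\<lambda>x. (H i x)\<^sup>2)) = (\<Sum>S\<in>Pow V. real (card S) * w S)"
        using sum_sum_Pow_member[OF V, of w] by simp
      also have "\<dots> \<le> (\<Sum>S\<in>Pow V. s ^ D / (1 - s) * (coef V f S)\<^sup>2)"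
      proof (rule sum_mono)
        fix S :: "'a set"
        show "real (card S) * w S \<le> s ^ D / (1 - s) * (coef V f S)\<^sup>2"
        proof (cases "card S \<le> Suc D")
          case False
          have "real (card S) * s ^ (2 * card S) = real (card S) * s ^ card S * s ^ card S"
            by (simp add: mult_2 power_add)
          also have "\<dots> \<le> 1 / (1 - s) * s ^ D"
            using s False mult_power_le_geometric[of s "card S"] by (intro mult_mono power_decreasing) auto
          finally have "real (card S) * s ^ (2 * card S) * (coef V f S)\<^sup>2 \<le> 1 / (1 - s) * s ^ D * (coef V f S)\<^sup>2"
            by (intro mult_right_mono) auto
          then show ?thesis using False by (simp add: w_def b2)
        qed (use s in \<open>auto simp: w_def\<close>)
      qed
      also have "\<dots> \<le> s ^ D / (1 - s) * 1"
        unfolding sum_distrib_left[symmetric]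
        by (intro mult_left_mono coef_sq_sum_le V f) (use s in auto)
      finally show ?thesis by simp
    qed
    have each: "E V (\<lambda>x. \<bar>disc i h x\<bar> ^ 3)
        \<le> 2 * \<sigma> * E V (\<lambda>x. (H i x)\<^sup>2) + \<sigma> * (\<theta> * \<sigma>) * infl s V f i + K * (infl s V f i)\<^sup>2" if "i \<in> V" for i
    proof -
      have "E V (\<lambda>x. \<bar>disc i h x\<bar> ^ 3)
          \<le> E V (\<lambda>x. 2 * \<sigma> * (H i x)\<^sup>2 + \<sigma> * (\<theta> * \<sigma>) * (d i x)\<^sup>2 + \<sigma> / \<theta> * L i x ^ 4)"
        by (intro E_mono pointwise that)
      also have "\<dots> = 2 * \<sigma> * E V (\<lambda>x. (H i x)\<^sup>2) + \<sigma> * (\<theta> * \<sigma>) * infl s V f i + \<sigma> / \<theta> * E V (\<lambda>x. L i x ^ 4)"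
        unfolding E_add E_cmult d_def E_chi_sum_sq[OF V] infl[OF that] ..
      also have "\<sigma> / \<theta> * E V (\<lambda>x. L i x ^ 4) \<le> \<sigma> / \<theta> * (B ^ D * (infl s V f i)\<^sup>2)"
        unfolding infl[OF that, symmetric] L_def using \<sigma> \<theta> by (intro mult_left_mono B V) auto
      finally show ?thesis by (simp add: K_def)
    qed
    have "third V h \<le> (\<Sum>i\<in>V. 2 * \<sigma> * E V (\<lambda>x. (H i x)\<^sup>2) + \<sigma> * (\<theta> * \<sigma>) * infl s V f i + K * (infl s V f i)\<^sup>2)"
      unfolding third_def by (intro sum_mono each)
    also have "\<dots> = 2 * \<sigma> * (\<Sum>i\<in>V. E V (\<lambda>x. (H i x)\<^sup>2)) + \<sigma> * (\<theta> * \<sigma>) * (\<Sum>i\<in>V. infl s V f i)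
        + K * (\<Sum>i\<in>V. (infl s V f i)\<^sup>2)"
      by (simp add: sum.distrib sum_distrib_left)
    also have "\<dots> \<le> 2 * \<sigma> * (s ^ D / (1 - s)) + \<sigma> * (\<theta> * \<sigma>) * (1 / (1 - s)) + K * (\<Sum>i\<in>V. (infl s V f i)\<^sup>2)"
      using \<sigma> \<theta> s K by (intro add_mono mult_left_mono Hsum sum_infl_le V f) auto
    also have "2 * \<sigma> * (s ^ D / (1 - s)) \<le> 2 * \<sigma> * (\<kappa> * (1 - s) / (4 * \<sigma>) / (1 - s))"
      using D \<sigma> s by (intro mult_left_mono divide_right_mono) auto
    also have "\<dots> = \<kappa> / 2" using \<sigma> s by simp
    also have "\<sigma> * (\<theta> * \<sigma>) * (1 / (1 - s)) = \<kappa> / 2"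
      using \<sigma> s by (simp add: \<theta>_def power2_eq_square field_simps)
    finally show ?thesis by (simp add: h_def)
  qed
  then show ?thesis using that K by blast
qed

text \<open>Polarisation of \<open>E_chi_sum_sq\<close>.\<close>

lemma E_chi_sum_mult:
  assumes "finite V"
  shows "E V (\<lambda>x. (\<Sum>S\<in>Pow V. b S * chi S x) * (\<Sum>S\<in>Pow V. c S * chi S x)) = (\<Sum>S\<in>Pow V. b S * c S)"
proof -
  have 1: "(\<Sum>S\<in>Pow V. b S * chi S x) * (\<Sum>S\<in>Pow V. c S * chi S x)
      = 1 / 4 * ((\<Sum>S\<in>Pow V. (b S + c S) * chi S x)\<^sup>2 - (\<Sum>S\<in>Pow V. (b S - c S) * chi S x)\<^sup>2)" for x
    by (simp add: distrib_right left_diff_distrib sum.distrib sum_subtractf)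
      (simp add: power2_eq_square algebra_simps)
  have 2: "b S * c S = 1 / 4 * ((b S + c S)\<^sup>2 - (b S - c S)\<^sup>2)" for S
    by (simp add: power2_eq_square algebra_simps)
  show ?thesis
    by (subst 1, subst 2) (simp only: E_cmult E_diff E_chi_sum_sq[OF assms] sum_distrib_left[symmetric] sum_subtractf)
qed

text \<open>Uniqueness of the character expansion: \<open>noise\<close> is defined by an expansion,
  and its coefficients have to be read off from it.\<close>

lemma coef_chi_sum:
  assumes "finite V" "R \<subseteq> V"
  shows "coef V (\<lambda>x. \<Sum>S\<in>Pow V. c S * chi S x) R = c R"
proof -
  have delta: "(\<Sum>S\<in>Pow V. (if S = R then 1 else 0) * h S) = h R" for h :: "'a set \<Rightarrow> real"
    using assms by (simp add: if_distrib[where f = "\<lambda>t. t * _"] cong: if_cong)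
  show ?thesis
    using E_chi_sum_mult[OF assms(1), of "\<lambda>S. if S = R then 1 else 0" c]
    unfolding delta coef_def by (simp add: mult.commute)
qed

lemma coef_noise:
  assumes "finite V" "R \<subseteq> V"
  shows "coef V (noise s V f) R = s ^ card R * coef V f R"
  using coef_chi_sum[OF assms, of "\<lambda>S. s ^ card S * coef V f S"] by (simp add: noise_def[abs_def])

lemma E_noise:
  assumes "finite V"
  shows "E V (noise s V f) = E V f"
  using coef_noise[OF assms, of "{}" s f] by (simp add: coef_def chi_def)

text \<open>Noise multiplies the Fourier term at \<open>S\<close> by a factor that differs from 1 by
  at most \<open>2 * (1 - s) * card S\<close>. The term already carries \<open>lam ^ card S\<close>,
  and since \<open>\<bar>lam\<bar> < 1\<close> this absorbs \<open>card S\<close>; the error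
  therefore vanishes as \<open>s\<close> tends to 1, uniformly in \<open>V\<close>.\<close>

lemma pairexp_noise_error:
  assumes V: "finite V" and s: "0 \<le> s" "s < 1"
    and f: "\<And>x. x \<subseteq> V \<Longrightarrow> f x \<in> {0..1}" and g: "\<And>x. x \<subseteq> V \<Longrightarrow> g x \<in> {0..1}"
  shows "pairexp V (\<lambda>x y. noise s V f x * noise s V g y) - 2 * (1 - s) / (1 - \<bar>lam\<bar>) \<le> pairexp V (\<lambda>x y. f x * g y)"
proof -
  define c where "c = 2 * (1 - s) / (1 - \<bar>lam\<bar>)"
  let ?F = "coef V f" and ?G = "coef V g"
  have lam: "0 \<le> \<bar>lam\<bar>" "\<bar>lam\<bar> < 1" using p_pos p_less by (auto simp: lam_def field_simps)
  have "pairexp V (\<lambda>x y. noise s V f x * noise s V g y) - pairexp V (\<lambda>x y. f x * g y)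
     = (\<Sum>S\<in>Pow V. - (lam ^ card S * (1 - s ^ (2 * card S)) * (?F S * ?G S)))"
    unfolding pairexp_fourier[OF V] sum_subtractf[symmetric]
  proof (intro sum.cong refl)
    fix S assume "S \<in> Pow V"
    then have cf: "coef V (noise s V h) S = s ^ card S * coef V h S" for h by (simp add: coef_noise[OF V])
    have "s ^ (2 * card S) = s ^ card S * s ^ card S" by (simp add: mult_2 power_add)
    then show "lam ^ card S * coef V (noise s V f) S * coef V (noise s V g) S - lam ^ card S * ?F S * ?G S
      = - (lam ^ card S * (1 - s ^ (2 * card S)) * (?F S * ?G S))"
      unfolding cf by (simp only:) (simp only: algebra_simps)
  qed
  also have "\<dots> \<le> (\<Sum>S\<in>Pow V. c * (((?F S)\<^sup>2 + (?G S)\<^sup>2) / 2))"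
  proof (rule sum_mono)
    fix S :: "'a set"
    have "\<bar>lam ^ card S * (1 - s ^ (2 * card S))\<bar> \<le> c"
    proof -
      have "1 + real (2 * card S) * (s - 1) \<le> (1 + (s - 1)) ^ (2 * card S)"
        using s by (intro Bernoulli_inequality) auto
      then have "1 - s ^ (2 * card S) \<le> 2 * (1 - s) * real (card S)" by (simp add: algebra_simps)
      moreover have "0 \<le> 1 - s ^ (2 * card S)" using s by (simp add: power_le_one)
      ultimately have "\<bar>lam ^ card S * (1 - s ^ (2 * card S))\<bar> \<le> \<bar>lam\<bar> ^ card S * (2 * (1 - s) * real (card S))"
        unfolding abs_mult power_abs by (intro mult_left_mono) auto
      also have "\<dots> = 2 * (1 - s) * (real (card S) * \<bar>lam\<bar> ^ card S)" by simp
      also have "\<dots> \<le> 2 * (1 - s) * (1 / (1 - \<bar>lam\<bar>))"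
        using s by (intro mult_left_mono mult_power_le_geometric lam) auto
      finally show ?thesis by (simp add: c_def)
    qed
    moreover have "\<bar>?F S * ?G S\<bar> \<le> ((?F S)\<^sup>2 + (?G S)\<^sup>2) / 2"
      using sum_squares_bound[of "\<bar>?F S\<bar>" "\<bar>?G S\<bar>"] by (simp add: abs_mult)
    ultimately have "\<bar>lam ^ card S * (1 - s ^ (2 * card S)) * (?F S * ?G S)\<bar> \<le> c * (((?F S)\<^sup>2 + (?G S)\<^sup>2) / 2)"
      unfolding abs_mult[of "_ * _" "?F S * ?G S"] by (intro mult_mono) auto
    then show "- (lam ^ card S * (1 - s ^ (2 * card S)) * (?F S * ?G S)) \<le> c * (((?F S)\<^sup>2 + (?G S)\<^sup>2) / 2)"
      by linarith
  qed
  also have "\<dots> = c * (((\<Sum>S\<in>Pow V. (?F S)\<^sup>2) + (\<Sum>S\<in>Pow V. (?G S)\<^sup>2)) / 2)"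
    unfolding sum_divide_distrib[symmetric] sum_distrib_left[symmetric] sum.distrib ..
  also have "\<dots> \<le> c * ((1 + 1) / 2)"
    using s lam by (intro mult_left_mono divide_right_mono add_mono coef_sq_sum_le V f g) (auto simp: c_def)
  finally show ?thesis by (simp add: c_def)
qed

text \<open>The replacement bound is applied to the noisy functions, which have the same means; the
  exponent is dropped because values lie in [0,1], and then the noise is removed. Half of
  \<open>\<eta>\<close> pays for this removal and a quarter for each of the two third
  moments.\<close>

lemma pairexp_lower_bound:
  assumes "\<eta> > 0" and a: "a \<ge> 2" "real a * p \<le> (real a - 1) * (1 - p)"
  obtains s K where "0 < s" "s < 1" "K \<ge> 0"
    "\<And>(V :: 'a set) f g. finite V \<Longrightarrow> (\<And>x. x \<subseteq> V \<Longrightarrow> f x \<in> {0..1}) \<Longrightarrow> (\<And>x. x \<subseteq> V \<Longrightarrow> g x \<in> {0..1}) \<Longrightarrow>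
       (E V f * E V g) ^ a - \<eta> - K * ((\<Sum>i\<in>V. (infl s V f i)\<^sup>2) + (\<Sum>i\<in>V. (infl s V g i)\<^sup>2))
       \<le> pairexp V (\<lambda>x y. f x * g y)"
proof -
  have lam: "0 \<le> \<bar>lam\<bar>" "\<bar>lam\<bar> < 1" using p_pos p_less by (auto simp: lam_def field_simps)
  \<comment> \<open>The amount of noise: the second bound keeps the error of removing it below
    \<open>\<eta> / 2\<close>, the first keeps \<open>s\<close> positive.\<close>
  define t where "t = min (1 / 2) (\<eta> * (1 - \<bar>lam\<bar>) / 4)"
  define s where "s = 1 - t"
  have t: "0 < t" "t \<le> 1 / 2" "t \<le> \<eta> * (1 - \<bar>lam\<bar>) / 4" using assms lam by (auto simp: t_def)
  then have s: "0 < s" "s < 1" by (auto simp: s_def)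
  have err: "2 * (1 - s) / (1 - \<bar>lam\<bar>) \<le> \<eta> / 2"
    using t lam by (simp add: s_def field_simps)
  define C where "C = 5 * real a ^ 6"
  have C: "C > 0" using a by (simp add: C_def)
  then have "\<eta> / (4 * C) > 0" using assms by simp
  from third_noise_bound[OF s this] obtain K where K: "K \<ge> 0"
    "\<And>(V :: 'a set) f. finite V \<Longrightarrow> (\<And>x. x \<subseteq> V \<Longrightarrow> f x \<in> {0..1}) \<Longrightarrow>
       third V (noise s V f) \<le> \<eta> / (4 * C) + K * (\<Sum>i\<in>V. (infl s V f i)\<^sup>2)"
    by blast
  have "(E V f * E V g) ^ a - \<eta> - C * K * ((\<Sum>i\<in>V. (infl s V f i)\<^sup>2) + (\<Sum>i\<in>V. (infl s V g i)\<^sup>2))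
       \<le> pairexp V (\<lambda>x y. f x * g y)"
    if V: "finite V" and f: "\<And>x. x \<subseteq> V \<Longrightarrow> f x \<in> {0..1}" and g: "\<And>x. x \<subseteq> V \<Longrightarrow> g x \<in> {0..1}" for V :: "'a set" and f g
  proof -
    let ?f = "noise s V f" and ?g = "noise s V g"
    have nb: "?f x \<in> {0..1}" "?g x \<in> {0..1}" for x
      using s by (auto intro!: noise_bounds V f g simp del: atLeastAtMost_iff)
    have "(E V f * E V g) ^ a - C * (third V ?f + third V ?g) \<le> pairexp V (\<lambda>x y. (?f x * ?g y) ^ a)"
      using pairexp_power_lower[OF a V, of ?f ?g] nb by (simp add: E_noise[OF V] C_def)
    also have "\<dots> \<le> pairexp V (\<lambda>x y. ?f x * ?g y)"
    proof (rule pairexp_mono)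
      fix x y
      have "?f x * ?g y \<in> {0..1}" using nb[of x] nb[of y] by (auto intro: mult_le_one)
      then show "(?f x * ?g y) ^ a \<le> ?f x * ?g y"
        using a power_decreasing[of 1 a "?f x * ?g y"] by auto
    qed
    also have "\<dots> \<le> pairexp V (\<lambda>x y. f x * g y) + \<eta> / 2"
    proof -
      have "pairexp V (\<lambda>x y. ?f x * ?g y) - 2 * (1 - s) / (1 - \<bar>lam\<bar>) \<le> pairexp V (\<lambda>x y. f x * g y)"
        using s by (intro pairexp_noise_error V f g) auto
      then show ?thesis using err by linarith
    qed
    finally have "(E V f * E V g) ^ a \<le> pairexp V (\<lambda>x y. f x * g y) + \<eta> / 2 + C * (third V ?f + third V ?g)"
      by simp
    also have "C * (third V ?f + third V ?g) \<le> C * ((\<eta> / (4 * C) + K * (\<Sum>i\<in>V. (infl s V f i)\<^sup>2))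
       + (\<eta> / (4 * C) + K * (\<Sum>i\<in>V. (infl s V g i)\<^sup>2)))"
      using C by (intro mult_left_mono add_mono K V f g) auto
    also have "\<dots> = \<eta> / 2 + C * K * ((\<Sum>i\<in>V. (infl s V f i)\<^sup>2) + (\<Sum>i\<in>V. (infl s V g i)\<^sup>2))"
      using C by (simp add: field_simps)
    finally show ?thesis by simp
  qed
  then show ?thesis using that[OF s, of "C * K"] K(1) C by simp
qed

section \<open>Energy increment\<close>

lemma coef_union:
  assumes "finite J" "finite V" "J \<inter> V = {}" "R \<subseteq> J" "S \<subseteq> V"
  shows "coef J (\<lambda>w. coef V (\<lambda>x. g (w \<union> x)) S) R = coef (J \<union> V) g (R \<union> S)"
proof -
  have "chi (R \<union> S) (w \<union> x) = chi R w * chi S x" if "w \<subseteq> J" "x \<subseteq> V" for w x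
  proof -
    have "finite R" "finite S" "R \<inter> S = {}" using assms finite_subset by auto
    then have "chi (R \<union> S) (w \<union> x) = (\<Prod>i\<in>R. phi (i \<in> w \<union> x)) * (\<Prod>i\<in>S. phi (i \<in> w \<union> x))"
      unfolding chi_def by (rule prod.union_disjoint)
    also have "\<dots> = chi R w * chi S x"
    proof -
      have "i \<in> w \<union> x \<longleftrightarrow> i \<in> w" if "i \<in> R" for i
        using that \<open>w \<subseteq> J\<close> \<open>x \<subseteq> V\<close> assms by auto
      moreover have "i \<in> w \<union> x \<longleftrightarrow> i \<in> x" if "i \<in> S" for i
        using that \<open>w \<subseteq> J\<close> \<open>x \<subseteq> V\<close> assms by auto
      ultimately show ?thesis
        unfolding chi_def by (intro arg_cong2[where f = "(*)"] prod.cong refl) auto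
    qed
    finally show ?thesis .
  qed
  then have "coef (J \<union> V) g (R \<union> S) = E J (\<lambda>w. E V (\<lambda>x. (g (w \<union> x) * chi S x) * chi R w))"
    unfolding coef_def E_union[OF assms(1-3)] by (intro E_cong) (simp add: mult_ac)
  then show ?thesis by (simp add: coef_def E_multc)
qed

text \<open>Parseval in the coordinates of \<open>J\<close>: averaging over \<open>w\<close> the
  squared coefficient at \<open>S\<close> of the restriction gives the sum of the squared
  coefficients of \<open>g\<close> at all \<open>R \<union> S\<close> with
  \<open>R \<subseteq> J\<close>. Noise acts after restriction, so it sees \<open>Z - J\<close>
  only.\<close>

lemma E_infl:
  assumes "finite J" "finite V" "J \<inter> V = {}" "i \<in> V"
  shows "E J (\<lambda>w. infl s V (\<lambda>x. g (w \<union> x)) i)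
    = (\<Sum>Z\<in>Pow (J \<union> V). if i \<in> Z then s ^ (2 * card (Z - J)) * (coef (J \<union> V) g Z)\<^sup>2 else 0)"
proof -
  have sq: "E J (\<lambda>w. (coef V (\<lambda>x. g (w \<union> x)) S)\<^sup>2) = (\<Sum>R\<in>Pow J. (coef (J \<union> V) g (R \<union> S))\<^sup>2)" if "S \<in> Pow V" for S
    unfolding power2_eq_square parseval[OF assms(1)]
    using that by (intro sum.cong refl) (simp add: coef_union[OF assms(1-3)])
  have "E J (\<lambda>w. infl s V (\<lambda>x. g (w \<union> x)) i)
     = (\<Sum>S\<in>Pow V. E J (\<lambda>w. (if i \<in> S then s ^ (2 * card S) else 0) * (coef V (\<lambda>x. g (w \<union> x)) S)\<^sup>2))"
    unfolding E_sum[symmetric] infl_def by (intro E_cong sum.cong) auto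
  also have "\<dots> = (\<Sum>S\<in>Pow V. \<Sum>R\<in>Pow J. (if i \<in> S then s ^ (2 * card S) else 0) * (coef (J \<union> V) g (R \<union> S))\<^sup>2)"
    unfolding E_cmult sum_distrib_left[symmetric] by (intro sum.cong refl) (simp add: sq)
  also have "\<dots> = (\<Sum>R\<in>Pow J. \<Sum>S\<in>Pow V. (if i \<in> S then s ^ (2 * card S) else 0) * (coef (J \<union> V) g (R \<union> S))\<^sup>2)"
    by (rule sum.swap)
  also have "\<dots> = (\<Sum>R\<in>Pow J. \<Sum>S\<in>Pow V. if i \<in> R \<union> S
      then s ^ (2 * card (R \<union> S - J)) * (coef (J \<union> V) g (R \<union> S))\<^sup>2 else 0)"
  proof (intro sum.cong refl)
    fix R S assume "R \<in> Pow J" "S \<in> Pow V"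
    then have "R \<union> S - J = S" "i \<in> R \<union> S \<longleftrightarrow> i \<in> S" using assms by auto
    then show "(if i \<in> S then s ^ (2 * card S) else 0) * (coef (J \<union> V) g (R \<union> S))\<^sup>2
      = (if i \<in> R \<union> S then s ^ (2 * card (R \<union> S - J)) * (coef (J \<union> V) g (R \<union> S))\<^sup>2 else 0)" by simp
  qed
  finally show ?thesis unfolding sum_Pow_union[OF assms(1-3)] .
qed

text \<open>Moving influential points into \<open>J\<close> switches off their noise, which increases this bounded
  quantity.\<close>

definition potential :: "real \<Rightarrow> 'a set \<Rightarrow> ('a set \<Rightarrow> real) \<Rightarrow> 'a set \<Rightarrow> real" where
  "potential s U g J = (\<Sum>Z\<in>Pow U. s ^ (2 * card (Z - J)) * (coef U g Z)\<^sup>2)"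

lemma potential_bounds:
  assumes "finite U" "\<And>x. x \<subseteq> U \<Longrightarrow> g x \<in> {0..1}" "0 \<le> s" "s \<le> 1"
  shows "potential s U g J \<in> {0..1}"
proof -
  have "potential s U g J \<le> (\<Sum>Z\<in>Pow U. (coef U g Z)\<^sup>2)"
    unfolding potential_def using assms
    by (intro sum_mono mult_left_le_one_le) (auto intro: power_le_one)
  also have "\<dots> \<le> 1" by (rule coef_sq_sum_le[OF assms(1,2)])
  finally show ?thesis using assms by (auto simp: potential_def intro!: sum_nonneg)
qed

text \<open>For a set \<open>Z\<close> with \<open>n\<close> points in \<open>A\<close> and
  \<open>m\<close> points outside \<open>J \<union> A\<close>, the weight grows by
  \<open>s ^ (2 * m) * (1 - s ^ (2 * n))\<close>, while the influences over \<open>A\<close> count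
  it \<open>n\<close> times with weight \<open>s ^ (2 * (m + n))\<close>.\<close>

lemma potential_increment:
  assumes "finite U" "J \<subseteq> U" "A \<subseteq> U - J" "0 \<le> s" "s < 1"
  shows "(1 - s) * E J (\<lambda>w. \<Sum>i\<in>A. infl s (U - J) (\<lambda>x. g (w \<union> x)) i)
    \<le> potential s U g (J \<union> A) - potential s U g J"
proof -
  have fin: "finite J" "finite (U - J)" "J \<inter> (U - J) = {}" "J \<union> (U - J) = U" "finite A"
    using assms finite_subset finite_subset[OF assms(3)] by auto
  have "E J (\<lambda>w. \<Sum>i\<in>A. infl s (U - J) (\<lambda>x. g (w \<union> x)) i)
      = (\<Sum>i\<in>A. \<Sum>Z\<in>Pow U. if i \<in> Z then s ^ (2 * card (Z - J)) * (coef U g Z)\<^sup>2 else 0)"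
    unfolding E_sum using E_infl[OF fin(1-3), of _ s g] assms(3) unfolding fin(4)
    by (intro sum.cong) auto
  also have "\<dots> = (\<Sum>Z\<in>Pow U. real (card (A \<inter> Z)) * s ^ (2 * card (Z - J)) * (coef U g Z)\<^sup>2)"
    by (subst sum.swap) (simp add: sum.If_cases[OF fin(5)] mult.assoc)
  finally have "(1 - s) * E J (\<lambda>w. \<Sum>i\<in>A. infl s (U - J) (\<lambda>x. g (w \<union> x)) i)
      = (\<Sum>Z\<in>Pow U. (1 - s) * (real (card (A \<inter> Z)) * s ^ (2 * card (Z - J))) * (coef U g Z)\<^sup>2)"
    by (simp add: sum_distrib_left mult.assoc)
  also have "\<dots> \<le> (\<Sum>Z\<in>Pow U. (s ^ (2 * card (Z - (J \<union> A))) - s ^ (2 * card (Z - J))) * (coef U g Z)\<^sup>2)"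
  proof (intro sum_mono mult_right_mono)
    fix Z assume "Z \<in> Pow U"
    then have "finite Z" using assms finite_subset by auto
    define m n where "m = card (Z - (J \<union> A))" and "n = card (A \<inter> Z)"
    have "Z - J = (Z - (J \<union> A)) \<union> (A \<inter> Z)" using assms(3) by auto
    also have "card \<dots> = m + n"
      unfolding m_def n_def using \<open>finite Z\<close> by (intro card_Un_disjoint) auto
    finally have card: "card (Z - J) = m + n" .
    have "(1 - s) * (real n * s ^ (2 * n)) \<le> (1 - s) * (real (2 * n) * s ^ (2 * n))"
      using assms by (intro mult_left_mono mult_right_mono) auto
    also have "\<dots> \<le> 1 - s ^ (2 * n)" by (rule mult_power_le_one_minus_power[OF assms(4,5)])
    finally have "s ^ (2 * m) * ((1 - s) * (real n * s ^ (2 * n))) \<le> s ^ (2 * m) * (1 - s ^ (2 * n))"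
      using assms by (intro mult_left_mono) auto
    then show "(1 - s) * (real (card (A \<inter> Z)) * s ^ (2 * card (Z - J))) \<le> s ^ (2 * card (Z - (J \<union> A))) - s ^ (2 * card (Z - J))"
      unfolding card m_def[symmetric] n_def[symmetric] by (simp add: algebra_simps power_add)
  qed simp
  also have "\<dots> = potential s U g (J \<union> A) - potential s U g J"
    by (simp add: potential_def left_diff_distrib sum_subtractf)
  finally show ?thesis .
qed

text \<open>\<open>J\<close> is repeatedly enlarged by all points influential for some restriction.
  Since the potential is bounded, some step gains little, which means that the points about to be
  added carry little influence on average; the other points have small influence
  individually.\<close>

lemma regularity:
  assumes s: "0 < s" "s < 1" and \<kappa>: "\<kappa> > 0"
  obtains j where "\<And>(U :: 'a set) g. finite U \<Longrightarrow> (\<And>x. x \<subseteq> U \<Longrightarrow> g x \<in> {0..1}) \<Longrightarrow>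
    \<exists>J\<subseteq>U. card J \<le> j \<and> E J (\<lambda>w. \<Sum>i\<in>U - J. (infl s (U - J) (\<lambda>x. g (w \<union> x)) i)\<^sup>2) \<le> \<kappa>"
proof -
  \<comment> \<open>The total influence is at most \<open>1 / (1 - s)\<close>, so points below the
    threshold contribute at most \<open>\<tau> / (1 - s) = \<kappa> / 2\<close> to the sum of
    squares. \<open>N\<close> bounds the number of points above it for one restriction, and
    \<open>M\<close> is the number of steps after which one gain is at most
    \<open>(1 - s) * \<kappa> / 2\<close>.\<close>
  define \<tau> where "\<tau> = \<kappa> * (1 - s) / 2"
  have \<tau>: "\<tau> > 0" using assms by (simp add: \<tau>_def)
  define N where "N = nat \<lceil>1 / (\<tau> * (1 - s))\<rceil>"
  have N: "1 / (1 - s) \<le> \<tau> * real N"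
  proof -
    have "1 / (\<tau> * (1 - s)) \<le> real N" unfolding N_def by linarith
    then have "\<tau> * (1 / (\<tau> * (1 - s))) \<le> \<tau> * real N" using \<tau> by (intro mult_left_mono) auto
    then show ?thesis using \<tau> by simp
  qed
  define M where "M = Suc (nat \<lceil>2 / (\<kappa> * (1 - s))\<rceil>)"
  have "0 < M" by (simp add: M_def)
  have M: "1 / real M \<le> \<kappa> * (1 - s) / 2"
  proof -
    have "2 / (\<kappa> * (1 - s)) \<le> real M" unfolding M_def by linarith
    moreover note \<open>0 < M\<close>
    moreover have "0 < \<kappa> * (1 - s)" using assms by simp
    ultimately show ?thesis by (simp add: divide_le_eq le_divide_eq mult.commute)
  qed
  \<comment> \<open>A step adds at most \<open>N\<close> points for each of the \<open>2 ^ k\<close>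
    subsets of a \<open>J\<close> with \<open>k\<close> elements.\<close>
  define b where "b m = ((\<lambda>k. k + 2 ^ k * N) ^^ m) 0" for m
  have b_Suc: "b (Suc m) = b m + 2 ^ b m * N" for m by (simp add: b_def)
  have b_mono: "b m \<le> b n" if "m \<le> n" for m n
    using that by (rule lift_Suc_mono_le[rotated]) (simp add: b_Suc)
  have "\<exists>J\<subseteq>U. card J \<le> b M \<and> E J (\<lambda>w. \<Sum>i\<in>U - J. (infl s (U - J) (\<lambda>x. g (w \<union> x)) i)\<^sup>2) \<le> \<kappa>"
    if U: "finite U" and g: "\<And>x. x \<subseteq> U \<Longrightarrow> g x \<in> {0..1}" for U :: "'a set" and g
  proof -
    define I where "I J w i = infl s (U - J) (\<lambda>x. g (w \<union> x)) i" for J w i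
    define A where "A J = {i \<in> U - J. \<exists>w\<in>Pow J. I J w i > \<tau>}" for J
    define X where "X m = ((\<lambda>J. J \<union> A J) ^^ m) {}" for m
    have X_Suc: "X (Suc m) = X m \<union> A (X m)" for m by (simp add: X_def)
    have XU: "X m \<subseteq> U" for m
      by (induction m) (auto simp: X_Suc A_def, simp add: X_def)
    have restr: "g (w \<union> x) \<in> {0..1}" if "J \<subseteq> U" "w \<subseteq> J" "x \<subseteq> U - J" for J w x
      using that by (intro g) auto
    have I_nonneg: "0 \<le> I J w i" for J w i using s by (simp add: I_def infl_nonneg)
    have I_sum: "(\<Sum>i\<in>U - J. I J w i) \<le> 1 / (1 - s)" if "J \<subseteq> U" "w \<subseteq> J" for J w
      unfolding I_def using s U that by (intro sum_infl_le restr) auto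
    have I_le1: "I J w i \<le> 1" if "J \<subseteq> U" "w \<subseteq> J" for J w i
    proof -
      have "I J w i \<le> (\<Sum>S\<in>Pow (U - J). (coef (U - J) (\<lambda>x. g (w \<union> x)) S)\<^sup>2)"
        unfolding I_def infl_def using s
        by (intro sum_mono) (auto intro!: mult_left_le_one_le power_le_one)
      also have "\<dots> \<le> 1" using U that by (intro coef_sq_sum_le restr) auto
      finally show ?thesis .
    qed
    have card_A: "card (A J) \<le> 2 ^ card J * N" if J: "J \<subseteq> U" for J
    proof -
      have fJ: "finite J" "finite (U - J)" using J U finite_subset by auto
      have "card {i \<in> U - J. I J w i > \<tau>} \<le> N" if "w \<in> Pow J" for w
      proof -
        have "\<tau> * real (card {i \<in> U - J. I J w i > \<tau>}) = (\<Sum>i\<in>{i \<in> U - J. I J w i > \<tau>}. \<tau>)" by simp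
        also have "\<dots> \<le> (\<Sum>i\<in>{i \<in> U - J. I J w i > \<tau>}. I J w i)" by (intro sum_mono) auto
        also have "\<dots> \<le> (\<Sum>i\<in>U - J. I J w i)" using fJ I_nonneg by (intro sum_mono2) auto
        also have "\<dots> \<le> \<tau> * real N" using I_sum[OF J, of w] that N by simp
        finally show ?thesis using \<tau> by simp
      qed
      moreover have "A J = (\<Union>w\<in>Pow J. {i \<in> U - J. I J w i > \<tau>})" by (auto simp: A_def)
      ultimately have "card (A J) \<le> (\<Sum>w\<in>Pow J. N)"
        using fJ card_UN_le[of "Pow J" "\<lambda>w. {i \<in> U - J. I J w i > \<tau>}"]
          sum_mono[of "Pow J" "\<lambda>w. card {i \<in> U - J. I J w i > \<tau>}" "\<lambda>_. N"]
        by (metis (no_types, lifting) finite_Pow_iff order_trans)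
      then show ?thesis using fJ by (simp add: card_Pow)
    qed
    have card_X: "card (X m) \<le> b m" for m
    proof (induction m)
      case (Suc m)
      have "card (X (Suc m)) \<le> card (X m) + card (A (X m))" unfolding X_Suc by (rule card_Un_le)
      also have "\<dots> \<le> b m + 2 ^ b m * N"
        using Suc card_A[OF XU[of m]] by (intro add_mono order_trans[OF card_A[OF XU]] mult_right_mono power_increasing) auto
      finally show ?case by (simp add: b_Suc)
    qed (simp add: X_def b_def)
    \<comment> \<open>Pigeonhole: the gains telescope to at most 1. The set before the cheap step is
      the one that is kept.\<close>
    have "\<exists>m<M. potential s U g (X (Suc m)) - potential s U g (X m) \<le> 1 / real M"
    proof (rule ccontr)
      assume "\<not> ?thesis"
      then have "(\<Sum>m<M. 1 / real M) < (\<Sum>m<M. potential s U g (X (Suc m)) - potential s U g (X m))"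
        using \<open>0 < M\<close> by (intro sum_strict_mono) (auto simp: not_le)
      then have "1 < potential s U g (X M) - potential s U g (X 0)"
        using \<open>0 < M\<close> sum_lessThan_telescope[of "\<lambda>m. potential s U g (X m)" M] by simp
      moreover have "potential s U g Z \<in> {0..1}" for Z
        by (intro potential_bounds U g) (use s in auto)
      from this[of "X M"] this[of "X 0"] have "potential s U g (X M) - potential s U g (X 0) \<le> 1" by auto
      ultimately show False by linarith
    qed
    then obtain m where m: "m < M" "potential s U g (X (Suc m)) - potential s U g (X m) \<le> 1 / real M" by blast
    define J where "J = X m"
    have J: "J \<subseteq> U" "finite J" "finite (U - J)" using XU[of m] U finite_subset[OF XU[of m] U] by (auto simp: J_def)
    have AJ: "A J \<subseteq> U - J" by (auto simp: A_def)
    have "(1 - s) * E J (\<lambda>w. \<Sum>i\<in>A J. I J w i) \<le> potential s U g (J \<union> A J) - potential s U g J"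
      unfolding I_def using s by (intro potential_increment U J AJ) auto
    also have "\<dots> \<le> (1 - s) * (\<kappa> / 2)" using m(2) M by (simp add: J_def X_Suc mult.commute)
    finally have EA: "E J (\<lambda>w. \<Sum>i\<in>A J. I J w i) \<le> \<kappa> / 2"
      using s by simp
    have "E J (\<lambda>w. \<Sum>i\<in>U - J. (I J w i)\<^sup>2) \<le> E J (\<lambda>w. \<kappa> / 2 + (\<Sum>i\<in>A J. I J w i))"
    proof (rule E_mono)
      fix w assume w: "w \<subseteq> J"
      \<comment> \<open>On \<open>A J\<close> an influence, being at most 1, bounds its own square;
        elsewhere one factor of the square is at most \<open>\<tau>\<close>.\<close>
      have "(\<Sum>i\<in>U - J. (I J w i)\<^sup>2) \<le> (\<Sum>i\<in>U - J. \<tau> * I J w i + (if i \<in> A J then I J w i else 0))"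
      proof (rule sum_mono)
        fix i assume i: "i \<in> U - J"
        show "(I J w i)\<^sup>2 \<le> \<tau> * I J w i + (if i \<in> A J then I J w i else 0)"
        proof (cases "i \<in> A J")
          case True
          have "I J w i * I J w i \<le> 1 * I J w i" by (intro mult_right_mono I_le1 J w I_nonneg)
          moreover have "0 \<le> \<tau> * I J w i" using \<tau> I_nonneg by simp
          ultimately show ?thesis using True by (simp add: power2_eq_square)
        next
          case False
          then have "I J w i \<le> \<tau>" using i w by (auto simp: A_def not_less)
          then show ?thesis using False I_nonneg by (simp add: power2_eq_square mult_right_mono)
        qed
      qed
      also have "\<dots> = \<tau> * (\<Sum>i\<in>U - J. I J w i) + (\<Sum>i\<in>A J. I J w i)"
        using AJ J by (simp add: sum.distrib sum_distrib_left sum.If_cases Int_absorb1)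
      also have "\<tau> * (\<Sum>i\<in>U - J. I J w i) \<le> \<tau> * (1 / (1 - s))"
        using \<tau> by (intro mult_left_mono I_sum J w) auto
      also have "\<dots> = \<kappa> / 2" using s by (simp add: \<tau>_def field_simps)
      finally show "(\<Sum>i\<in>U - J. (I J w i)\<^sup>2) \<le> \<kappa> / 2 + (\<Sum>i\<in>A J. I J w i)" by simp
    qed
    also have "\<dots> \<le> \<kappa>" using EA by (simp add: E_add E_const[OF J(2)])
    finally have "E J (\<lambda>w. \<Sum>i\<in>U - J. (I J w i)\<^sup>2) \<le> \<kappa>" .
    moreover have "card J \<le> b M" using card_X[of m] b_mono[of m M] m(1) by (simp add: J_def)
    ultimately show ?thesis using J(1) by (auto simp: I_def)
  qed
  then show ?thesis using that by blast
qed

section \<open>The removal property of the cube\<close>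

lemma cube_edge_eq_pairexp: "cube_edge p n g = pairexp {1..n} (\<lambda>x y. g x * g y)"
proof -
  have "{(x, y). x \<subseteq> {1..n} \<and> y \<subseteq> {1..n} \<and> x \<inter> y = {}} = (SIGMA x:Pow {1..n}. Pow ({1..n} - x))"
    by auto
  then show ?thesis
    by (simp add: cube_edge_def pairexp_def mu_pair_def sum.Sigma mult_ac)
qed

text \<open>Every disjoint pair of subsets of \<open>J\<close> has at least this probability, so one
  disjoint pair of members of \<open>T\<close> already forces a definite edge density.\<close>

lemma pairexp_ge_term:
  assumes "finite J" "w \<subseteq> J" "w' \<subseteq> J" "w \<inter> w' = {}" "\<And>x y. x \<subseteq> J \<Longrightarrow> y \<subseteq> J \<Longrightarrow> 0 \<le> h x y"
  shows "min p (1 - 2 * p) ^ card J * h w w' \<le> pairexp J h"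
proof -
  let ?q = "min p (1 - 2 * p)"
  let ?W = "\<lambda>x y. p ^ card x * p ^ card y * (1 - 2 * p) ^ (card J - card x - card y)"
  have q: "0 < ?q" "?q \<le> p" "?q \<le> 1 - 2 * p" using p_pos p_less by auto
  have nn: "0 \<le> ?W x y * h x y" if "x \<subseteq> J" "y \<subseteq> J - x" for x y
    using that p_pos p_less assms(5)[of x y] by (intro mult_nonneg_nonneg) auto
  have "card (w \<union> w') \<le> card J" using assms by (intro card_mono) auto
  moreover have "card (w \<union> w') = card w + card w'"
    using assms finite_subset by (intro card_Un_disjoint) auto
  ultimately have "?q ^ card J = ?q ^ card w * ?q ^ card w' * ?q ^ (card J - card w - card w')"
    by (simp flip: power_add)
  also have "\<dots> \<le> ?W w w'"
    using q by (intro mult_mono power_mono) auto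
  finally have "?q ^ card J * h w w' \<le> ?W w w' * h w w'"
    using assms by (intro mult_right_mono) auto
  also have "\<dots> \<le> (\<Sum>y\<in>Pow (J - w). ?W w y * h w y)"
    by (rule member_le_sum[of w' "Pow (J - w)" "\<lambda>y. ?W w y * h w y"]) (use assms nn in auto)
  also have "\<dots> \<le> pairexp J h"
    unfolding pairexp_def
    by (rule member_le_sum[of w "Pow J" "\<lambda>w. \<Sum>y\<in>Pow (J - w). ?W w y * h w y"])
      (use assms nn in \<open>auto intro!: sum_nonneg\<close>)
  finally show ?thesis .
qed

lemma removal_one:
  assumes \<epsilon>: "\<epsilon> \<in> {0<..1}"
  obtains \<delta> j where "\<delta> \<in> {0<..1}"
    "\<And>n g. (\<And>x. x \<subseteq> {1..n} \<Longrightarrow> g x \<in> {0..1}) \<Longrightarrow> cube_edge p n g \<le> \<delta> \<Longrightarrow>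
      \<exists>J T. J \<subseteq> {1..n} \<and> card J \<le> j \<and> intersecting_family J T \<and>
        E J (\<lambda>w. indicator (Pow J - T) w * E ({1..n} - J) (\<lambda>x. g (w \<union> x))) \<le> \<epsilon>"
proof -
  obtain a :: nat where a: "a \<ge> 2" "real a * p \<le> (real a - 1) * (1 - p)"
  proof
    \<comment> \<open>The condition on \<open>a\<close> rearranges to
      \<open>1 - p \<le> a * (1 - 2 * p)\<close>, which has a solution because
      \<open>p < 1/2\<close>.\<close>
    let ?a = "nat \<lceil>(1 - p) / (1 - 2 * p)\<rceil> + 2"
    show "2 \<le> ?a" by simp
    have "(1 - p) / (1 - 2 * p) \<le> real ?a" by linarith
    then have "1 - p \<le> real ?a * (1 - 2 * p)" using p_less by (simp add: field_simps)
    then show "real ?a * p \<le> (real ?a - 1) * (1 - p)" by (simp add: algebra_simps)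
  qed
  \<comment> \<open>Members of \<open>T\<close> have mean above \<open>\<epsilon> / 2\<close>, so
    the main term for two of them is at least \<open>4 * \<eta>\<close>; two errors of at most
    \<open>\<eta>\<close> leave \<open>2 * \<eta>\<close>.\<close>
  define \<eta> where "\<eta> = (\<epsilon> / 2 * (\<epsilon> / 2)) ^ a / 4"
  have \<eta>: "0 < \<eta>" "\<eta> \<le> 1"
  proof -
    have "\<epsilon> / 2 * (\<epsilon> / 2) \<le> 1" using \<epsilon> by (intro mult_le_one) auto
    then have "(\<epsilon> / 2 * (\<epsilon> / 2)) ^ a \<le> 1" using \<epsilon> by (intro power_le_one) auto
    then show "0 < \<eta>" "\<eta> \<le> 1" using \<epsilon> by (auto simp: \<eta>_def)
  qed
  obtain s K where sK: "0 < s" "s < 1" "K \<ge> 0" and lower: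
    "\<And>(V :: nat set) f g. finite V \<Longrightarrow> (\<And>x. x \<subseteq> V \<Longrightarrow> f x \<in> {0..1}) \<Longrightarrow> (\<And>x. x \<subseteq> V \<Longrightarrow> g x \<in> {0..1}) \<Longrightarrow>
       (E V f * E V g) ^ a - \<eta> - K * ((\<Sum>i\<in>V. (infl s V f i)\<^sup>2) + (\<Sum>i\<in>V. (infl s V g i)\<^sup>2))
       \<le> pairexp V (\<lambda>x y. f x * g y)"
    using pairexp_lower_bound[OF \<eta>(1) a] by blast
  define \<kappa> where "\<kappa> = \<eta> / (2 * K + 1)"
  have \<kappa>: "0 < \<kappa>" "K * (\<kappa> + \<kappa>) \<le> \<eta>"
  proof -
    show pos: "0 < \<kappa>" using \<eta> sK by (auto simp: \<kappa>_def)
    have "\<kappa> * (2 * K + 1) = \<eta>" using sK by (simp add: \<kappa>_def)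
    then show "K * (\<kappa> + \<kappa>) \<le> \<eta>" using pos by (simp add: algebra_simps)
  qed
  \<comment> \<open>With this bound, Markov's inequality gives weight at most
    \<open>\<epsilon> / 2\<close> to the restrictions whose sum of squared influences exceeds
    \<open>\<kappa>\<close>.\<close>
  have "\<kappa> * \<epsilon> / 2 > 0" using \<kappa> \<epsilon> by simp
  from regularity[OF sK(1,2) this] obtain j where reg:
    "\<And>(U :: nat set) g. finite U \<Longrightarrow> (\<And>x. x \<subseteq> U \<Longrightarrow> g x \<in> {0..1}) \<Longrightarrow>
      \<exists>J\<subseteq>U. card J \<le> j \<and> E J (\<lambda>w. \<Sum>i\<in>U - J. (infl s (U - J) (\<lambda>x. g (w \<union> x)) i)\<^sup>2) \<le> \<kappa> * \<epsilon> / 2"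
    by metis
  let ?q = "min p (1 - 2 * p)"
  have q: "0 < ?q" "?q \<le> 1" using p_pos p_less by auto
  \<comment> \<open>Half of the edge density that a disjoint pair in \<open>T\<close> would force,
    so that the contradiction is strict.\<close>
  define \<delta> where "\<delta> = ?q ^ j * \<eta>"
  have \<delta>: "\<delta> \<in> {0<..1}"
  proof -
    have "0 < ?q ^ j" "?q ^ j \<le> 1" using q by (simp_all only: zero_less_power power_le_one less_imp_le)
    then show ?thesis using \<eta> by (auto simp: \<delta>_def intro!: mult_le_one)
  qed
  have "\<exists>J T. J \<subseteq> {1..n} \<and> card J \<le> j \<and> intersecting_family J T \<and>
        E J (\<lambda>w. indicator (Pow J - T) w * E ({1..n} - J) (\<lambda>x. g (w \<union> x))) \<le> \<epsilon>"
    if g: "\<And>x. x \<subseteq> {1..n} \<Longrightarrow> g x \<in> {0..1}" and edge: "cube_edge p n g \<le> \<delta>" for n :: nat and g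
  proof -
    obtain J where J: "J \<subseteq> {1..n}" "card J \<le> j" and
      EJ: "E J (\<lambda>w. \<Sum>i\<in>{1..n} - J. (infl s ({1..n} - J) (\<lambda>x. g (w \<union> x)) i)\<^sup>2) \<le> \<kappa> * \<epsilon> / 2"
      using reg[of "{1..n}" g] g by auto
    define V where "V = {1..n} - J"
    define gw where "gw w x = g (w \<union> x)" for w x
    define Y where "Y w = (\<Sum>i\<in>V. (infl s V (gw w) i)\<^sup>2)" for w
    have fin: "finite J" "finite V" "J \<inter> V = {}" "J \<union> V = {1..n}"
      using J finite_subset by (auto simp: V_def)
    have gw: "gw w x \<in> {0..1}" if "w \<subseteq> J" "x \<subseteq> V" for w x
      using that fin unfolding gw_def by (intro g) auto
    have Y: "0 \<le> Y w" for w by (auto simp: Y_def intro: sum_nonneg)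
    have EY: "E J Y \<le> \<kappa> * \<epsilon> / 2" using EJ by (simp add: Y_def[abs_def] V_def gw_def[abs_def])
    define T where "T = {w \<in> Pow J. E V (gw w) > \<epsilon> / 2 \<and> Y w \<le> \<kappa>}"
    \<comment> \<open>The case \<open>w = w'\<close> is allowed, so this also excludes the empty set
      from \<open>T\<close>.\<close>
    have "w \<inter> w' \<noteq> {}" if w: "w \<in> T" "w' \<in> T" for w w'
    proof
      assume dis: "w \<inter> w' = {}"
      have wJ: "w \<subseteq> J" "w' \<subseteq> J" using w by (auto simp: T_def)
      have "4 * \<eta> \<le> (E V (gw w) * E V (gw w')) ^ a"
      proof -
        have "\<epsilon> / 2 * (\<epsilon> / 2) \<le> E V (gw w) * E V (gw w')"
          using w \<epsilon> by (intro mult_mono) (auto simp: T_def)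
        then show ?thesis using \<epsilon> by (simp add: \<eta>_def power_mono)
      qed
      moreover have "K * (Y w + Y w') \<le> K * (\<kappa> + \<kappa>)"
        using w sK by (intro mult_left_mono add_mono) (auto simp: T_def)
      moreover have "(E V (gw w) * E V (gw w')) ^ a - \<eta> - K * (Y w + Y w') \<le> pairexp V (\<lambda>x y. gw w x * gw w' y)"
        unfolding Y_def by (intro lower fin gw wJ)
      ultimately have "2 * \<eta> \<le> pairexp V (\<lambda>x y. gw w x * gw w' y)" using \<kappa>(2) by linarith
      moreover have "?q ^ j \<le> ?q ^ card J" using q J by (intro power_decreasing) auto
      ultimately have "?q ^ j * (2 * \<eta>) \<le> ?q ^ card J * pairexp V (\<lambda>x y. gw w x * gw w' y)"
        using q \<eta> by (intro mult_mono) auto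
      also have "\<dots> \<le> pairexp J (\<lambda>w w'. pairexp V (\<lambda>x y. gw w x * gw w' y))"
      proof (rule pairexp_ge_term[OF fin(1) wJ dis])
        fix u u' assume u: "u \<subseteq> J" "u' \<subseteq> J"
        have "pairexp V (\<lambda>x y. 0) \<le> pairexp V (\<lambda>x y. gw u x * gw u' y)"
          using gw[OF u(1)] gw[OF u(2)] by (intro pairexp_mono) auto
        then show "0 \<le> pairexp V (\<lambda>x y. gw u x * gw u' y)" by (simp add: pairexp_def)
      qed
      also have "\<dots> = cube_edge p n g"
        using pairexp_union[OF fin(1-3), of "\<lambda>x y. g x * g y"] fin(4) by (simp add: cube_edge_eq_pairexp gw_def)
      finally have "2 * \<delta> \<le> cube_edge p n g" by (simp only: \<delta>_def mult_ac)
      then have "2 * \<delta> \<le> \<delta>" using edge by linarith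
      then show False using \<delta> by simp
    qed
    then have "intersecting_family J T" by (auto simp: intersecting_family_def T_def)
    \<comment> \<open>The first summand pays for the restrictions of small mean; the second is the
      pointwise form of Markov's inequality for those with large influences.\<close>
    moreover have "E J (\<lambda>w. indicator (Pow J - T) w * E V (gw w)) \<le> E J (\<lambda>w. \<epsilon> / 2 + Y w * (1 / \<kappa>))"
    proof (rule E_mono)
      fix w assume w: "w \<subseteq> J"
      have le1: "E V (gw w) \<le> 1"
        using E_mono[of V "gw w" "\<lambda>_. 1"] gw[OF w] by (simp add: E_const[OF fin(2)])
      show "indicator (Pow J - T) w * E V (gw w) \<le> \<epsilon> / 2 + Y w * (1 / \<kappa>)"
      proof (cases "Y w \<le> \<kappa>")
        case True
        then show ?thesis
          using w \<epsilon> Y[of w] \<kappa> by (cases "w \<in> T") (auto simp: T_def not_less intro: add_increasing2)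
      next
        case False
        then have "1 \<le> Y w * (1 / \<kappa>)" using \<kappa> by (simp add: field_simps)
        moreover have "indicator (Pow J - T) w * E V (gw w) \<le> 1"
          using le1 by (simp add: indicator_def)
        ultimately show ?thesis using \<epsilon> by simp
      qed
    qed
    moreover have "\<dots> \<le> \<epsilon>"
    proof -
      have "E J Y * (1 / \<kappa>) \<le> \<kappa> * \<epsilon> / 2 * (1 / \<kappa>)" using EY \<kappa> by (intro mult_right_mono) auto
      also have "\<dots> = \<epsilon> / 2" using \<kappa> by simp
      finally show ?thesis unfolding E_add E_multc E_const[OF fin(1)] by linarith
    qed
    ultimately show ?thesis using J unfolding V_def gw_def by (meson order_trans)
  qed
  then show ?thesis using that[OF \<delta>] by blast
qed

lemma removal_property_exists:
  "\<exists>\<delta> j. \<delta> ` {0<..1} \<subseteq> {0<..1} \<and> removal_property p \<delta> j"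
proof -
  let ?P = "\<lambda>\<epsilon> \<delta> j. \<delta> \<in> {0<..1::real} \<and> (\<forall>n g. (\<forall>x. x \<subseteq> {1..n} \<longrightarrow> g x \<in> {0..1}) \<longrightarrow> cube_edge p n g \<le> \<delta> \<longrightarrow>
      (\<exists>J T. J \<subseteq> {1..n} \<and> card J \<le> (j :: nat) \<and> intersecting_family J T \<and>
        E J (\<lambda>w. indicator (Pow J - T) w * E ({1..n} - J) (\<lambda>x. g (w \<union> x))) \<le> \<epsilon>))"
  have "\<forall>\<epsilon>\<in>{0<..1}. \<exists>\<delta> j. ?P \<epsilon> \<delta> j"
  proof
    fix \<epsilon> :: real assume "\<epsilon> \<in> {0<..1}"
    then show "\<exists>\<delta> j. ?P \<epsilon> \<delta> j" by (rule removal_one) blast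
  qed
  then obtain \<delta> where "\<forall>\<epsilon>\<in>{0<..1}. \<exists>j. ?P \<epsilon> (\<delta> \<epsilon>) j" by (rule bchoice[THEN exE])
  then obtain j where "\<forall>\<epsilon>\<in>{0<..1}. ?P \<epsilon> (\<delta> \<epsilon>) (j \<epsilon>)" by (rule bchoice[THEN exE])
  then have "\<delta> ` {0<..1} \<subseteq> {0<..1} \<and> removal_property p \<delta> j"
    unfolding removal_property_def by auto
  then show ?thesis by blast
qed

end

section \<open>The binomial distribution to the right of its mean\<close>

lemma Bernstein_recurrence:
  assumes "l < n"
  shows "Bernstein n (Suc l) x * real (Suc l) * (1 - x) = Bernstein n l x * real (n - l) * x"
proof -
  have "Suc l * (n choose Suc l) = (n - l) * (n choose l)"
    using binomial_absorb_comp[of n l] binomial_absorption[of l n] by simp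
  then have "real (Suc l) * real (n choose Suc l) = real (n - l) * real (n choose l)"
    by (metis of_nat_mult)
  moreover have "(1 - x) ^ (n - l) = (1 - x) ^ (n - Suc l) * (1 - x)"
    using assms by (metis Suc_diff_Suc power_Suc2)
  ultimately show ?thesis
    by (simp add: Bernstein_def mult_ac)
qed

lemma sum_Bernstein_variance:
  "(\<Sum>i\<le>n. (real i - real n * x)\<^sup>2 * Bernstein n i x) = real n * x * (1 - x)"
proof -
  have "(\<Sum>i\<le>n. (real i - real n * x)\<^sup>2 * Bernstein n i x)
     = (\<Sum>i\<le>n. real i * (real i - 1) * Bernstein n i x)
       + (1 - 2 * real n * x) * (\<Sum>i\<le>n. real i * Bernstein n i x)
       + (real n * x)\<^sup>2 * (\<Sum>i\<le>n. Bernstein n i x)"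
    unfolding sum_distrib_left sum.distrib[symmetric]
    by (intro sum.cong refl) (simp add: power2_eq_square algebra_simps)
  also have "\<dots> = real n * x * (1 - x)"
    unfolding sum_kk_Bernstein sum_k_Bernstein sum_Bernstein by (simp add: power2_eq_square algebra_simps)
  finally show ?thesis .
qed

text \<open>The ratios of consecutive terms at distance \<open>t\<close> above and below the mean \<open>k\<close> have product at
  least $1$, so the inequality propagates outwards from \<open>k\<close>.\<close>

lemma Bernstein_reflect_le:
  assumes x: "0 < x" "x < 1/2" and k: "real k = x * real n" and "i < k"
  shows "Bernstein n (k - Suc i) x \<le> Bernstein n (k + i) x"
  using assms(4)
proof (induction i)
  case 0
  then obtain l where l: "k = Suc l" by (cases k) auto
  have kn: "k \<le> n" using k x mult_right_mono[of x 1 "real n"] by simp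
  have "real (Suc l) * (1 - x) \<le> real (n - l) * x"
    using k kn x by (simp add: l of_nat_diff algebra_simps)
  then have "Bernstein n l x * (real (Suc l) * (1 - x)) \<le> Bernstein n l x * (real (n - l) * x)"
    using x by (intro mult_left_mono Bernstein_nonneg) auto
  also have "\<dots> = Bernstein n (Suc l) x * (real (Suc l) * (1 - x))"
    using Bernstein_recurrence[of l n x] kn l by (simp add: mult_ac)
  finally have "Bernstein n l x \<le> Bernstein n (Suc l) x"
    using x by simp
  then show ?case by (simp add: l)
next
  case (Suc i)
  have k2: "2 * real k < real n" using k x Suc.prems by (cases n) auto
  then have kn: "2 * k < n" by linarith
  define u where "u = k - Suc (Suc i)"
  have u: "k = u + Suc (Suc i)" using Suc.prems by (simp add: u_def)
  define b0 b1 b2 b3 where "b0 = Bernstein n u x" and "b1 = Bernstein n (Suc u) x"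
    and "b2 = Bernstein n (k + i) x" and "b3 = Bernstein n (Suc (k + i)) x"
  have b: "0 \<le> b0" "0 \<le> b1" "0 \<le> b2" "0 \<le> b3" using x by (simp_all add: b0_def b1_def b2_def b3_def Bernstein_nonneg)
  have IH: "b1 \<le> b2" using Suc by (simp add: b1_def b2_def u Suc_diff_le)
  define t N where "t = real i + 1" and "N = real n - real k"
  have uk: "real (Suc u) = real k - t" "real (n - u) = N + 1 + t" "real (Suc (k + i)) = real k + t" "real (n - (k + i)) = N + 1 - t"
    using kn by (simp_all add: u t_def N_def of_nat_diff)
  have "u < n" "k + i < n" using kn u by auto
  from Bernstein_recurrence[OF this(1), of x] Bernstein_recurrence[OF this(2), of x]
  have r1: "b1 * (real k - t) * (1 - x) = b0 * (N + 1 + t) * x"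
    and r2: "b3 * (real k + t) * (1 - x) = b2 * (N + 1 - t) * x"
    unfolding uk b0_def b1_def b2_def b3_def by simp_all
  have pos: "0 < real k - t" "0 < N + 1 - t" "0 < N + 1 + t" "0 < real k + t" "0 < t"
    using uk kn by (auto simp: u t_def N_def)
  have xN: "x * N = (1 - x) * real k" using k by (simp add: N_def algebra_simps)
  have kN: "real k \<le> N" using k2 by (simp add: N_def)
  \<comment> \<open>The product of the two ratios, cleared of denominators. By \<open>xN\<close> the
    leading terms agree up to the gain from \<open>N + 1\<close>, and the terms in
    \<open>t\<^sup>2\<close> compare correctly because \<open>x < 1/2\<close>.\<close>
  have key: "(real k - t) * (real k + t) * (1 - x)\<^sup>2 \<le> (N + 1 - t) * (N + 1 + t) * x\<^sup>2"
  proof -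
    have "(real k - t) * (real k + t) * (1 - x)\<^sup>2 = ((1 - x) * real k)\<^sup>2 - t\<^sup>2 * (1 - x)\<^sup>2"
      by (simp add: power2_eq_square algebra_simps)
    also have "\<dots> = (x * N)\<^sup>2 - t\<^sup>2 * (1 - x)\<^sup>2" by (simp add: xN)
    also have "\<dots> \<le> (x * (N + 1))\<^sup>2 - t\<^sup>2 * x\<^sup>2"
      using x kN by (intro diff_mono power_mono mult_left_mono) auto
    also have "\<dots> = (N + 1 - t) * (N + 1 + t) * x\<^sup>2"
      by (simp add: power2_eq_square algebra_simps)
    finally show ?thesis .
  qed
  define c where "c = (N + 1 + t) * x * (real k + t) * (1 - x)"
  have "b0 * c = (b0 * (N + 1 + t) * x) * (real k + t) * (1 - x)" by (simp add: c_def mult_ac)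
  also have "\<dots> = b1 * ((real k - t) * (real k + t) * (1 - x)\<^sup>2)"
    unfolding r1[symmetric] by (simp add: power2_eq_square mult_ac)
  also have "\<dots> \<le> b2 * ((N + 1 - t) * (N + 1 + t) * x\<^sup>2)"
    using b pos by (intro mult_mono[OF IH key]) auto
  also have "\<dots> = (b2 * (N + 1 - t) * x) * (N + 1 + t) * x" by (simp add: power2_eq_square mult_ac)
  also have "\<dots> = b3 * c" unfolding r2[symmetric] by (simp add: c_def mult_ac)
  finally have "b0 \<le> b3" using pos x by (simp add: c_def)
  then show ?case by (simp add: b0_def b3_def u_def)
qed

text \<open>The reflection of \<open>k - 1 - i\<close> to \<open>k + i\<close> maps the sizes below
  \<open>k\<close> injectively into the others without decreasing the probability. Since
  \<open>k\<close> itself belongs to the upper part, the bound 1/2 holds with no error term.\<close>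

lemma Bernstein_upper_half:
  assumes x: "0 < x" "x < 1/2" and k: "real k = x * real n"
  shows "1 / 2 \<le> (\<Sum>i\<in>{k..n}. Bernstein n i x)"
proof -
  have kn: "2 * k \<le> n" using k x mult_right_mono[of x "1/2" "real n"] by simp
  have "(\<Sum>i<k. Bernstein n i x) = (\<Sum>i<k. Bernstein n (k - Suc i) x)"
    by (rule sum.nat_diff_reindex[symmetric])
  also have "\<dots> \<le> (\<Sum>i<k. Bernstein n (k + i) x)"
    using assms by (intro sum_mono Bernstein_reflect_le) auto
  also have "\<dots> = (\<Sum>i\<in>(+) k ` {..<k}. Bernstein n i x)"
    by (simp add: sum.reindex)
  also have "\<dots> \<le> (\<Sum>i\<in>{k..n}. Bernstein n i x)"
    using x kn by (intro sum_mono2) (auto intro: Bernstein_nonneg)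
  finally have "(\<Sum>i<k. Bernstein n i x) \<le> (\<Sum>i\<in>{k..n}. Bernstein n i x)" .
  moreover have "(\<Sum>i<k. Bernstein n i x) + (\<Sum>i\<in>{k..n}. Bernstein n i x) = 1"
  proof -
    have "{..<k} \<union> {k..n} = {..n}" using kn by auto
    then show ?thesis
      by (subst sum.union_disjoint[symmetric]) auto
  qed
  ultimately show ?thesis by linarith
qed

text \<open>Chebyshev's inequality, with variance at most \<open>n\<close>, discards the sizes above
  \<open>k + m\<close>. Terms with \<open>k + i > n\<close> are 0, so the window may extend past
  \<open>n\<close>.\<close>

lemma Bernstein_window:
  assumes x: "0 < x" "x < 1/2" and k: "real k = x * real n"
  shows "1 / 2 - real n / (real m + 1)\<^sup>2 \<le> (\<Sum>i\<le>m. Bernstein n (k + i) x)"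
proof -
  have B: "0 \<le> Bernstein n i x" for i using x by (intro Bernstein_nonneg) auto
  have "(\<Sum>i\<in>{k + m<..n}. Bernstein n i x) \<le> (\<Sum>i\<in>{k + m<..n}. (real i - real n * x)\<^sup>2 * Bernstein n i x / (real m + 1)\<^sup>2)"
  proof (rule sum_mono)
    fix i assume "i \<in> {k + m<..n}"
    then have "real m + 1 \<le> real i - real n * x" using k by (simp add: mult.commute)
    then have "(real m + 1)\<^sup>2 \<le> (real i - real n * x)\<^sup>2" by (intro power_mono) auto
    then have "(real m + 1)\<^sup>2 * Bernstein n i x \<le> (real i - real n * x)\<^sup>2 * Bernstein n i x"
      by (intro mult_right_mono B)
    then show "Bernstein n i x \<le> (real i - real n * x)\<^sup>2 * Bernstein n i x / (real m + 1)\<^sup>2"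
      by (simp add: le_divide_eq mult.commute)
  qed
  also have "\<dots> \<le> (\<Sum>i\<le>n. (real i - real n * x)\<^sup>2 * Bernstein n i x / (real m + 1)\<^sup>2)"
    using B by (intro sum_mono2) auto
  also have "\<dots> = real n * x * (1 - x) / (real m + 1)\<^sup>2"
    by (simp add: sum_Bernstein_variance flip: sum_divide_distrib)
  also have "\<dots> \<le> real n / (real m + 1)\<^sup>2"
  proof (intro divide_right_mono)
    have "x * (1 - x) \<le> 1" using x by (intro mult_le_one) auto
    then have "real n * (x * (1 - x)) \<le> real n * 1" by (intro mult_left_mono) auto
    then show "real n * x * (1 - x) \<le> real n" by (simp add: mult.assoc)
  qed simp
  finally have tail: "(\<Sum>i\<in>{k + m<..n}. Bernstein n i x) \<le> real n / (real m + 1)\<^sup>2" .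
  have "(\<Sum>i\<in>{k..n}. Bernstein n i x) \<le> (\<Sum>i\<in>(+) k ` {..m} \<union> {k + m<..n}. Bernstein n i x)"
  proof (intro sum_mono2)
    show "{k..n} \<subseteq> (+) k ` {..m} \<union> {k + m<..n}"
    proof
      fix i assume "i \<in> {k..n}"
      then show "i \<in> (+) k ` {..m} \<union> {k + m<..n}"
        by (cases "i \<le> k + m") (auto intro!: image_eqI[of _ _ "i - k"])
    qed
  qed (use B in auto)
  also have "\<dots> = (\<Sum>i\<le>m. Bernstein n (k + i) x) + (\<Sum>i\<in>{k + m<..n}. Bernstein n i x)"
    by (subst sum.union_disjoint) (auto simp: sum.reindex)
  finally show ?thesis using tail Bernstein_upper_half[OF assms] by linarith
qed

text \<open>Union bound: deleting \<open>j\<close> points from an \<open>N\<close>-set destroys only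
  those subsets that contain a deleted point, and \<open>(N - 1) choose i\<close> subsets of size
  \<open>Suc i\<close> pass through each point.\<close>

lemma binomial_diff_lower:
  "N choose Suc i \<le> ((N - j) choose Suc i) + j * ((N - 1) choose i)"
proof (induction j)
  case (Suc j)
  show ?case
  proof (cases "N - j")
    case 0
    then show ?thesis using Suc by simp
  next
    case (Suc M)
    then have "(N - j) choose Suc i = (M choose i) + (M choose Suc i)" "N - Suc j = M" by auto
    moreover have "M choose i \<le> (N - 1) choose i" using Suc by (intro binomial_right_mono) auto
    ultimately show ?thesis using Suc.IH by simp
  qed
qed simp

text \<open>In probabilistic terms, a random \<open>i\<close>-subset of \<open>N\<close> points
  misses \<open>j\<close> given points with probability at least
  \<open>1 - j * i / N\<close>.\<close>

lemma binomial_ratio_lower: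
  assumes "N - j \<le> r" "0 < N"
  shows "(1 - real j * real i / real N) * real (N choose i) \<le> real (r choose i)"
proof (cases i)
  case (Suc l)
  have "real (N choose i) \<le> real ((N - j) choose i) + real j * real ((N - 1) choose l)"
    using binomial_diff_lower[of N l j] unfolding Suc by (metis of_nat_add of_nat_le_iff of_nat_mult)
  moreover have "real ((N - j) choose i) \<le> real (r choose i)"
    using assms by (simp add: binomial_right_mono)
  moreover have "real ((N - 1) choose l) = real i * real (N choose i) / real N"
  proof -
    have "i * (N choose i) = N * ((N - 1) choose l)" unfolding Suc by (rule binomial_absorption)
    then have "real i * real (N choose i) = real N * real ((N - 1) choose l)" by (metis of_nat_mult)
    then show ?thesis using assms by simp
  qed
  ultimately show ?thesis by (simp add: algebra_simps)
qed simp

section \<open>Transfer to the slice\<close>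

lemma sum_Pow_card:
  fixes h :: "nat \<Rightarrow> real"
  assumes "finite R"
  shows "(\<Sum>X\<in>Pow R. h (card X)) = (\<Sum>i\<le>card R. real (card R choose i) * h i)"
proof -
  have "(\<Sum>X\<in>Pow R. h (card X)) = (\<Sum>i\<le>card R. \<Sum>X\<in>{X \<in> Pow R. card X = i}. h (card X))"
    using assms by (intro sum.group[symmetric]) (auto intro: card_mono)
  also have "\<dots> = (\<Sum>i\<le>card R. real (card R choose i) * h i)"
    using assms by (intro sum.cong refl) (simp add: n_subsets)
  finally show ?thesis .
qed

text \<open>A superset \<open>x\<close> of \<open>y\<close> is uniquely \<open>y \<union> X\<close>
  with \<open>X\<close> disjoint from \<open>y\<close>.\<close>

lemma sum_Pow_nsets_swap:
  fixes h :: "'a set \<Rightarrow> 'a set \<Rightarrow> real"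
  assumes "finite U"
  shows "(\<Sum>x\<in>Pow U. \<Sum>y\<in>nsets x k. h x y) = (\<Sum>y\<in>nsets U k. \<Sum>X\<in>Pow (U - y). h (y \<union> X) y)"
proof -
  have fin: "finite (nsets x k)" if "x \<in> Pow U" for x
    using that assms finite_subset by (auto intro: finite_imp_finite_nsets)
  have "(\<Sum>x\<in>Pow U. \<Sum>y\<in>nsets x k. h x y) = (\<Sum>(x, y)\<in>Sigma (Pow U) (\<lambda>x. nsets x k). h x y)"
    using assms fin by (intro sum.Sigma) auto
  also have "\<dots> = (\<Sum>(y, X)\<in>Sigma (nsets U k) (\<lambda>y. Pow (U - y)). h (y \<union> X) y)"
    by (rule sum.reindex_bij_witness[where i = "\<lambda>(y, X). (y \<union> X, y)" and j = "\<lambda>(x, y). (y, x - y)"])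
      (auto simp: nsets_def Un_absorb1)
  also have "\<dots> = (\<Sum>y\<in>nsets U k. \<Sum>X\<in>Pow (U - y). h (y \<union> X) y)"
    using assms by (intro sum.Sigma[symmetric]) (auto intro: finite_imp_finite_nsets)
  finally show ?thesis .
qed

lemma sum_Pow_nsets_diff_swap:
  fixes h :: "'a set \<Rightarrow> 'a set \<Rightarrow> real"
  assumes "finite V"
  shows "(\<Sum>X\<in>Pow V. \<Sum>y\<in>nsets (V - X) k. h X y) = (\<Sum>y\<in>nsets V k. \<Sum>X\<in>Pow (V - y). h X y)"
proof -
  have "(\<Sum>X\<in>Pow V. \<Sum>y\<in>nsets (V - X) k. h X y) = (\<Sum>(X, y)\<in>Sigma (Pow V) (\<lambda>X. nsets (V - X) k). h X y)"
    using assms by (intro sum.Sigma) (auto intro: finite_imp_finite_nsets)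
  also have "\<dots> = (\<Sum>(y, X)\<in>Sigma (nsets V k) (\<lambda>y. Pow (V - y)). h X y)"
    by (rule sum.reindex_bij_witness[where i = "\<lambda>(y, X). (X, y)" and j = "\<lambda>(x, y). (y, x)"])
      (auto simp: nsets_def)
  also have "\<dots> = (\<Sum>y\<in>nsets V k. \<Sum>X\<in>Pow (V - y). h X y)"
    using assms by (intro sum.Sigma[symmetric]) (auto intro: finite_imp_finite_nsets)
  finally show ?thesis .
qed

text \<open>Division by zero makes this $0$ for sets with fewer than \<open>k\<close> elements.\<close>

definition slice_average :: "nat \<Rightarrow> ('a set \<Rightarrow> real) \<Rightarrow> 'a set \<Rightarrow> real" where
  "slice_average k f z = (\<Sum>y\<in>nsets z k. f y) / real (card z choose k)"

lemma slice_average_bounds: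
  assumes "\<And>y. y \<in> nsets z k \<Longrightarrow> f y \<in> {0..1}"
  shows "slice_average k f z \<in> {0..1}"
proof -
  have "(\<Sum>y\<in>nsets z k. f y) \<le> (\<Sum>y\<in>nsets z k. 1)"
    using assms by (intro sum_mono) auto
  moreover have "0 \<le> (\<Sum>y\<in>nsets z k. f y)" using assms by (intro sum_nonneg) auto
  ultimately show ?thesis by (simp add: slice_average_def divide_le_eq)
qed

context biased_cube
begin

text \<open>The weight that a disjoint pair \<open>(y, y')\<close> of \<open>k\<close>-sets receives from its supersets does not
  depend on the pair.\<close>

lemma pairexp_slice:
  obtains W where "\<And>(U :: 'a set) \<phi>. finite U \<Longrightarrow> card U = n \<Longrightarrow>
    pairexp U (\<lambda>x x'. (\<Sum>y\<in>nsets x k. \<Sum>y'\<in>nsets x' k. \<phi> y y') / (real (card x choose k) * real (card x' choose k)))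
      = W * (\<Sum>y\<in>nsets U k. \<Sum>y'\<in>nsets (U - y) k. \<phi> y y')"
proof -
  define w where "w a b = p ^ a * p ^ b * (1 - 2 * p) ^ (n - a - b) / (real (a choose k) * real (b choose k))" for a b
  define r where "r = n - k - k"
  \<comment> \<open>\<open>i\<close> and \<open>l\<close> are the numbers of points added to
    \<open>y\<close> and to \<open>y'\<close>, drawn disjointly from the \<open>r\<close> points
    outside both.\<close>
  define W where "W = (\<Sum>i\<le>r. real (r choose i) * (\<Sum>l\<le>r - i. real ((r - i) choose l) * w (k + i) (k + l)))"
  have "pairexp U (\<lambda>x x'. (\<Sum>y\<in>nsets x k. \<Sum>y'\<in>nsets x' k. \<phi> y y') / (real (card x choose k) * real (card x' choose k)))
      = W * (\<Sum>y\<in>nsets U k. \<Sum>y'\<in>nsets (U - y) k. \<phi> y y')"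
    if U: "finite U" "card U = n" for U :: "'a set" and \<phi>
  proof -
    have fin: "finite X" if "X \<subseteq> U" for X using that U finite_subset by auto
    have "pairexp U (\<lambda>x x'. (\<Sum>y\<in>nsets x k. \<Sum>y'\<in>nsets x' k. \<phi> y y') / (real (card x choose k) * real (card x' choose k)))
      = (\<Sum>x\<in>Pow U. \<Sum>x'\<in>Pow (U - x). \<Sum>y\<in>nsets x k. \<Sum>y'\<in>nsets x' k. w (card x) (card x') * \<phi> y y')"
      unfolding pairexp_def w_def U(2)
      by (intro sum.cong refl) (simp add: sum_distrib_left sum_divide_distrib mult_ac)
    also have "\<dots> = (\<Sum>x\<in>Pow U. \<Sum>y\<in>nsets x k. \<Sum>x'\<in>Pow (U - x). \<Sum>y'\<in>nsets x' k. w (card x) (card x') * \<phi> y y')"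
      by (intro sum.cong refl sum.swap)
    also have "\<dots> = (\<Sum>y\<in>nsets U k. \<Sum>X\<in>Pow (U - y). \<Sum>x'\<in>Pow (U - (y \<union> X)). \<Sum>y'\<in>nsets x' k.
        w (card (y \<union> X)) (card x') * \<phi> y y')"
      by (rule sum_Pow_nsets_swap[OF U(1)])
    also have "\<dots> = (\<Sum>y\<in>nsets U k. \<Sum>X\<in>Pow (U - y). \<Sum>y'\<in>nsets (U - y - X) k. \<Sum>X'\<in>Pow (U - y - X - y').
        w (card (y \<union> X)) (card (y' \<union> X')) * \<phi> y y')"
    proof -
      have diff: "U - (y \<union> X) = U - y - X" for y X by auto
      show ?thesis unfolding diff using U(1) by (intro sum.cong refl sum_Pow_nsets_swap) auto
    qed
    also have "\<dots> = (\<Sum>y\<in>nsets U k. \<Sum>y'\<in>nsets (U - y) k. \<Sum>X\<in>Pow (U - y - y'). \<Sum>X'\<in>Pow (U - y - X - y').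
        w (card (y \<union> X)) (card (y' \<union> X')) * \<phi> y y')"
      using U(1) by (intro sum.cong refl sum_Pow_nsets_diff_swap) auto
    also have "\<dots> = (\<Sum>y\<in>nsets U k. \<Sum>y'\<in>nsets (U - y) k. W * \<phi> y y')"
    proof (intro sum.cong refl)
      fix y y' assume y: "y \<in> nsets U k" and y': "y' \<in> nsets (U - y) k"
      define R where "R = U - y - y'"
      have R: "finite R" "card R = r"
        using y y' U by (auto simp: R_def r_def nsets_def card_Diff_subset)
      have "(\<Sum>X\<in>Pow R. \<Sum>X'\<in>Pow (U - y - X - y'). w (card (y \<union> X)) (card (y' \<union> X')) * \<phi> y y')
          = (\<Sum>X\<in>Pow R. (\<Sum>l\<le>r - card X. real ((r - card X) choose l) * w (k + card X) (k + l)) * \<phi> y y')"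
      proof (intro sum.cong refl)
        fix X assume X: "X \<in> Pow R"
        have fX: "finite X" using X R finite_subset by auto
        have cR: "U - y - X - y' = R - X" "finite (R - X)" "card (R - X) = r - card X"
          using X R fX by (auto simp: R_def card_Diff_subset)
        have c1: "card (y \<union> X) = k + card X"
          using y X fX by (subst card_Un_disjoint) (auto simp: nsets_def R_def)
        have c2: "card (y' \<union> X') = k + card X'" if "X' \<in> Pow (R - X)" for X'
          using y' that cR(2) finite_subset by (subst card_Un_disjoint) (auto simp: nsets_def R_def)
        have "(\<Sum>X'\<in>Pow (R - X). w (card (y \<union> X)) (card (y' \<union> X')) * \<phi> y y')
          = (\<Sum>X'\<in>Pow (R - X). w (k + card X) (k + card X')) * \<phi> y y'"
          unfolding sum_distrib_right by (intro sum.cong refl) (simp only: c1 c2)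
        then show "(\<Sum>X'\<in>Pow (U - y - X - y'). w (card (y \<union> X)) (card (y' \<union> X')) * \<phi> y y')
          = (\<Sum>l\<le>r - card X. real ((r - card X) choose l) * w (k + card X) (k + l)) * \<phi> y y'"
          unfolding cR(1) using sum_Pow_card[OF cR(2), of "\<lambda>l. w (k + card X) (k + l)"] by (simp add: cR(3))
      qed
      also have "\<dots> = W * \<phi> y y'"
        unfolding sum_distrib_right[symmetric] W_def
        using sum_Pow_card[OF R(1), of "\<lambda>i. \<Sum>l\<le>r - i. real ((r - i) choose l) * w (k + i) (k + l)"] by (simp add: R(2))
      finally show "(\<Sum>X\<in>Pow (U - y - y'). \<Sum>X'\<in>Pow (U - y - X - y'). w (card (y \<union> X)) (card (y' \<union> X')) * \<phi> y y')
        = W * \<phi> y y'" unfolding R_def .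
    qed
    also have "\<dots> = W * (\<Sum>y\<in>nsets U k. \<Sum>y'\<in>nsets (U - y) k. \<phi> y y')"
      by (simp add: sum_distrib_left)
    finally show ?thesis .
  qed
  then show ?thesis using that by blast
qed

text \<open>The weight \<open>W\<close> is bounded without being computed: testing
  \<open>pairexp_slice\<close> on the constant 1 identifies \<open>W * ?N\<close> as the probability
  that both sets of a random disjoint pair have at least \<open>k\<close> elements.\<close>

lemma cube_edge_slice_average_le:
  assumes f: "\<And>y. y \<in> nsets {1..n} k \<Longrightarrow> 0 \<le> f y" and k: "2 * k \<le> n"
  shows "cube_edge p n (slice_average k f) \<le> kneser_edge n k f"
proof -
  let ?U = "{1..n}"
  let ?D = "\<lambda>\<phi>. \<Sum>y\<in>nsets ?U k. \<Sum>y'\<in>nsets (?U - y) k. \<phi> y y' :: real"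
  let ?A = "\<lambda>\<phi> x x'. (\<Sum>y\<in>nsets x k. \<Sum>y'\<in>nsets x' k. \<phi> y y' :: real) / (real (card x choose k) * real (card x' choose k))"
  let ?N = "real (n choose k) * real ((n - k) choose k)"
  obtain W where W: "\<And>(U :: nat set) \<phi>. finite U \<Longrightarrow> card U = n \<Longrightarrow>
    pairexp U (\<lambda>x x'. (\<Sum>y\<in>nsets x k. \<Sum>y'\<in>nsets x' k. \<phi> y y') / (real (card x choose k) * real (card x' choose k)))
      = W * (\<Sum>y\<in>nsets U k. \<Sum>y'\<in>nsets (U - y) k. \<phi> y y')"
    using pairexp_slice[of n k] by blast
  have W': "pairexp ?U (?A \<phi>) = W * ?D \<phi>" for \<phi> by (rule W) auto
  have "(\<Sum>y'\<in>nsets (?U - y) k. 1) = real ((n - k) choose k)" if "y \<in> nsets ?U k" for y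
  proof -
    have "card (?U - y) = n - k" using that by (simp add: nsets_def card_Diff_subset)
    then show ?thesis by simp
  qed
  then have D1: "?D (\<lambda>_ _. 1) = ?N" by simp
  have "W * ?N \<le> 1"
  proof -
    have "W * ?N = pairexp ?U (?A (\<lambda>_ _. 1))" by (simp only: W' D1)
    also have "\<dots> \<le> pairexp ?U (\<lambda>x x'. 1)" by (intro pairexp_mono) simp
    also have "\<dots> = 1" using pairexp_fst[of ?U "\<lambda>_. 1"] by (simp add: E_const)
    finally show ?thesis .
  qed
  moreover have N: "0 < ?N" using k by simp
  ultimately have "W \<le> 1 / ?N" by (simp add: pos_le_divide_eq)
  moreover have "0 \<le> ?D (\<lambda>y y'. f y * f y')"
    using f by (intro sum_nonneg mult_nonneg_nonneg) (auto simp: nsets_def)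
  ultimately have "W * ?D (\<lambda>y y'. f y * f y') \<le> 1 / ?N * ?D (\<lambda>y y'. f y * f y')"
    by (rule mult_right_mono)
  moreover have "cube_edge p n (slice_average k f) = W * ?D (\<lambda>y y'. f y * f y')"
    unfolding W'[symmetric] cube_edge_eq_pairexp slice_average_def
    by (simp add: sum_product)
  moreover have "kneser_edge n k f = 1 / ?N * ?D (\<lambda>y y'. f y * f y')"
  proof -
    have "{(x, y). x \<in> nsets ?U k \<and> y \<in> nsets ?U k \<and> x \<inter> y = {}} = (SIGMA x:nsets ?U k. nsets (?U - x) k)"
      by (auto simp: nsets_def)
    moreover have "(\<Sum>(x, y)\<in>(SIGMA x:nsets ?U k. nsets (?U - x) k). f x * f y / ?N)
        = ?D (\<lambda>y y'. f y * f y' / ?N)"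
      by (intro sum.Sigma[symmetric]) (auto intro: finite_imp_finite_nsets)
    ultimately show ?thesis
      by (simp add: kneser_edge_def sum_divide_distrib)
  qed
  ultimately show ?thesis by simp
qed

text \<open>Only supersets \<open>y \<union> X\<close> with \<open>X\<close> disjoint from
  \<open>J\<close> are kept, since they have the same trace on \<open>J\<close> as \<open>y\<close>.
  Each \<open>y\<close> then receives at least the weight \<open>c\<close>: a lower bound for the
  chance that \<open>X\<close> misses \<open>J\<close>, times the probability of a size in the
  window, divided among all \<open>k\<close>-sets.\<close>

lemma slice_mass_le:
  assumes U: "finite U" "card U = n" and J: "J \<subseteq> U" "card J \<le> j"
    and f: "\<And>y. y \<in> nsets U k \<Longrightarrow> 0 \<le> f y" and kn: "k < n"
  shows "(1 - real j * real m / real (n - k)) * (\<Sum>i\<le>m. Bernstein n (k + i) p)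
      * ((\<Sum>y\<in>{y \<in> nsets U k. y \<inter> J \<notin> T}. f y) / real (n choose k))
    \<le> E U (\<lambda>z. indicator {z. z \<inter> J \<notin> T} z * slice_average k f z)"
proof -
  define N where "N = n - k"
  define c where "c = (1 - real j * real m / real N) * (\<Sum>i\<le>m. Bernstein n (k + i) p) / real (n choose k)"
  define v where "v i = p ^ (k + i) * (1 - p) ^ (n - (k + i)) / real ((k + i) choose k)" for i
  have v: "0 \<le> v i" for i using p_pos p_less by (simp add: v_def)
  have fin: "finite X" if "X \<subseteq> U" for X using that U finite_subset by auto
  have finn: "finite (nsets U k)" using U by (simp add: finite_imp_finite_nsets)
  have weight: "mu p U (y \<union> X) / real (card (y \<union> X) choose k) = v (card X)"
    if "y \<in> nsets U k" "X \<in> Pow (U - y)" for y X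
  proof -
    have "card (y \<union> X) = k + card X"
      using that fin[of X] by (subst card_Un_disjoint) (auto simp: nsets_def)
    then show ?thesis by (simp add: mu_def v_def U)
  qed
  have lower: "c \<le> (\<Sum>X\<in>Pow (U - y - J). v (card X))" if y: "y \<in> nsets U k" for y
  proof -
    define r where "r = card (U - y - J)"
    have "card (U - y) = N" using y U by (simp add: nsets_def card_Diff_subset N_def)
    then have r: "N - j \<le> r"
      using diff_card_le_card_Diff[of J "U - y"] J fin[of J] by (simp add: r_def)
    have summand: "(1 - real j * real m / real N) * (Bernstein n (k + i) p / real (n choose k)) \<le> real (r choose i) * v i"
      if "i \<le> m" for i
    proof -
      \<comment> \<open>Both sides count the pairs of a \<open>(k + i)\<close>-set and a
        \<open>k\<close>-subset of it. So the binomial weight of size \<open>k + i\<close>, shared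
        equally among the \<open>k\<close>-sets, is \<open>v i\<close> for each of the
        \<open>N choose i\<close> extensions.\<close>
      have "(n choose (k + i)) * ((k + i) choose k) = (n choose k) * (N choose i)"
      proof (cases "k + i \<le> n")
        case True
        then show ?thesis using choose_mult[of k "k + i" n] by (simp add: N_def)
      next
        case False
        then show ?thesis using kn by (simp add: N_def binomial_eq_0)
      qed
      then have "real (n choose (k + i)) * real ((k + i) choose k) = real (n choose k) * real (N choose i)"
        by (metis of_nat_mult)
      then have eq: "Bernstein n (k + i) p / real (n choose k) = real (N choose i) * v i"
        using kn by (simp add: Bernstein_def v_def field_simps)
      have "real j * real i / real N \<le> real j * real m / real N"
        using that by (intro divide_right_mono mult_left_mono) auto
      then have "(1 - real j * real m / real N) * real (N choose i) \<le> (1 - real j * real i / real N) * real (N choose i)"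
        by (intro mult_right_mono) auto
      also have "\<dots> \<le> real (r choose i)"
        using r kn by (intro binomial_ratio_lower) (auto simp: N_def)
      finally show ?thesis
        unfolding eq mult.assoc[symmetric] using v by (intro mult_right_mono) auto
    qed
    have "c = (\<Sum>i\<le>m. (1 - real j * real m / real N) * (Bernstein n (k + i) p / real (n choose k)))"
      by (simp add: c_def sum_distrib_left sum_divide_distrib)
    also have "\<dots> \<le> (\<Sum>i\<le>m. real (r choose i) * v i)" by (intro sum_mono summand) auto
    \<comment> \<open>Either of \<open>m\<close> and \<open>r\<close> may be the larger; the
      binomial coefficients beyond \<open>r\<close> vanish.\<close>
    also have "\<dots> \<le> (\<Sum>i\<le>max m r. real (r choose i) * v i)"
      using v by (intro sum_mono2) auto
    also have "\<dots> = (\<Sum>i\<le>r. real (r choose i) * v i)"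
      by (intro sum.mono_neutral_right) auto
    also have "\<dots> = (\<Sum>X\<in>Pow (U - y - J). v (card X))"
      unfolding r_def using U by (intro sum_Pow_card[symmetric]) auto
    finally show ?thesis .
  qed
  have "c * (\<Sum>y\<in>{y \<in> nsets U k. y \<inter> J \<notin> T}. f y)
      = (\<Sum>y\<in>nsets U k. if y \<inter> J \<notin> T then c * f y else 0)"
    unfolding sum_distrib_left using finn by (simp add: sum.inter_filter)
  also have "\<dots> \<le> (\<Sum>y\<in>nsets U k. \<Sum>X\<in>Pow (U - y). indicator {z. z \<inter> J \<notin> T} (y \<union> X) * (v (card X) * f y))"
  proof (rule sum_mono)
    fix y assume y: "y \<in> nsets U k"
    have nn: "0 \<le> indicator {z. z \<inter> J \<notin> T} (y \<union> X) * (v (card X) * f y)" for X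
      using v f[OF y] by simp
    show "(if y \<inter> J \<notin> T then c * f y else 0)
       \<le> (\<Sum>X\<in>Pow (U - y). indicator {z. z \<inter> J \<notin> T} (y \<union> X) * (v (card X) * f y))"
    proof (cases "y \<inter> J \<in> T")
      case True
      then show ?thesis using nn by (simp add: sum_nonneg)
    next
      case False
      have "c * f y \<le> (\<Sum>X\<in>Pow (U - y - J). v (card X)) * f y"
        by (intro mult_right_mono lower f y)
      also have "\<dots> = (\<Sum>X\<in>Pow (U - y - J). indicator {z. z \<inter> J \<notin> T} (y \<union> X) * (v (card X) * f y))"
        unfolding sum_distrib_right
      proof (intro sum.cong refl)
        fix X assume "X \<in> Pow (U - y - J)"
        then have "(y \<union> X) \<inter> J = y \<inter> J" by auto
        then show "v (card X) * f y = indicator {z. z \<inter> J \<notin> T} (y \<union> X) * (v (card X) * f y)"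
          using False by (simp add: indicator_def)
      qed
      also have "\<dots> \<le> (\<Sum>X\<in>Pow (U - y). indicator {z. z \<inter> J \<notin> T} (y \<union> X) * (v (card X) * f y))"
        using U nn by (intro sum_mono2) auto
      finally show ?thesis using False by simp
    qed
  qed
  also have "\<dots> = (\<Sum>y\<in>nsets U k. \<Sum>X\<in>Pow (U - y). indicator {z. z \<inter> J \<notin> T} (y \<union> X)
      * (mu p U (y \<union> X) / real (card (y \<union> X) choose k) * f y))"
    by (intro sum.cong refl) (simp only: weight)
  also have "\<dots> = (\<Sum>z\<in>Pow U. \<Sum>y\<in>nsets z k. indicator {z. z \<inter> J \<notin> T} z * (mu p U z / real (card z choose k) * f y))"
    by (rule sum_Pow_nsets_swap[OF U(1), symmetric])
  also have "\<dots> = E U (\<lambda>z. indicator {z. z \<inter> J \<notin> T} z * slice_average k f z)"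
    unfolding cube_expectation_def slice_average_def
    by (intro sum.cong refl) (simp add: sum_distrib_left sum_divide_distrib mult_ac)
  finally show ?thesis by (simp add: c_def N_def)
qed

lemma kneser_removal:
  assumes rem: "removal_property p \<delta> j" and \<epsilon>: "\<epsilon> \<in> {0<..1}"
  shows "\<exists>n0. \<forall>n\<ge>n0. \<forall>k. real k = p * real n \<and> k \<ge> 1 \<longrightarrow>
      (\<forall>f. (\<forall>x\<in>nsets {1..n} k. f x \<in> {0..1}) \<longrightarrow> kneser_edge n k f \<le> \<delta> \<epsilon> \<longrightarrow>
        (\<exists>J T. J \<subseteq> {1..n} \<and> card J \<le> j \<epsilon> \<and> intersecting_family J T \<and>
          (\<Sum>x\<in>{x \<in> nsets {1..n} k. x \<inter> J \<notin> T}. f x) / real (n choose k) \<le> 5 * \<epsilon>))"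
proof -
  \<comment> \<open>The window of sizes has width about \<open>\<gamma> * n\<close>. As
    \<open>k < n / 2\<close>, this choice makes the chance that the added points meet
    \<open>J\<close> at most 1/4.\<close>
  define \<gamma> where "\<gamma> = 1 / (8 * (real (j \<epsilon>) + 1))"
  have \<gamma>: "0 < \<gamma>" "8 * real (j \<epsilon>) * \<gamma> \<le> 1" by (auto simp: \<gamma>_def divide_simps)
  \<comment> \<open>Large enough for \<open>\<gamma>\<^sup>2 * n \<ge> 10\<close>, so that the
    Chebyshev tail costs at most 1/10 of the upper half and 2/5 remains; \<open>Suc\<close> makes
    \<open>n\<close> positive. The bound depends on \<open>j \<epsilon>\<close> only.\<close>
  define n0 where "n0 = Suc (nat \<lceil>10 / \<gamma>\<^sup>2\<rceil>)"
  have "\<exists>J T. J \<subseteq> {1..n} \<and> card J \<le> j \<epsilon> \<and> intersecting_family J T \<and>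
      (\<Sum>x\<in>{x \<in> nsets {1..n} k. x \<inter> J \<notin> T}. f x) / real (n choose k) \<le> 5 * \<epsilon>"
    if n: "n \<ge> n0" and k: "real k = p * real n" "k \<ge> 1"
      and f: "\<forall>x\<in>nsets {1..n} k. f x \<in> {0..1}" and edge: "kneser_edge n k f \<le> \<delta> \<epsilon>" for n k f
  proof -
    let ?U = "{1..n}"
    have n1: "n \<ge> 1" using n by (simp add: n0_def)
    have "2 * real k < real n" using k p_less n1 by simp
    then have kn: "2 * k < n" by linarith
    have n_large: "10 \<le> \<gamma>\<^sup>2 * real n"
    proof -
      have "10 / \<gamma>\<^sup>2 \<le> real n" using n unfolding n0_def by linarith
      then show ?thesis using \<gamma> by (simp add: field_simps)
    qed
    define m where "m = nat \<lfloor>\<gamma> * real n\<rfloor>"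
    have "0 \<le> \<gamma> * real n" using \<gamma> by simp
    then have m: "real m \<le> \<gamma> * real n" "\<gamma> * real n \<le> real m + 1"
      unfolding m_def by linarith+
    have win: "2 / 5 \<le> (\<Sum>i\<le>m. Bernstein n (k + i) p)"
    proof -
      have "(\<gamma> * real n)\<^sup>2 \<le> (real m + 1)\<^sup>2" using m \<gamma> by (intro power_mono) auto
      then have "\<gamma>\<^sup>2 * real n * real n \<le> (real m + 1)\<^sup>2" by (simp add: power2_eq_square mult_ac)
      moreover have "10 * real n \<le> \<gamma>\<^sup>2 * real n * real n" using n_large by (intro mult_right_mono) auto
      ultimately have "10 * real n \<le> (real m + 1)\<^sup>2" by linarith
      then have "real n / (real m + 1)\<^sup>2 \<le> 1 / 10" by (simp add: divide_le_eq)
      then show ?thesis using Bernstein_window[OF p_pos p_less k(1), of m] by linarith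
    qed
    have hit: "3 / 4 \<le> 1 - real (j \<epsilon>) * real m / real (n - k)"
    proof -
      have "real (j \<epsilon>) * real m \<le> real (j \<epsilon>) * (\<gamma> * real n)" using m by (intro mult_left_mono) auto
      also have "\<dots> = 8 * real (j \<epsilon>) * \<gamma> * (real n / 8)" by simp
      also have "\<dots> \<le> 1 * (real n / 8)" using \<gamma> by (intro mult_right_mono) auto
      also have "\<dots> \<le> real (n - k) / 4" using kn by (simp add: of_nat_diff)
      finally show ?thesis using kn by (simp add: divide_le_eq)
    qed
    let ?g = "slice_average k f"
    have g: "?g x \<in> {0..1}" if "x \<in> Pow ?U" for x
      using f that by (intro slice_average_bounds) (auto simp: nsets_def)
    have f0: "0 \<le> f y" if "y \<in> nsets ?U k" for y using f that by auto
    have gedge: "cube_edge p n ?g \<le> \<delta> \<epsilon>"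
      using cube_edge_slice_average_le[of n k f] f0 kn edge by simp
    have "\<exists>J T. J \<subseteq> ?U \<and> card J \<le> j \<epsilon> \<and> intersecting_family J T \<and>
        E J (\<lambda>w. indicator (Pow J - T) w * E (?U - J) (\<lambda>x. ?g (w \<union> x))) \<le> \<epsilon>"
      using rem[unfolded removal_property_def, rule_format, OF n1 \<epsilon> _ gedge] g by blast
    then obtain J T where J: "J \<subseteq> ?U" "card J \<le> j \<epsilon>" and T: "intersecting_family J T"
      and le: "E J (\<lambda>w. indicator (Pow J - T) w * E (?U - J) (\<lambda>x. ?g (w \<union> x))) \<le> \<epsilon>"
      by blast
    have fin: "finite J" "finite (?U - J)" "J \<inter> (?U - J) = {}" "J \<union> (?U - J) = ?U"
      using J finite_subset by auto
    define Q where "Q = (\<Sum>x\<in>{x \<in> nsets ?U k. x \<inter> J \<notin> T}. f x) / real (n choose k)"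
    have "0 \<le> Q" unfolding Q_def using f0 by (intro divide_nonneg_nonneg sum_nonneg) auto
    have "E ?U (\<lambda>z. indicator {z. z \<inter> J \<notin> T} z * ?g z)
        = E J (\<lambda>w. E (?U - J) (\<lambda>x. indicator {z. z \<inter> J \<notin> T} (w \<union> x) * ?g (w \<union> x)))"
      using E_union[OF fin(1-3)] fin(4) by simp
    also have "\<dots> = E J (\<lambda>w. indicator (Pow J - T) w * E (?U - J) (\<lambda>x. ?g (w \<union> x)))"
      unfolding E_cmult[symmetric]
    proof (intro E_cong)
      fix w x assume "w \<subseteq> J" "x \<subseteq> ?U - J"
      then have "(w \<union> x) \<inter> J = w" by auto
      then show "indicator {z. z \<inter> J \<notin> T} (w \<union> x) * ?g (w \<union> x) = indicator (Pow J - T) w * ?g (w \<union> x)"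
        using \<open>w \<subseteq> J\<close> by (simp add: indicator_def)
    qed
    finally have "E ?U (\<lambda>z. indicator {z. z \<inter> J \<notin> T} z * ?g z) \<le> \<epsilon>" using le by simp
    then have "(1 - real (j \<epsilon>) * real m / real (n - k)) * (\<Sum>i\<le>m. Bernstein n (k + i) p) * Q \<le> \<epsilon>"
      using slice_mass_le[of ?U n J "j \<epsilon>" k f m T] J f0 kn unfolding Q_def by force
    \<comment> \<open>The guaranteed factor is 3/10, so the bound obtained is in fact
      \<open>10 / 3 * \<epsilon>\<close>.\<close>
    moreover have "3 / 4 * (2 / 5) * Q \<le> (1 - real (j \<epsilon>) * real m / real (n - k)) * (\<Sum>i\<le>m. Bernstein n (k + i) p) * Q"
      using \<open>0 \<le> Q\<close> by (intro mult_right_mono mult_mono[OF hit win] order_trans[OF _ hit]) simp_all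
    ultimately have "Q \<le> 5 * \<epsilon>" using \<open>0 \<le> Q\<close> by linarith
    then show ?thesis using J T unfolding Q_def by blast
  qed
  then show ?thesis by (intro exI[of _ n0] allI impI, elim conjE)
qed

end

theorem theorem7p2:
  fixes p :: real
  assumes "0 < p" and "p < 1/2"
  shows "(\<exists>(\<delta> :: real \<Rightarrow> real) (j :: real \<Rightarrow> nat).
            \<delta> ` {0<..1} \<subseteq> {0<..1} \<and> removal_property p \<delta> j) \<and>
         (\<forall>(\<delta> :: real \<Rightarrow> real) (j :: real \<Rightarrow> nat).
            \<delta> ` {0<..1} \<subseteq> {0<..1} \<and> removal_property p \<delta> j \<longrightarrow>
            (\<forall>\<epsilon>\<in>{0<..1}. \<exists>n\<^sub>0 :: nat. \<forall>n\<ge>n\<^sub>0. \<forall>k :: nat. real k = p * real n \<and> k \<ge> 1 \<longrightarrow>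
               (\<forall>f. (\<forall>x\<in>nsets {1..n} k. f x \<in> {0..1}) \<longrightarrow> kneser_edge n k f \<le> \<delta> \<epsilon> \<longrightarrow>
                  (\<exists>J T. J \<subseteq> {1..n} \<and> card J \<le> j \<epsilon> \<and>
                     intersecting_family J T \<and>
                     (\<Sum>x\<in>{x \<in> nsets {1..n} k. x \<inter> J \<notin> T}. f x) / real (n choose k)
                       \<le> 5 * \<epsilon>))))"
proof -
  interpret biased_cube p by unfold_locales (fact assms)+
  show ?thesis
  proof (intro conjI allI impI ballI)
    show "\<exists>\<delta> j. \<delta> ` {0<..1} \<subseteq> {0<..1} \<and> removal_property p \<delta> j"
      by (rule removal_property_exists)
  next
    fix \<delta> :: "real \<Rightarrow> real" and j :: "real \<Rightarrow> nat" and \<epsilon> :: real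
    assume "\<delta> ` {0<..1} \<subseteq> {0<..1} \<and> removal_property p \<delta> j" and "\<epsilon> \<in> {0<..1}"
    then show "\<exists>n0. \<forall>n\<ge>n0. \<forall>k. real k = p * real n \<and> k \<ge> 1 \<longrightarrow>
      (\<forall>f. (\<forall>x\<in>nsets {1..n} k. f x \<in> {0..1}) \<longrightarrow> kneser_edge n k f \<le> \<delta> \<epsilon> \<longrightarrow>
        (\<exists>J T. J \<subseteq> {1..n} \<and> card J \<le> j \<epsilon> \<and> intersecting_family J T \<and>
          (\<Sum>x\<in>{x \<in> nsets {1..n} k. x \<inter> J \<notin> T}. f x) / real (n choose k) \<le> 5 * \<epsilon>))"
      by (intro kneser_removal) auto
  qed
qed

end
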